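(* Let $L=\bigoplus_{i\ge 1}L_i$ be an infinite-dimensional Nottingham algebra over a field $\mathbb{F}$ of characteristic $p$, with second diamond in degree $q$. Suppose that $L_{2q-1}$ is a diamond of infinite type, and suppose that the earliest diamond of finite type past $L_q$ (possibly fake) occurs in degree $a(q-1)+1$, and has type $\mu\in\mathbb{F}$. Then either $a-1$ equals a power of $p$, or $a$ equals twice a power of $p$ and $\mu=1$.
   Context: Lie products are written without commas and are left-normed: $[abc]=[[ab]c]$, and $[ab^i]=[ab\cdots b]$ with $b$ occurring $i$ times. A thin Lie algebra is a graded Lie algebra $L=\bigoplus_{i\ge 1}L_i$ over a field $\mathbb{F}$ with $\dim L_1=2$ satisfying the covering property: for each $i$ and each nonzero $z\in L_i$ one has $[zL_1]=L_{i+1}$. All homogeneous components then have dimension at most two. Components of dimension two are called (genuine) diamonds; $L_1$ is the first diamond, and thin Lie algebras are required to have at least one further diamond; the earliest diamond past $L_1$ is the second diamond. A Nottingham algebra is a thin Lie algebra over a field of characteristic $p>3$ with second diamond $L_q$, where $q>5$ is a power of $p$. Standard generators: in a Nottingham algebra $L$ with second diamond $L_q$ there are generators $x,y$ of $L_1$, each unique up to scalar multiples, such that $[yxy]=0$ and, setting $v_1=[yx^{q-2}]$ (which spans $L_{q-1}$), $[v_1xx]=0=[v_1yy]$ and $[v_1yx]=-2[v_1xy]$. Types: let $L_m$ be a two-dimensional component with $m>1$ and $L_{m+1}\ne 0$, and let $w$ be a nonzero element of $L_{m-1}$ (which is one-dimensional). $L_m$ is a diamond of finite type $\mu\in\mathbb{F}$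 if $[wxx]=0=[wyy]$ and $\mu[wyx]=(1-\mu)[wxy]$; it is a diamond of infinite type if $[wxx]=0=[wyy]$ and $[wyx]=-[wxy]$. (The second diamond $L_q$ always has type $-1$; $L_1$ has no type; for two-dimensional $L_m$ one always has $\mu\ne 0,1$.) Fake diamonds: if $L_{m-1}$ is one-dimensional, spanned by $w$, with $m>1$ and $L_{m+1}\neq 0$, then $L_m$ is a (fake) diamond of type $1$ if $[wxx]=0$ and $[wy]=0$, and a (fake) diamond of type $0$ if $[wx]=0$ and $[wyy]=0$; fake diamonds are one-dimensional components and count as diamonds of finite type. If $L_m$ satisfies the definition of type $1$ then $L_{m+1}$ satisfies the definition of type $0$; by convention one calls (fake) diamond precisely one of $L_m$, $L_{m+1}$, of the appropriate type, and not the other. It is known that consecutive diamonds differ in degree by $q-1$ (with a suitable choice, under the convention, for fake diamonds); in particular the earliest diamond of finite type past $L_q$ has degree of the form $a(q-1)+1$ with $a$ an integer, and here $L_{k(q-1)+1}$ is a diamond of infinite type for $2\le k\le a-1$. *)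

theory Defs
  imports Complex_Main
begin

text \<open>
  The product is written as a left-associative infix, so that \<open>a \<cdot> b \<cdot> c\<close> is the left-normed
  product of \<open>a\<close>, \<open>b\<close>, \<open>c\<close>.
\<close>

locale lie_algebra = vector_space scale
  for scale :: "'f::field \<Rightarrow> 'v::ab_group_add \<Rightarrow> 'v" +
  fixes br :: "'v \<Rightarrow> 'v \<Rightarrow> 'v" (infixl \<open>\<cdot>\<close> 70)
  assumes linear_left: "Vector_Spaces.linear scale scale (\<lambda>a. a \<cdot> b)"
    and linear_right: "Vector_Spaces.linear scale scale (\<lambda>b. a \<cdot> b)"
    and alternating: "a \<cdot> a = 0"
    and jacobi: "a \<cdot> b \<cdot> c + b \<cdot> c \<cdot> a + c \<cdot> a \<cdot> b = 0"
begin

definition infinite_dimensional :: bool where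
  "infinite_dimensional \<longleftrightarrow> \<not> (\<exists>B. finite B \<and> span B = UNIV)"

definition left_normed_pow :: "'v \<Rightarrow> 'v \<Rightarrow> nat \<Rightarrow> 'v" where
  "left_normed_pow a b i = ((\<lambda>u. u \<cdot> b) ^^ i) a"

end

text \<open>
  The whole type is the direct sum of the components \<open>L i\<close> with \<open>i \<ge> 1\<close>; the value \<open>L 0\<close> is
  irrelevant.
\<close>

locale graded_lie_algebra = lie_algebra scale br
  for scale :: "'f::field \<Rightarrow> 'v::ab_group_add \<Rightarrow> 'v"
    and br :: "'v \<Rightarrow> 'v \<Rightarrow> 'v" (infixl \<open>\<cdot>\<close> 70) +
  fixes L :: "nat \<Rightarrow> 'v set"
  assumes subspace_component: "1 \<le> i \<Longrightarrow> subspace (L i)"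
    and span_components: "span (\<Union>i\<in>{1..}. L i) = UNIV"
    and independent_components:
      "\<lbrakk>finite I; I \<subseteq> {1..}; \<And>i. i \<in> I \<Longrightarrow> u i \<in> L i; (\<Sum>i\<in>I. u i) = 0; j \<in> I\<rbrakk> \<Longrightarrow> u j = 0"
    and graded: "\<lbrakk>1 \<le> i; 1 \<le> j; a \<in> L i; b \<in> L j\<rbrakk> \<Longrightarrow> a \<cdot> b \<in> L (i + j)"

text \<open>
  The covering property says nothing about \<open>L (i + 1)\<close> when \<open>L i\<close> is zero. The assumption
  \<open>no_gaps\<close> makes explicit that a thin Lie algebra is generated by \<open>L 1\<close>: given the covering
  property, this amounts to no nonzero component following a zero one.
\<close>

locale thin_lie_algebra = graded_lie_algebra scale br L
  for scale :: "'f::field \<Rightarrow> 'v::ab_group_add \<Rightarrow> 'v"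
    and br :: "'v \<Rightarrow> 'v \<Rightarrow> 'v" (infixl \<open>\<cdot>\<close> 70)
    and L :: "nat \<Rightarrow> 'v set" +
  assumes dim_L1: "dim (L 1) = 2"
    and covering: "\<lbrakk>1 \<le> i; z \<in> L i; z \<noteq> 0\<rbrakk> \<Longrightarrow> (\<lambda>u. z \<cdot> u) ` L 1 = L (i + 1)"
    and no_gaps: "\<lbrakk>1 \<le> i; L i = {0}\<rbrakk> \<Longrightarrow> L (i + 1) = {0}"
    and further_diamond: "\<exists>m>1. dim (L m) = 2"
begin

definition second_diamond :: "nat \<Rightarrow> bool" where
  "second_diamond m \<longleftrightarrow> 1 < m \<and> dim (L m) = 2 \<and> (\<forall>i. 1 < i \<and> i < m \<longrightarrow> dim (L i) \<noteq> 2)"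

text \<open>
  Diamond types are relative to a pair \<open>x\<close>, \<open>y\<close> of elements of \<open>L 1\<close>, meant to be standard
  generators (see below).
\<close>

definition infinite_type_diamond :: "'v \<Rightarrow> 'v \<Rightarrow> nat \<Rightarrow> bool" where
  "infinite_type_diamond x y m \<longleftrightarrow>
     1 < m \<and> dim (L m) = 2 \<and> L (m + 1) \<noteq> {0} \<and>
     (\<exists>w\<in>L (m - 1). w \<noteq> 0 \<and> w \<cdot> x \<cdot> x = 0 \<and> w \<cdot> y \<cdot> y = 0 \<and> w \<cdot> y \<cdot> x = - (w \<cdot> x \<cdot> y))"

definition genuine_finite_type_diamond :: "'v \<Rightarrow> 'v \<Rightarrow> nat \<Rightarrow> 'f \<Rightarrow> bool" where
  "genuine_finite_type_diamond x y m \<mu> \<longleftrightarrow>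
     1 < m \<and> dim (L m) = 2 \<and> L (m + 1) \<noteq> {0} \<and>
     (\<exists>w\<in>L (m - 1). w \<noteq> 0 \<and> w \<cdot> x \<cdot> x = 0 \<and> w \<cdot> y \<cdot> y = 0 \<and>
        scale \<mu> (w \<cdot> y \<cdot> x) = scale (1 - \<mu>) (w \<cdot> x \<cdot> y))"

definition fake_diamond_1 :: "'v \<Rightarrow> 'v \<Rightarrow> nat \<Rightarrow> bool" where
  "fake_diamond_1 x y m \<longleftrightarrow>
     1 < m \<and> dim (L (m - 1)) = 1 \<and> L (m + 1) \<noteq> {0} \<and>
     (\<exists>w. span {w} = L (m - 1) \<and> w \<cdot> x \<cdot> x = 0 \<and> w \<cdot> y = 0)"

definition fake_diamond_0 :: "'v \<Rightarrow> 'v \<Rightarrow> nat \<Rightarrow> bool" where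
  "fake_diamond_0 x y m \<longleftrightarrow>
     1 < m \<and> dim (L (m - 1)) = 1 \<and> L (m + 1) \<noteq> {0} \<and>
     (\<exists>w. span {w} = L (m - 1) \<and> w \<cdot> x = 0 \<and> w \<cdot> y \<cdot> y = 0)"

definition finite_type_diamond :: "'v \<Rightarrow> 'v \<Rightarrow> nat \<Rightarrow> 'f \<Rightarrow> bool" where
  "finite_type_diamond x y m \<mu> \<longleftrightarrow>
     genuine_finite_type_diamond x y m \<mu> \<or>
     (\<mu> = 1 \<and> fake_diamond_1 x y m) \<or> (\<mu> = 0 \<and> fake_diamond_0 x y m)"

end

locale nottingham_algebra = thin_lie_algebra scale br L
  for scale :: "'f::field \<Rightarrow> 'v::ab_group_add \<Rightarrow> 'v"
    and br :: "'v \<Rightarrow> 'v \<Rightarrow> 'v" (infixl \<open>\<cdot>\<close> 70)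
    and L :: "nat \<Rightarrow> 'v set" +
  fixes p q :: nat
  assumes characteristic: "CHAR('f) = p" and "p > 3"
    and power: "\<exists>n. q = p ^ n" and "q > 5"
    and second_diamond_q: "second_diamond q"
begin

definition standard_generators :: "'v \<Rightarrow> 'v \<Rightarrow> bool" where
  "standard_generators x y \<longleftrightarrow>
     span {x, y} = L 1 \<and> y \<cdot> x \<cdot> y = 0 \<and>
     (let v = left_normed_pow y x (q - 2) in
        span {v} = L (q - 1) \<and> v \<cdot> x \<cdot> x = 0 \<and> v \<cdot> y \<cdot> y = 0 \<and>
        v \<cdot> y \<cdot> x = scale (- 2) (v \<cdot> x \<cdot> y))"

text \<open>
  If \<open>L m\<close> satisfies the definition of type 1, then \<open>L (m + 1)\<close> satisfies that of type 0, and only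
  one of the two is called a diamond. Hence when a fake diamond of type 0 is considered in
  degree \<open>d\<close>, the component \<open>L (d - 1)\<close> may satisfy the definition of type 1 without being counted
  as an earlier diamond.
\<close>

definition earliest_finite_type_diamond :: "'v \<Rightarrow> 'v \<Rightarrow> nat \<Rightarrow> 'f \<Rightarrow> bool" where
  "earliest_finite_type_diamond x y d \<mu> \<longleftrightarrow>
     q < d \<and> finite_type_diamond x y d \<mu> \<and>
     (\<forall>m \<nu>. q < m \<and> m < d \<and> finite_type_diamond x y m \<nu> \<longrightarrow>
        m + 1 = d \<and> fake_diamond_1 x y m \<and> fake_diamond_0 x y d)"

end

end

theory Submission
  imports Defs "HOL-Computational_Algebra.Primes"
begin

text \<open>
  Write \<open>v\<^sub>1 = [yx\<^sup>q\<^sup>-\<^sup>2]\<close> and \<open>v\<^sub>k\<^sub>+\<^sub>1 = [v\<^sub>kxyx\<^sup>q\<^sup>-\<^sup>3]\<close>, so that \<open>v\<^sub>k\<close> spans the component just below the \<open>k\<close>-th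
  diamond past \<open>L\<^sub>1\<close>. As long as the diamonds are of infinite type, \<open>ad v\<^sub>1\<close> maps \<open>v\<^sub>k\<close> to \<open>v\<^sub>k\<^sub>+\<^sub>1\<close> and commutes
  with the action of \<open>x\<close> and \<open>y\<close>, and \<open>[v\<^sub>iv\<^sub>j] = 0\<close> for \<open>i, j \<ge> 2\<close> and \<open>i + j \<le> a\<close>. The diamond of finite
  type above \<open>v\<^sub>a\<close> is felt for the first time at \<open>i + j = a + 1\<close>: there
  \<open>[v\<^sub>iv\<^sub>j] = 2 (-1)\<^sup>j\<^sup>-\<^sup>1 w\<close>, where \<open>w\<close> spans the component in degree \<open>(a + 1)(q - 1)\<close>. This forces
  \<open>a\<close> to be even. Either \<open>w\<close> lies below a diamond of infinite type, or \<open>\<mu> = 1\<close> and \<open>[wx]\<close> does. In both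
  cases the Jacobi identity with the vanishing of \<open>[v\<^sub>iv\<^sub>j]\<close> below level \<open>a + 1\<close> shows that about \<open>a / 2\<close>
  further diamonds are of infinite type, whence \<open>[wv\<^sub>1\<^sup>s] \<noteq> 0\<close> for \<open>s < a / 2\<close>. At each of these levels
  \<open>[v\<^sub>iv\<^sub>j]\<close> is a multiple of \<open>[wv\<^sub>1\<^sup>s]\<close> whose coefficient obeys Pascal's recursion, with boundary
  value \<open>2\<close> along \<open>s = 0\<close> and \<open>\<tau>\<close> along \<open>i = a\<close>; here \<open>\<tau> = 1\<close> in the first case and \<open>\<tau> = 2\<close> in the
  second. Its antisymmetry for \<open>s\<close> the \<open>p\<close>-part of \<open>a - 1\<close>, respectively of \<open>a\<close>, gives the theorem.
\<close>

text \<open>Most of the work goes into the chains between diamonds: \<open>y\<close> must kill every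
  component strictly between two vertices. The tool is that \<open>y\<close> commutes with [y x^j]
  for j \<le> q - 3, so ad y commutes with ad [y x^j], and evaluating a product in two ways gives a
  scalar times [t x^i y] = 0. The scalar is typically affine in i and therefore vanishes modulo p
  for some i; these exceptional degrees shape the chain lemmas, since there a second relation has to
  step in, often one that starts lower down.

  Infinite dimension is used in this form: no component is zero, so a homogeneous element killed by
  \<open>x\<close> and \<open>y\<close> is zero.

  The bound s < a / 2 comes from writing \<open>w\<close>, for a = 2 m, as a nonzero multiple of
  [v_{m+1} v_m]: whatever kills both factors kills \<open>w\<close>.

  The p-part is the right s because C(b p^e, p^e) = b modulo p. With s = p^e, antisymmetry becomes 2
  b = 0, which is absurd. This s exceeds the admissible range exactly when b = 1 in the first case
  and b = 2 in the second.\<close>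

context lie_algebra
begin

section \<open>Elementary bracket calculus\<close>

lemma module_hom_left: "module_hom scale scale (\<lambda>a. a \<cdot> b)"
  using linear_left[of b] by (simp add: Vector_Spaces.linear_def)

lemma module_hom_right: "module_hom scale scale (\<lambda>b. a \<cdot> b)"
  using linear_right[of a] by (simp add: Vector_Spaces.linear_def)

lemma br_add_left: "(a + b) \<cdot> c = a \<cdot> c + b \<cdot> c"
  by (rule module_hom.add[OF module_hom_left])

lemma br_add_right: "a \<cdot> (b + c) = a \<cdot> b + a \<cdot> c"
  by (rule module_hom.add[OF module_hom_right])

lemma br_scale_left: "scale r a \<cdot> b = scale r (a \<cdot> b)"
  by (rule module_hom.scale[OF module_hom_left])

lemma br_scale_right: "a \<cdot> scale r b = scale r (a \<cdot> b)"
  by (rule module_hom.scale[OF module_hom_right])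

lemma br_zero_left [simp]: "0 \<cdot> b = 0"
  by (rule module_hom.zero[OF module_hom_left])

lemma br_zero_right [simp]: "a \<cdot> 0 = 0"
  by (rule module_hom.zero[OF module_hom_right])

lemma br_minus_left: "(- a) \<cdot> b = - (a \<cdot> b)"
  by (rule module_hom.neg[OF module_hom_left])

lemma br_minus_right: "a \<cdot> (- b) = - (a \<cdot> b)"
  by (rule module_hom.neg[OF module_hom_right])

lemma br_diff_left: "(a - b) \<cdot> c = a \<cdot> c - b \<cdot> c"
  by (rule module_hom.diff[OF module_hom_left])

lemma br_diff_right: "a \<cdot> (b - c) = a \<cdot> b - a \<cdot> c"
  by (rule module_hom.diff[OF module_hom_right])

lemma br_sum_left: "(\<Sum>i\<in>I. f i) \<cdot> b = (\<Sum>i\<in>I. f i \<cdot> b)"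
  by (rule module_hom.sum[OF module_hom_left])

lemmas br_lin = br_add_left br_add_right br_scale_left br_scale_right br_minus_left br_minus_right
  br_diff_left br_diff_right

lemma br_swap: "a \<cdot> b = - (b \<cdot> a)"
proof -
  have "(a + b) \<cdot> (a + b) = 0" by (rule alternating)
  then have "a \<cdot> b + b \<cdot> a = 0" unfolding br_add_left br_add_right by (simp add: alternating add.commute)
  then show ?thesis by (simp add: eq_neg_iff_add_eq_0)
qed

lemma br_br: "a \<cdot> (b \<cdot> c) = a \<cdot> b \<cdot> c - a \<cdot> c \<cdot> b"
proof -
  have "a \<cdot> b \<cdot> c + b \<cdot> c \<cdot> a + c \<cdot> a \<cdot> b = 0" by (rule jacobi)
  moreover have "b \<cdot> c \<cdot> a = - (a \<cdot> (b \<cdot> c))" by (rule br_swap)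
  moreover have "c \<cdot> a \<cdot> b = - (a \<cdot> c \<cdot> b)" by (subst br_swap[of c a]) (simp add: br_lin)
  ultimately show ?thesis by (simp add: algebra_simps add_eq_0_iff)
qed

text \<open>Numerals are split into sums so that identities can be closed by cancellation in the group.\<close>

lemma scale_numeral_Bit0: "scale (numeral (num.Bit0 n)) u = scale (numeral n) u + scale (numeral n) u"
  by (simp only: numeral_Bit0 scale_left_distrib)

lemma scale_numeral_Bit1: "scale (numeral (num.Bit1 n)) u = scale (numeral n) u + scale (numeral n) u + u"
  by (simp only: numeral_Bit1 scale_left_distrib scale_one)

lemmas scale_simps = scale_left_distrib scale_left_diff_distrib scale_right_distrib
  scale_right_diff_distrib scale_numeral_Bit0 scale_numeral_Bit1

section \<open>Expansions of products with [d x^n]\<close>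

lemma lnp_0 [simp]: "left_normed_pow c x 0 = c"
  by (simp add: left_normed_pow_def)

lemma lnp_Suc [simp]: "left_normed_pow c x (Suc n) = left_normed_pow c x n \<cdot> x"
  by (simp add: left_normed_pow_def)

lemma lnp_lnp: "left_normed_pow (left_normed_pow c x m) x n = left_normed_pow c x (m + n)"
  by (induction n) simp_all

lemma lnp_Suc2: "left_normed_pow c x (Suc n) = left_normed_pow (c \<cdot> x) x n"
  using lnp_lnp[of c x 1 n] by simp

lemma lnp_zero [simp]: "left_normed_pow 0 x n = 0"
  by (induction n) simp_all

lemma lnp_add: "left_normed_pow (c + d) x n = left_normed_pow c x n + left_normed_pow d x n"
  by (induction n) (simp_all add: br_lin)

lemma lnp_diff: "left_normed_pow (c - d) x n = left_normed_pow c x n - left_normed_pow d x n"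
  by (induction n) (simp_all add: br_lin)

lemma lnp_scale: "left_normed_pow (scale r c) x n = scale r (left_normed_pow c x n)"
  by (induction n) (simp_all add: br_lin)

lemma lnp_minus: "left_normed_pow (- c) x n = - left_normed_pow c x n"
  by (induction n) (simp_all add: br_lin)

lemmas lnp_lin = lnp_add lnp_diff lnp_scale lnp_minus

text \<open>The generalized Jacobi identity: up to sign, ad [d x^n] is an n-fold commutator of ad d
  with ad x, which expands with alternating binomial coefficients.\<close>

lemma br_lnp:
  "c \<cdot> left_normed_pow d x n =
    (\<Sum>l\<le>n. scale ((-1) ^ l * of_nat (n choose l))
      (left_normed_pow (left_normed_pow c x l \<cdot> d) x (n - l)))"
proof (induction n arbitrary: c)
  case 0
  show ?case by simp
next
  case (Suc n)
  let ?g = "\<lambda>l m. left_normed_pow (left_normed_pow c x l \<cdot> d) x m"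
  let ?s = "\<lambda>n l. (-1) ^ l * of_nat (n choose l) :: 'f"
  have A: "c \<cdot> left_normed_pow d x n \<cdot> x = (\<Sum>l\<le>n. scale (?s n l) (?g l (Suc n - l)))"
    unfolding Suc.IH br_sum_left by (intro sum.cong) (auto simp: br_lin Suc_diff_le)
  also have "\<dots> = (\<Sum>l\<le>Suc n. scale (?s n l) (?g l (Suc n - l)))"
    by (simp add: binomial_eq_0)
  also have "\<dots> = ?g 0 (Suc n) + (\<Sum>l\<le>n. scale (?s n (Suc l)) (?g (Suc l) (n - l)))"
    by (subst sum.atMost_Suc_shift) simp
  finally have A: "c \<cdot> left_normed_pow d x n \<cdot> x = \<dots>" .
  have B: "c \<cdot> x \<cdot> left_normed_pow d x n = (\<Sum>l\<le>n. scale (?s n l) (?g (Suc l) (n - l)))"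
    unfolding Suc.IH by (simp only: lnp_Suc2)
  have "c \<cdot> left_normed_pow d x (Suc n) = c \<cdot> left_normed_pow d x n \<cdot> x - c \<cdot> x \<cdot> left_normed_pow d x n"
    by (simp add: br_br)
  also have "\<dots> = ?g 0 (Suc n) + (\<Sum>l\<le>n. scale (?s (Suc n) (Suc l)) (?g (Suc l) (n - l)))"
    unfolding A B add_diff_eq[symmetric] sum_subtractf[symmetric]
    by (intro arg_cong2[where f = "(+)"] refl sum.cong)
      (simp_all add: scale_left_diff_distrib[symmetric] algebra_simps del: lnp_Suc)
  also have "\<dots> = (\<Sum>l\<le>Suc n. scale (?s (Suc n) l) (?g l (Suc n - l)))"
    by (subst sum.atMost_Suc_shift) simp
  finally show ?case .
qed

text \<open>Leibniz's rule for the derivation given by right multiplication by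
  \<open>x\<close>.\<close>

lemma lnp_br:
  "left_normed_pow (a \<cdot> b) x n =
    (\<Sum>l\<le>n. scale (of_nat (n choose l)) (left_normed_pow a x l \<cdot> left_normed_pow b x (n - l)))"
proof (induction n)
  case 0
  show ?case by simp
next
  case (Suc n)
  let ?g = "\<lambda>l m. left_normed_pow a x l \<cdot> left_normed_pow b x m"
  let ?s = "\<lambda>n l. of_nat (n choose l) :: 'f"
  have der: "u \<cdot> w \<cdot> x = u \<cdot> x \<cdot> w + u \<cdot> (w \<cdot> x)" for u w
    by (simp add: br_br)
  have "left_normed_pow (a \<cdot> b) x (Suc n) =
      (\<Sum>l\<le>n. scale (?s n l) (?g (Suc l) (n - l))) + (\<Sum>l\<le>n. scale (?s n l) (?g l (Suc n - l)))"
    unfolding lnp_Suc Suc.IH br_sum_left sum.distrib[symmetric]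
    by (intro sum.cong) (auto simp: br_scale_left der Suc_diff_le scale_right_distrib)
  also have "(\<Sum>l\<le>n. scale (?s n l) (?g l (Suc n - l))) = (\<Sum>l\<le>Suc n. scale (?s n l) (?g l (Suc n - l)))"
    by (simp add: binomial_eq_0)
  also have "\<dots> = ?g 0 (Suc n) + (\<Sum>l\<le>n. scale (?s n (Suc l)) (?g (Suc l) (n - l)))"
    by (subst sum.atMost_Suc_shift) simp
  finally have "left_normed_pow (a \<cdot> b) x (Suc n) =
     ?g 0 (Suc n) + (\<Sum>l\<le>n. scale (?s (Suc n) (Suc l)) (?g (Suc l) (n - l)))"
    by (simp add: scale_left_distrib sum.distrib add_ac del: lnp_Suc)
  also have "\<dots> = (\<Sum>l\<le>Suc n. scale (?s (Suc n) l) (?g l (Suc n - l)))"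
    by (subst sum.atMost_Suc_shift) simp
  finally show ?case .
qed

text \<open>The form of \<open>br_lnp\<close> for a chain killed by \<open>d\<close> up to step i:
  only the last n + 1 summands remain, and n is at most 2 in the applications.\<close>

lemma br_lnp_tail:
  assumes "\<And>l. l < i \<Longrightarrow> left_normed_pow c x l \<cdot> d = 0"
  shows "c \<cdot> left_normed_pow d x (i + n) =
    (\<Sum>l\<le>n. scale ((-1) ^ (i + l) * of_nat ((i + n) choose (i + l)))
      (left_normed_pow (left_normed_pow c x (i + l) \<cdot> d) x (n - l)))"
proof -
  have "c \<cdot> left_normed_pow d x (i + n) =
      (\<Sum>l\<in>{i..i+n}. scale ((-1) ^ l * of_nat ((i + n) choose l))
        (left_normed_pow (left_normed_pow c x l \<cdot> d) x (i + n - l)))"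
    unfolding br_lnp by (rule sum.mono_neutral_right) (auto simp: assms not_le)
  also have "\<dots> = (\<Sum>l\<in>{0..n}. scale ((-1) ^ (i + l) * of_nat ((i + n) choose (i + l)))
        (left_normed_pow (left_normed_pow c x (i + l) \<cdot> d) x (i + n - (i + l))))"
    using sum.shift_bounds_cl_nat_ivl[of "\<lambda>l. scale ((-1) ^ l * of_nat ((i + n) choose l))
        (left_normed_pow (left_normed_pow c x l \<cdot> d) x (i + n - l))" 0 i n]
    by (simp add: add.commute[of _ i])
  finally show ?thesis by (simp add: atMost_atLeast0)
qed

lemma br_lnp_cut:
  assumes "\<And>l. l \<notin> S \<Longrightarrow> l \<le> n \<Longrightarrow> left_normed_pow c x l \<cdot> d = 0" and "S \<subseteq> {..n}"
  shows "c \<cdot> left_normed_pow d x n =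
    (\<Sum>l\<in>S. scale ((-1) ^ l * of_nat (n choose l))
      (left_normed_pow (left_normed_pow c x l \<cdot> d) x (n - l)))"
  unfolding br_lnp using assms by (intro sum.mono_neutral_right) auto

declare lnp_Suc [simp del]

text \<open>The opposite situation to \<open>br_lnp_tail\<close>: \<open>c\<close> lies just below a
  diamond, so that only the first two summands remain.\<close>

lemma br_lnp_head:
  assumes "c \<cdot> x \<cdot> x = 0"
  shows "c \<cdot> left_normed_pow d x i =
    left_normed_pow (c \<cdot> d) x i - scale (of_nat i) (left_normed_pow (c \<cdot> x \<cdot> d) x (i - 1))"
proof (cases i)
  case (Suc n)
  have "left_normed_pow c x l \<cdot> d = 0" if "l \<notin> {0, 1}" for l
  proof -
    have "1 < l" using that by auto
    then obtain m where "l = Suc (1 + m)" using less_imp_Suc_add by blast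
    then show ?thesis using assms by (simp add: lnp_Suc2)
  qed
  then have "c \<cdot> left_normed_pow d x i = (\<Sum>l\<in>{0, 1}. scale ((-1) ^ l * of_nat (i choose l))
      (left_normed_pow (left_normed_pow c x l \<cdot> d) x (i - l)))"
    using Suc by (intro br_lnp_cut) auto
  then show ?thesis using Suc by (simp add: lnp_Suc scale_left_diff_distrib scale_left_distrib)
qed simp

lemma br_lnp_last:
  assumes "\<And>l. l < i \<Longrightarrow> left_normed_pow c x l \<cdot> d = 0"
  shows "c \<cdot> left_normed_pow d x i = scale ((-1) ^ i) (left_normed_pow c x i \<cdot> d)"
  using br_lnp_tail[of i c x d 0] assms by simp

end

text \<open>From i C(p^n, i) = p^n C(p^n - 1, i - 1): if p did not divide the binomial coefficient,
  p^n would divide i.\<close>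

lemma prime_power_dvd_choose:
  fixes p :: nat
  assumes "prime p" "0 < i" "i < p ^ n"
  shows "p dvd (p ^ n choose i)"
proof (rule ccontr)
  assume "\<not> p dvd (p ^ n choose i)"
  then have "coprime (p ^ n) (p ^ n choose i)"
    using assms(1) by (simp add: prime_imp_coprime)
  moreover have "p ^ n dvd i * (p ^ n choose i)"
    using assms(2) by (simp add: times_binomial_minus1_eq)
  ultimately have "p ^ n dvd i" by (simp add: coprime_dvd_mult_left_iff)
  then show False using assms(2,3) by (simp add: nat_dvd_not_less)
qed

text \<open>The number \<open>h = q - 3\<close> counts the factors \<open>x\<close> that lead from \<open>[vxy]\<close> to the vertex after \<open>v\<close>.\<close>

locale nottingham_generators = nottingham_algebra scale br L p q
  for scale :: "'f::field \<Rightarrow> 'v::ab_group_add \<Rightarrow> 'v"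
    and br :: "'v \<Rightarrow> 'v \<Rightarrow> 'v" (infixl \<open>\<cdot>\<close> 70)
    and L :: "nat \<Rightarrow> 'v set"
    and p q :: nat +
  fixes x y :: 'v and h :: nat
  assumes generators: "standard_generators x y"
    and q_eq: "q = h + 3"
    and infinite: infinite_dimensional
begin

abbreviation xpow :: "'v \<Rightarrow> nat \<Rightarrow> 'v" (infixl \<open>\<lhd>\<close> 70)
  where "c \<lhd> n \<equiv> left_normed_pow c x n"

definition v1 :: 'v where "v1 = y \<lhd> Suc h"

subsection \<open>Arithmetic in the field\<close>

lemma p_gt_3: "p > 3" and q_gt_5: "q > 5"
  using nottingham_algebra_axioms
  by (simp_all add: nottingham_algebra_def nottingham_algebra_axioms_def)

lemma prime_p: "prime p"
  using prime_CHAR_semidom[where ?'a = 'f] characteristic p_gt_3 by simp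

lemma of_nat_0_iff: "(of_nat n :: 'f) = 0 \<longleftrightarrow> p dvd n"
  by (simp add: of_nat_eq_0_iff_char_dvd characteristic)

lemma small_nonzero: "0 < n \<Longrightarrow> n < p \<Longrightarrow> (of_nat n :: 'f) \<noteq> 0"
  by (auto simp: of_nat_0_iff dest: dvd_imp_le)

lemma p_odd: "odd p"
  using prime_odd_nat[OF prime_p] p_gt_3 by simp

lemma p_ge_5: "p \<ge> 5"
  using p_odd p_gt_3 by presburger

lemma two_nonzero [simp]: "(2 :: 'f) \<noteq> 0"
  and three_nonzero [simp]: "(3 :: 'f) \<noteq> 0"
  and four_nonzero [simp]: "(4 :: 'f) \<noteq> 0"
  using small_nonzero[of 2] small_nonzero[of 3] small_nonzero[of 4] p_ge_5 by simp_all

lemma q_odd: "odd q"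
  using power p_odd by auto

lemma even_h: "even h"
  using q_odd q_eq by presburger

lemma h_ge: "h \<ge> 4"
  using q_gt_5 q_eq even_h by presburger

lemma p_dvd_q: "p dvd q"
proof -
  obtain n where n: "q = p ^ n" using power by blast
  then have "n \<noteq> 0" using q_gt_5 by (intro notI) simp
  then show ?thesis using n by simp
qed

lemma of_nat_q [simp]: "(of_nat q :: 'f) = 0"
  by (simp add: of_nat_0_iff p_dvd_q)

lemma of_nat_h [simp]: "(of_nat h :: 'f) = - 3"
proof -
  have "of_nat h + (3 :: 'f) = 0" using of_nat_q unfolding q_eq by simp
  then show ?thesis by (rule eq_neg_iff_add_eq_0[THEN iffD2])
qed

lemma choose_q:
  assumes "0 < i" "i < q" shows "(of_nat (q choose i) :: 'f) = 0"
proof -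
  obtain n where "q = p ^ n" using power by blast
  then show ?thesis using prime_power_dvd_choose[OF prime_p, of i n] assms of_nat_0_iff by metis
qed

lemma of_nat_pascal:
  "(of_nat (n choose Suc i) :: 'f) = of_nat (Suc n choose Suc i) - of_nat (n choose i)"
  by simp

lemma choose_q1: "i < q \<Longrightarrow> (of_nat ((h + 2) choose i) :: 'f) = (-1) ^ i"
proof (induction i)
  case (Suc i)
  have "Suc (h + 2) = q" by (simp add: q_eq)
  then have "(of_nat ((h + 2) choose Suc i) :: 'f) = of_nat (q choose Suc i) - of_nat ((h + 2) choose i)"
    by (metis of_nat_pascal)
  also have "of_nat (q choose Suc i) = (0 :: 'f)" using Suc.prems by (intro choose_q) auto
  also have "(of_nat ((h + 2) choose i) :: 'f) = (-1) ^ i" using Suc by simp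
  finally show ?case by simp
qed simp

lemma choose_q2: "i < q \<Longrightarrow> (of_nat ((h + 1) choose i) :: 'f) = (-1) ^ i * of_nat (i + 1)"
proof (induction i)
  case (Suc i)
  have "Suc (h + 1) = h + 2" by simp
  then have "(of_nat ((h + 1) choose Suc i) :: 'f) =
      of_nat ((h + 2) choose Suc i) - of_nat ((h + 1) choose i)"
    by (metis of_nat_pascal)
  also have "(of_nat ((h + 2) choose Suc i) :: 'f) = (-1) ^ Suc i" using Suc.prems by (rule choose_q1)
  also have "(of_nat ((h + 1) choose i) :: 'f) = (-1) ^ i * of_nat (i + 1)" using Suc by simp
  also have "(-1) ^ Suc i - (-1) ^ i * of_nat (i + 1) = ((-1) ^ Suc i * of_nat (Suc i + 1) :: 'f)"
    by (simp add: algebra_simps)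
  finally show ?case .
qed simp

lemma scale_cancel: "scale r u = 0 \<Longrightarrow> r \<noteq> 0 \<Longrightarrow> u = 0"
  by simp

lemma double_zero: "u + u = 0 \<Longrightarrow> u = 0" for u :: 'v
  using scale_cancel[of 2 u] by (simp add: scale_simps)

subsection \<open>Homogeneous elements\<close>

lemma span_xy: "span {x, y} = L 1"
  and yxy: "y \<cdot> x \<cdot> y = 0"
  and span_v1: "span {v1} = L (h + 2)"
  and v1xx: "v1 \<cdot> x \<cdot> x = 0"
  and v1yy: "v1 \<cdot> y \<cdot> y = 0"
  and v1yx: "v1 \<cdot> y \<cdot> x = scale (- 2) (v1 \<cdot> x \<cdot> y)"
proof -
  have "q - 2 = Suc h" "q - 1 = h + 2" by (simp_all add: q_eq)
  with generators show "span {x, y} = L 1" "y \<cdot> x \<cdot> y = 0" "span {v1} = L (h + 2)"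
    "v1 \<cdot> x \<cdot> x = 0" "v1 \<cdot> y \<cdot> y = 0" "v1 \<cdot> y \<cdot> x = scale (- 2) (v1 \<cdot> x \<cdot> y)"
    unfolding standard_generators_def Let_def v1_def by simp_all
qed

lemma x_L1: "x \<in> L 1" and y_L1: "y \<in> L 1"
  using span_xy span_base[of x "{x, y}"] span_base[of y "{x, y}"] by auto

lemma L1_cases:
  assumes "u \<in> L 1" obtains \<alpha> \<beta> where "u = scale \<alpha> x + scale \<beta> y"
proof -
  have "u \<in> span {x, y}" using assms span_xy by simp
  then obtain \<alpha> \<beta> where "u - scale \<alpha> x = scale \<beta> y"
    by (auto simp: span_breakdown_eq[of u x] span_singleton)
  then show ?thesis using that[of \<alpha> \<beta>] by (simp add: diff_eq_eq add.commute)
qed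

lemma L_x: "c \<in> L m \<Longrightarrow> 1 \<le> m \<Longrightarrow> c \<cdot> x \<in> L (Suc m)"
  using graded[of m 1 c x] x_L1 by simp

lemma L_y: "c \<in> L m \<Longrightarrow> 1 \<le> m \<Longrightarrow> c \<cdot> y \<in> L (Suc m)"
  using graded[of m 1 c y] y_L1 by simp

lemma L_xpow: "c \<in> L m \<Longrightarrow> 1 \<le> m \<Longrightarrow> c \<lhd> n \<in> L (m + n)"
  by (induction n) (auto simp: lnp_Suc intro: L_x)

lemma L_step:
  assumes "c \<in> L m" "1 \<le> m" "c \<noteq> 0" "d \<in> L (Suc m)"
  obtains \<alpha> \<beta> where "d = scale \<alpha> (c \<cdot> x) + scale \<beta> (c \<cdot> y)"
proof -
  have "d \<in> (\<lambda>u. c \<cdot> u) ` L 1" using covering[of m c] assms by simp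
  then obtain u where u: "u \<in> L 1" "d = c \<cdot> u" by blast
  from u(1) obtain \<alpha> \<beta> where "u = scale \<alpha> x + scale \<beta> y" by (rule L1_cases)
  then show ?thesis using u(2) that by (simp add: br_lin)
qed

lemma nonzero_element:
  assumes "1 \<le> m" "L m \<noteq> {0}" obtains c where "c \<in> L m" "c \<noteq> 0"
  using subspace_0[OF subspace_component[OF assms(1)]] assms(2) by blast

lemma finite_dim_component: "1 \<le> m \<Longrightarrow> \<exists>B. finite B \<and> L m \<subseteq> span B"
proof (induction m rule: nat_induct_at_least)
  case base
  have "finite {x, y} \<and> L 1 \<subseteq> span {x, y}" unfolding span_xy by simp
  then show ?case by blast
next
  case (Suc m)
  show ?case
  proof (cases "L m = {0}")
    case True
    then have "L (Suc m) = {0}" using no_gaps[OF Suc.hyps] by simp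
    then show ?thesis by (intro exI[of _ "{}"]) simp
  next
    case False
    then obtain c where c: "c \<in> L m" "c \<noteq> 0"
      by (rule nonzero_element[OF Suc.hyps])
    have "L (Suc m) \<subseteq> span {c \<cdot> x, c \<cdot> y}"
    proof
      fix d assume "d \<in> L (Suc m)"
      then obtain \<alpha> \<beta> where "d = scale \<alpha> (c \<cdot> x) + scale \<beta> (c \<cdot> y)"
        by (rule L_step[OF c(1) Suc.hyps c(2)])
      then show "d \<in> span {c \<cdot> x, c \<cdot> y}"
        by (simp only:) (intro span_add span_scale span_base, simp_all)
    qed
    then show ?thesis by (intro exI[of _ "{c \<cdot> x, c \<cdot> y}"]) simp
  qed
qed

text \<open>A zero component forces all later ones to be zero, and the finitely many remaining ones
  are finite-dimensional.\<close>

lemma component_nonzero: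
  assumes "1 \<le> m" shows "L m \<noteq> {0}"
proof
  assume m: "L m = {0}"
  have zero: "L n = {0}" if "m \<le> n" for n
    using that
  proof (induction n rule: nat_induct_at_least)
    case (Suc n)
    then show ?case using no_gaps[of n] assms by simp
  qed (rule m)
  have "\<forall>n. \<exists>B. 1 \<le> n \<longrightarrow> finite B \<and> L n \<subseteq> span B"
    using finite_dim_component by blast
  then obtain B where B: "\<And>n. 1 \<le> n \<Longrightarrow> finite (B n) \<and> L n \<subseteq> span (B n)"
    by metis
  let ?B = "\<Union>n\<in>{1..<m}. B n"
  have "L n \<subseteq> span ?B" if "1 \<le> n" for n
  proof (cases "n < m")
    case True
    then have "span (B n) \<subseteq> span ?B" using that by (intro span_mono) auto
    then show ?thesis using B that by blast
  next
    case False
    then show ?thesis using zero[of n] span_zero by auto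
  qed
  then have "(\<Union>n\<in>{1..}. L n) \<subseteq> span ?B" by auto
  then have "span ?B = UNIV"
    using span_components span_minimal[OF _ subspace_span] by blast
  moreover have "finite ?B" using B by auto
  ultimately show False using infinite unfolding infinite_dimensional_def by blast
qed

text \<open>If \<open>c\<close> were nonzero, the covering property would make its products with
  \<open>L 1\<close> fill the next component, which is not zero. This is the standard device below
  for proving that an element vanishes.\<close>

lemma killed_by_generators:
  assumes "c \<in> L m" "1 \<le> m" "c \<cdot> x = 0" "c \<cdot> y = 0"
  shows "c = 0"
proof (rule ccontr)
  assume "c \<noteq> 0"
  obtain d where d: "d \<in> L (Suc m)" "d \<noteq> 0"
    using component_nonzero[of "Suc m"] by (auto intro: nonzero_element[of "Suc m"])
  obtain \<alpha> \<beta> where "d = scale \<alpha> (c \<cdot> x) + scale \<beta> (c \<cdot> y)"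
    by (rule L_step[OF assms(1,2) \<open>c \<noteq> 0\<close> d(1)])
  then show False using d(2) assms(3,4) by simp
qed

text \<open>In Leibniz's rule the inner binomial coefficients vanish because q is a power of the
  characteristic.\<close>

lemma xpow_q_derivation: "(a \<cdot> b) \<lhd> q = (a \<lhd> q) \<cdot> b + a \<cdot> (b \<lhd> q)"
proof -
  have "(a \<cdot> b) \<lhd> q = (\<Sum>l\<in>{0, q}. scale (of_nat (q choose l)) ((a \<lhd> l) \<cdot> (b \<lhd> (q - l))))"
    unfolding lnp_br by (rule sum.mono_neutral_right) (auto simp: choose_q)
  then show ?thesis using q_gt_5 by (simp add: add.commute)
qed

lemma y_xpow_q: "y \<lhd> q = 0"
  using v1xx by (simp add: q_eq numeral_3_eq_3 v1_def lnp_Suc)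

lemma x_xpow_q: "x \<lhd> q = 0"
  unfolding q_eq by (simp add: numeral_3_eq_3 lnp_Suc2 alternating)

text \<open>The q-th power of ad x is a derivation that kills both generators, hence
  everything.\<close>

lemma xpow_q:
  assumes "1 \<le> m" "c \<in> L m" shows "c \<lhd> q = 0"
  using assms
proof (induction m arbitrary: c rule: nat_induct_at_least)
  case base
  then obtain \<alpha> \<beta> where "c = scale \<alpha> x + scale \<beta> y" by (rule L1_cases)
  then show ?case by (simp add: lnp_lin x_xpow_q y_xpow_q)
next
  case (Suc m)
  obtain e where e: "e \<in> L m" "e \<noteq> 0"
    by (rule nonzero_element[OF Suc.hyps component_nonzero[OF Suc.hyps]])
  from Suc.prems obtain \<alpha> \<beta> where "c = scale \<alpha> (e \<cdot> x) + scale \<beta> (e \<cdot> y)"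
    by (rule L_step[OF e(1) Suc.hyps e(2)])
  then show ?case using Suc.IH[OF e(1)]
    by (simp add: lnp_lin xpow_q_derivation x_xpow_q y_xpow_q)
qed

text \<open>The signs of row q - 2 of Pascal's triangle cancel those of
  \<open>br_lnp\<close>.\<close>

lemma br_v1: "c \<cdot> v1 = (\<Sum>l\<le>h+1. scale (of_nat (l + 1)) ((c \<lhd> l) \<cdot> y \<lhd> (h + 1 - l)))"
  unfolding v1_def br_lnp Suc_eq_plus1
proof (intro sum.cong refl)
  fix l assume "l \<in> {..h+1}"
  then have "(of_nat ((h + 1) choose l) :: 'f) = (-1) ^ l * of_nat (l + 1)"
    by (intro choose_q2) (simp add: q_eq)
  moreover have "(-1) ^ l * ((-1) ^ l * of_nat (l + 1)) = (of_nat (l + 1) :: 'f)"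
    by (simp add: mult.assoc[symmetric] power_mult_distrib[symmetric])
  ultimately show "scale ((-1) ^ l * of_nat ((h + 1) choose l)) ((c \<lhd> l) \<cdot> y \<lhd> (h + 1 - l)) =
      scale (of_nat (l + 1)) ((c \<lhd> l) \<cdot> y \<lhd> (h + 1 - l))"
    by (simp only:)
qed

lemma br_v1_cut:
  assumes "\<And>l. l \<notin> S \<Longrightarrow> l \<le> h + 1 \<Longrightarrow> (c \<lhd> l) \<cdot> y = 0" and "S \<subseteq> {..h+1}"
  shows "c \<cdot> v1 = (\<Sum>l\<in>S. scale (of_nat (l + 1)) ((c \<lhd> l) \<cdot> y \<lhd> (h + 1 - l)))"
  unfolding br_v1 using assms by (intro sum.mono_neutral_right) auto

lemma v1_L: "v1 \<in> L (h + 2)"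
  using L_xpow[OF y_L1, of "Suc h"] by (simp add: v1_def)

lemma v1_nonzero: "v1 \<noteq> 0"
proof
  assume "v1 = 0"
  then have "L (h + 2) = {0}" using span_v1 by (metis span_insert_0 span_empty)
  then show False using component_nonzero[of "h + 2"] by simp
qed

text \<open>Otherwise [v1 x] and [v1 y] would be killed by both generators, and then so would
  \<open>v1\<close>.\<close>

lemma v1xy_nonzero: "v1 \<cdot> x \<cdot> y \<noteq> 0"
proof
  assume z: "v1 \<cdot> x \<cdot> y = 0"
  have "v1 \<cdot> x = 0"
    using L_x[OF v1_L] by (rule killed_by_generators) (simp_all add: v1xx z)
  moreover have "v1 \<cdot> y = 0"
    using L_y[OF v1_L] by (rule killed_by_generators) (simp_all add: v1yx v1yy z)
  ultimately show False using killed_by_generators[OF v1_L] v1_nonzero by simp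
qed

lemma v1_independent:
  assumes "scale \<alpha> (v1 \<cdot> x) + scale \<beta> (v1 \<cdot> y) = 0" shows "\<alpha> = 0 \<and> \<beta> = 0"
proof -
  have "(scale \<alpha> (v1 \<cdot> x) + scale \<beta> (v1 \<cdot> y)) \<cdot> x = 0" "(scale \<alpha> (v1 \<cdot> x) + scale \<beta> (v1 \<cdot> y)) \<cdot> y = 0"
    using assms by simp_all
  then show ?thesis using v1xy_nonzero by (simp add: br_lin v1xx v1yy v1yx)
qed

section \<open>The components below the second diamond are centralized by \<open>y\<close>\<close>

lemma xpow_1 [simp]: "c \<lhd> Suc 0 = c \<cdot> x"
  by (simp add: lnp_Suc)

lemma y_pow_v1 [simp]: "y \<lhd> Suc h = v1" "y \<lhd> Suc (Suc h) = v1 \<cdot> x"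
  by (simp_all add: v1_def lnp_Suc)

lemma y_pow_L: "y \<lhd> i \<in> L (Suc i)"
  using L_xpow[OF y_L1, of i] by simp

lemma y_pow_nonzero:
  assumes "i \<le> h + 1" shows "y \<lhd> i \<noteq> 0"
proof
  assume "y \<lhd> i = 0"
  then have "y \<lhd> i \<lhd> (Suc h - i) = 0" by simp
  then show False using v1_nonzero assms by (simp add: lnp_lnp)
qed

text \<open>Below the second diamond two-dimensional components are excluded, so [y x^i y] must be
  proportional to [y x^(i+1)] as long as both lie in degree less than q.\<close>

lemma y_pow_span:
  assumes "1 \<le> i" "i \<le> h + 1" "d \<in> L (Suc i)"
  shows "\<exists>r. d = scale r (y \<lhd> i)"
  using assms
proof (induction i arbitrary: d rule: nat_induct_at_least)
  case base
  then have d: "d \<in> L (Suc 1)" by simp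
  obtain \<alpha> \<beta> where "d = scale \<alpha> (y \<cdot> x) + scale \<beta> (y \<cdot> y)"
    using y_pow_nonzero[of 0] by (auto intro: L_step[OF y_L1 _ _ d])
  then show ?case by (intro exI[of _ \<alpha>]) (simp add: alternating)
next
  case (Suc i)
  let ?u = "y \<lhd> i \<cdot> x" and ?w = "y \<lhd> i \<cdot> y"
  have nz: "?u \<noteq> 0" using y_pow_nonzero[of "Suc i"] Suc.prems by (simp add: lnp_Suc)
  have "y \<lhd> i \<noteq> 0" using y_pow_nonzero[of i] Suc.prems by simp
  then have step: "\<exists>\<alpha> \<beta>. e = scale \<alpha> ?u + scale \<beta> ?w" if "e \<in> L (Suc (Suc i))" for e
    by (metis L_step[OF y_pow_L[of i] _ _ that] le_add1 plus_1_eq_Suc)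
  have w: "?w \<in> span {?u}"
  proof (rule ccontr)
    assume nw: "?w \<notin> span {?u}"
    have ind: "independent {?w, ?u}"
      using nw by (rule independent_insertI) (simp add: nz)
    have "L (Suc (Suc i)) \<subseteq> span {?w, ?u}"
    proof
      fix e assume "e \<in> L (Suc (Suc i))"
      then obtain \<alpha> \<beta> where "e = scale \<alpha> ?u + scale \<beta> ?w" using step by blast
      then show "e \<in> span {?w, ?u}"
        by (simp only:) (intro span_add span_scale span_base, simp_all)
    qed
    moreover have "{?w, ?u} \<subseteq> L (Suc (Suc i))"
      using L_x[OF y_pow_L[of i]] L_y[OF y_pow_L[of i]] by simp
    ultimately have "card {?w, ?u} = dim (L (Suc (Suc i)))"
      using ind by (intro basis_card_eq_dim)
    moreover have "?w \<noteq> ?u" using nw span_base[of ?u "{?u}"] by auto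
    ultimately have "dim (L (Suc (Suc i))) = 2" by simp
    moreover have "dim (L (Suc (Suc i))) \<noteq> 2"
      using second_diamond_q Suc.prems q_eq unfolding second_diamond_def by simp
    ultimately show False by contradiction
  qed
  obtain \<alpha> \<beta> where d: "d = scale \<alpha> ?u + scale \<beta> ?w"
    using step Suc.prems by blast
  obtain \<gamma> where "?w = scale \<gamma> ?u" using w unfolding span_singleton by blast
  then have "d = scale (\<alpha> + \<beta> * \<gamma>) (y \<lhd> Suc i)"
    using d by (simp add: scale_left_distrib lnp_Suc)
  then show ?case by (rule exI)
qed

context
  fixes c :: "nat \<Rightarrow> 'f"
  assumes c: "\<And>i. i \<le> h \<Longrightarrow> y \<lhd> i \<cdot> y = scale (c i) (y \<lhd> Suc i)"
begin

text \<open>The structure constants below the second diamond: the product of [y x^i] and [y x^j] is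
  \<open>f i j\<close> times [y x^(i+j+1)].\<close>

definition f :: "nat \<Rightarrow> nat \<Rightarrow> 'f" where
  "f i j = (\<Sum>l\<le>j. (-1) ^ l * of_nat (j choose l) * c (i + l))"

lemma y_pow_y_pow:
  assumes "i + j \<le> h"
  shows "(y \<lhd> i) \<cdot> (y \<lhd> j) = scale (f i j) (y \<lhd> (i + j + 1))"
  unfolding br_lnp f_def scale_sum_left
proof (intro sum.cong refl)
  fix l assume "l \<in> {..j}"
  then have l: "l \<le> j" by simp
  have "(y \<lhd> i \<lhd> l) \<cdot> y = scale (c (i + l)) (y \<lhd> (i + l + 1))"
    using c[of "i + l"] l assms by (simp add: lnp_lnp)
  then have "(y \<lhd> i \<lhd> l) \<cdot> y \<lhd> (j - l) = scale (c (i + l)) (y \<lhd> (i + l + 1 + (j - l)))"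
    by (simp only: lnp_scale lnp_lnp)
  also have "i + l + 1 + (j - l) = i + j + 1" using l by simp
  finally show "scale ((-1) ^ l * of_nat (j choose l)) ((y \<lhd> i \<lhd> l) \<cdot> y \<lhd> (j - l)) =
      scale ((-1) ^ l * of_nat (j choose l) * c (i + l)) (y \<lhd> (i + j + 1))"
    by (simp only: scale_scale)
qed

text \<open>The product lies in the second diamond. Only the summand l = j ends in \<open>y\<close>
  and contributes to [v1 y]; all others are multiples of [v1 x].\<close>

lemma y_pow_y_pow_q:
  assumes "i + j = h + 1"
  shows "\<exists>\<beta>. (y \<lhd> i) \<cdot> (y \<lhd> j) = scale ((-1) ^ j) (v1 \<cdot> y) + scale \<beta> (v1 \<cdot> x)"
proof -
  have *: "(y \<lhd> i \<lhd> l) \<cdot> y \<lhd> (j - l) = scale (c (i + l)) (v1 \<cdot> x)" if l: "l < j" for l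
  proof -
    have "(y \<lhd> i \<lhd> l) \<cdot> y = scale (c (i + l)) (y \<lhd> (i + l + 1))"
      using c[of "i + l"] l assms by (simp add: lnp_lnp)
    then have "(y \<lhd> i \<lhd> l) \<cdot> y \<lhd> (j - l) = scale (c (i + l)) (y \<lhd> (i + l + 1 + (j - l)))"
      by (simp only: lnp_scale lnp_lnp)
    moreover have "i + l + 1 + (j - l) = Suc (h + 1)" using l assms by simp
    ultimately show ?thesis by simp
  qed
  have "(y \<lhd> i) \<cdot> (y \<lhd> j) = scale ((-1) ^ j) (v1 \<cdot> y) +
      (\<Sum>l<j. scale ((-1) ^ l * of_nat (j choose l)) ((y \<lhd> i \<lhd> l) \<cdot> y \<lhd> (j - l)))"
    unfolding br_lnp lessThan_Suc_atMost[symmetric] sum.lessThan_Suc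
    using assms by (simp add: lnp_lnp add.commute)
  also have "(\<Sum>l<j. scale ((-1) ^ l * of_nat (j choose l)) ((y \<lhd> i \<lhd> l) \<cdot> y \<lhd> (j - l))) =
      (\<Sum>l<j. scale ((-1) ^ l * of_nat (j choose l) * c (i + l)) (v1 \<cdot> x))"
    by (intro sum.cong) (simp_all only: * lessThan_iff scale_scale)
  finally show ?thesis unfolding scale_sum_left[symmetric] by blast
qed

text \<open>One degree above the second diamond the summands with l < j contain [y x^q] = 0. The
  last two are multiples of [v1 x y], the first of them through [v1 y x] = -2 [v1 x y].\<close>

lemma y_pow_y_pow_q1:
  assumes "i + Suc j = h + 2"
  shows "(y \<lhd> i) \<cdot> (y \<lhd> Suc j) = scale ((-1) ^ Suc j * (2 * of_nat (Suc j) + 1)) (v1 \<cdot> x \<cdot> y)"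
proof -
  have *: "(y \<lhd> i \<lhd> l) \<cdot> y \<lhd> (Suc j - l) = 0" if l: "l < j" for l
  proof -
    have "(y \<lhd> i \<lhd> l) \<cdot> y = scale (c (i + l)) (y \<lhd> (i + l + 1))"
      using c[of "i + l"] l assms by (simp add: lnp_lnp)
    then have "(y \<lhd> i \<lhd> l) \<cdot> y \<lhd> (Suc j - l) = scale (c (i + l)) (y \<lhd> (i + l + 1 + (Suc j - l)))"
      by (simp only: lnp_scale lnp_lnp)
    moreover have "i + l + 1 + (Suc j - l) = q" using l assms q_eq by simp
    ultimately show ?thesis using y_xpow_q by simp
  qed
  have ij: "i + j = h + 1" "i + Suc j = Suc (h + 1)" using assms by simp_all
  have 1: "(y \<lhd> i \<lhd> j) \<cdot> y \<lhd> (Suc j - j) = scale (-2) (v1 \<cdot> x \<cdot> y)"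
    using v1yx by (simp add: lnp_lnp ij)
  have 2: "(y \<lhd> i \<lhd> Suc j) \<cdot> y \<lhd> (Suc j - Suc j) = v1 \<cdot> x \<cdot> y"
    by (simp only: lnp_lnp ij diff_self_eq_0 lnp_0) simp
  have "(y \<lhd> i) \<cdot> (y \<lhd> Suc j) =
      (\<Sum>l\<in>{j, Suc j}. scale ((-1) ^ l * of_nat (Suc j choose l)) ((y \<lhd> i \<lhd> l) \<cdot> y \<lhd> (Suc j - l)))"
    unfolding br_lnp
  proof (rule sum.mono_neutral_right)
    show "\<forall>l\<in>{..Suc j} - {j, Suc j}.
        scale ((-1) ^ l * of_nat (Suc j choose l)) ((y \<lhd> i \<lhd> l) \<cdot> y \<lhd> (Suc j - l)) = 0"
    proof
      fix l assume "l \<in> {..Suc j} - {j, Suc j}"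
      then have "l < j" by auto
      then show "scale ((-1) ^ l * of_nat (Suc j choose l)) ((y \<lhd> i \<lhd> l) \<cdot> y \<lhd> (Suc j - l)) = 0"
        by (simp only: * scale_zero_right)
    qed
  qed auto
  also have "\<dots> = scale ((-1) ^ j * of_nat (Suc j)) (scale (-2) (v1 \<cdot> x \<cdot> y))
      + scale ((-1) ^ Suc j) (v1 \<cdot> x \<cdot> y)"
    using 1 2 by simp
  also have "\<dots> = scale ((-1) ^ j * of_nat (Suc j) * (-2) + (-1) ^ Suc j) (v1 \<cdot> x \<cdot> y)"
    by (simp only: scale_scale scale_left_distrib)
  also have "(-1) ^ j * of_nat (Suc j) * (-2) + (-1) ^ Suc j =
      ((-1) ^ Suc j * (2 * of_nat (Suc j) + 1) :: 'f)"
    by (simp add: algebra_simps)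
  finally show ?thesis .
qed

text \<open>Let k be least with \<open>c k\<close> nonzero. Vanishing squares force k to be odd and
  k = -1 in the field. Products that land in degrees q and q + 1 are known from the second diamond
  and give a recursion for \<open>c\<close> close to \<open>h\<close>; the Jacobi identity at its
  border then contradicts \<open>c k\<close> being nonzero.\<close>

lemma y_pow_coeff_zero: "i \<le> h \<Longrightarrow> c i = 0"
proof (rule ccontr)
  assume "i \<le> h" "c i \<noteq> 0"
  define k where "k = (LEAST i. c i \<noteq> 0)"
  have ck: "c k \<noteq> 0" unfolding k_def using \<open>c i \<noteq> 0\<close> by (rule LeastI)
  have kh: "k \<le> h" unfolding k_def using \<open>c i \<noteq> 0\<close> \<open>i \<le> h\<close> by (meson Least_le order_trans)
  have below: "c j = 0" if "j < k" for j
    using not_less_Least[of j "\<lambda>i. c i \<noteq> 0"] that unfolding k_def by blast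
  have c0: "c 0 = 0"
    using c[of 0] y_pow_nonzero[of 1] by (simp add: alternating)
  have c1: "c 1 = 0"
    using c[of 1] yxy y_pow_nonzero[of 2] h_ge by (simp add: numeral_2_eq_2)
  have k2: "k \<ge> 2" using ck c0 c1 by (metis One_nat_def less_2_cases not_le)
  have f_below: "f i j = 0" if "i + j < k" for i j
    unfolding f_def using that by (intro sum.neutral) (auto simp: below)
  have f_k: "f i j = (-1) ^ j * c k" if "i + j = k" for i j
  proof -
    have "f i j = (\<Sum>l\<in>{j}. (-1) ^ l * of_nat (j choose l) * c (i + l))"
      unfolding f_def using that by (intro sum.mono_neutral_right) (auto simp: below)
    then show ?thesis using that by simp
  qed
  have odd_k: "odd k"
  proof
    assume "even k"
    then obtain m where m: "k = m + m" by (metis evenE mult_2)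
    have "scale (f m m) (y \<lhd> (m + m + 1)) = 0"
      using y_pow_y_pow[of m m] m kh by (simp add: alternating)
    then show False using f_k[of m m] m ck y_pow_nonzero[of "m + m + 1"] kh by simp
  qed
  then have k3: "k \<ge> 3" and kh1: "k + 1 \<le> h" using k2 kh even_h by presburger+
  obtain m where m: "k + 1 = m + m" using odd_k by (metis evenE mult_2 odd_even_add odd_one)
  then obtain m' where m': "m = Suc m'" "k = Suc (m' + m')" by (cases m) auto
  \<comment> \<open>By minimality of k only the terms with \<open>c k\<close> and
    \<open>c (k + 1)\<close> survive in the square of [y x^m], where 2 m = k + 1.\<close>
  have fmm: "f m m = (-1) ^ m' * of_nat m * c k + (-1) ^ m * c (k + 1)"
  proof -
    have "f m m = (\<Sum>l\<in>{m', m}. (-1) ^ l * of_nat (m choose l) * c (m + l))"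
      unfolding f_def
    proof (rule sum.mono_neutral_right)
      show "\<forall>l\<in>{..m} - {m', m}. (-1) ^ l * of_nat (m choose l) * c (m + l) = 0"
        using m' by (auto intro!: below)
    qed (use m' in auto)
    moreover have "m + m' = k" "m + m = k + 1" using m m' by simp_all
    ultimately show ?thesis using m'(1) by simp
  qed
  have "scale (f m m) (y \<lhd> (m + m + 1)) = 0"
    using y_pow_y_pow[of m m] m kh1 by (simp add: alternating)
  then have "f m m = 0" using y_pow_nonzero[of "m + m + 1"] m kh1 by simp
  \<comment> \<open>\<open>y\<close> commutes with [y x^(m-1)] and with [y x^m], hence with their
    product, which is a nonzero multiple of [y x^(k+1)].\<close>
  have "c (k + 1) = 0"
  proof -
    have "y \<lhd> m' \<cdot> y = 0" "y \<lhd> m \<cdot> y = 0"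
      using c[of m'] c[of m] below[of m'] below[of m] m' k3 kh by simp_all
    then have "(y \<lhd> m') \<cdot> (y \<lhd> m) \<cdot> y = 0"
      using br_br[of "y \<lhd> m'" "y \<lhd> m" y] by simp
    then have "scale (f m' m) (y \<lhd> (k + 1) \<cdot> y) = 0"
      using y_pow_y_pow[of m' m] m' kh by (simp add: br_lin)
    then have "y \<lhd> (k + 1) \<cdot> y = 0" using f_k[of m' m] m' ck by simp
    then show ?thesis using c[of "k + 1"] y_pow_nonzero[of "Suc (k + 1)"] kh1 by simp
  qed
  then have m0: "(of_nat m :: 'f) = 0" using fmm \<open>f m m = 0\<close> ck by simp
  have "of_nat (k + 1) = (of_nat m + of_nat m :: 'f)" using m by simp
  then have of_nat_k: "of_nat k = (- 1 :: 'f)" using m0 by (simp add: eq_neg_iff_add_eq_0 add.commute)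
  \<comment> \<open>That p divides m makes k large enough for the descent below, which runs over
    about p / 2 indices.\<close>
  have "p \<le> m" using m0 m'(1) of_nat_0_iff[of m] dvd_imp_le[of p m] by simp
  then have k_large: "k + 1 \<ge> 2 * p" using m by simp
  \<comment> \<open>Multiplying by \<open>y\<close> moves the product into the second diamond; the
    coefficients of [v1 y] are compared.\<close>
  have f_h: "f i j = (-1) ^ j * c i" if ij: "i + j = h" "j < k" for i j
  proof -
    have 1: "(y \<lhd> i) \<cdot> (y \<lhd> j) \<cdot> y = (y \<lhd> i \<cdot> y) \<cdot> (y \<lhd> j)"
      using br_br[of "y \<lhd> i" "y \<lhd> j" y] c[of j] below[of j] ij by simp
    obtain \<beta> where "(y \<lhd> Suc i) \<cdot> (y \<lhd> j) = scale ((-1) ^ j) (v1 \<cdot> y) + scale \<beta> (v1 \<cdot> x)"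
      using y_pow_y_pow_q[of "Suc i" j] ij by auto
    then have "scale (f i j) (v1 \<cdot> y) = scale (c i) (scale ((-1) ^ j) (v1 \<cdot> y) + scale \<beta> (v1 \<cdot> x))"
      using 1 y_pow_y_pow[of i j] ij c[of i] by (simp add: br_lin)
    then have "scale (- c i * \<beta>) (v1 \<cdot> x) + scale (f i j - c i * (-1) ^ j) (v1 \<cdot> y) = 0"
      by (simp add: scale_simps)
    from v1_independent[OF this] show ?thesis by simp
  qed
  have f1: "f i 1 = c i - c (i + 1)" for i
    by (simp add: f_def)
  have der: "u \<cdot> w \<cdot> z = u \<cdot> z \<cdot> w + u \<cdot> (w \<cdot> z)" for u w z
    by (simp add: br_br)
  have Y: "(y \<lhd> i) \<cdot> (y \<lhd> 1) = scale (c i - c (i + 1)) (y \<lhd> (i + 2))" if "i + 1 \<le> h" for i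
    using y_pow_y_pow[of i 1] that f1[of i] by simp
  have Q: "(y \<lhd> i) \<cdot> (y \<lhd> j) = scale ((-1) ^ j * (2 * of_nat j + 1)) (v1 \<cdot> x \<cdot> y)"
    if "i + j = h + 2" "1 \<le> j" for i j
    using y_pow_y_pow_q1[of i "j - 1"] that by simp
  \<comment> \<open>Jacobi identity with [y x] as third factor; [y x^j] and [y x] commute because
    \<open>c j\<close> and \<open>c (j + 1)\<close> vanish.\<close>
  have rec: "(2 * of_nat j + 4) * c i = (2 * of_nat j + 1) * c (i + 1)"
    if ij: "i + j = h" "1 \<le> j" "j + 1 < k" for i j
  proof -
    have "(y \<lhd> i) \<cdot> (y \<lhd> j) \<cdot> (y \<lhd> 1) = (y \<lhd> i) \<cdot> (y \<lhd> 1) \<cdot> (y \<lhd> j)"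
      using der[of "y \<lhd> i" "y \<lhd> j" "y \<lhd> 1"] Y[of j] below[of j] below[of "j + 1"] that kh
      by simp
    moreover have "(y \<lhd> i) \<cdot> (y \<lhd> j) \<cdot> (y \<lhd> 1) = scale (((-1) ^ j * c i) * - 3) (v1 \<cdot> x \<cdot> y)"
      using y_pow_y_pow[of i j] f_h[of i j] Q[of "h + 1" 1] that
      by (simp add: br_lin)
    moreover have "(y \<lhd> i) \<cdot> (y \<lhd> 1) \<cdot> (y \<lhd> j) =
        scale ((c i - c (i + 1)) * ((-1) ^ j * (2 * of_nat j + 1))) (v1 \<cdot> x \<cdot> y)"
      using Y[of i] Q[of "i + 2" j] that by (simp add: br_lin)
    ultimately have "scale (((-1) ^ j * c i) * - 3) (v1 \<cdot> x \<cdot> y) =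
        scale ((c i - c (i + 1)) * ((-1) ^ j * (2 * of_nat j + 1))) (v1 \<cdot> x \<cdot> y)" by metis
    then have "((-1) ^ j * c i) * - 3 = (c i - c (i + 1)) * ((-1) ^ j * (2 * of_nat j + 1))"
      using v1xy_nonzero scale_cancel_right by blast
    then have "(-1) ^ j * (- 3 * c i) = (-1) ^ j * ((c i - c (i + 1)) * (2 * of_nat j + 1))"
      by (simp add: algebra_simps)
    then have "- 3 * c i = (c i - c (i + 1)) * (2 * of_nat j + 1)"
      by (simp only: mult_cancel_left) simp
    moreover have "(2 * of_nat j + 4) * c i - (2 * of_nat j + 1) * c (i + 1) =
        (c i - c (i + 1)) * (2 * of_nat j + 1) - (- 3 * c i)"
      by (simp add: algebra_simps)
    ultimately show ?thesis by simp
  qed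
  text \<open>Descent from \<open>t = (p - 5) / 2\<close>, where the factor \<open>2 * j + 1\<close> of \<open>rec\<close> vanishes.\<close>
  have desc: "c (h - (k - 2 - t)) = 0" if "t \<le> (p - 5) div 2" for t
    using that
  proof (induction t rule: inc_induct)
    case base
    let ?t = "(p - 5) div 2"
    have t: "2 * ?t + 5 = p" using p_odd p_ge_5 by simp
    define j where "j = k - 2 - ?t"
    have jt: "j + ?t + 2 = k" "1 \<le> j" using k_large t by (simp_all add: j_def)
    have "of_nat j + of_nat ?t + 2 = (- 1 :: 'f)" using of_nat_k jt(1) by (metis of_nat_add of_nat_numeral)
    then have oj: "of_nat j = (- 3 - of_nat ?t :: 'f)"
      using eq_diff_eq[of "of_nat j" "- 1" "of_nat ?t + (2 :: 'f)"] by (simp add: add.assoc)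
    have "(of_nat (2 * ?t + 5) :: 'f) = 0" unfolding t by (simp add: of_nat_0_iff)
    then have t0: "2 * of_nat ?t + 5 = (0 :: 'f)" by (simp only: of_nat_add of_nat_mult of_nat_numeral)
    have "2 * of_nat j + 1 = - (2 * of_nat ?t + 5 :: 'f)" unfolding oj by (simp add: algebra_simps)
    then have "2 * of_nat j + 1 = (0 :: 'f)" unfolding t0 by simp
    moreover from this have "2 * of_nat j + 4 = (3 :: 'f)"
      using add.assoc[of "2 * of_nat j" 1 "3 :: 'f"] by simp
    ultimately show ?case using rec[of "h - j" j] jt kh by (simp add: j_def)
  next
    case (step t)
    have t: "2 * t + 5 < p" using step.hyps p_odd p_ge_5 by presburger
    define j where "j = k - 2 - t"
    have jt: "j + t + 2 = k" "1 \<le> j" using k_large t by (simp_all add: j_def)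
    have "of_nat j + of_nat t + 2 = (- 1 :: 'f)" using of_nat_k jt(1) by (metis of_nat_add of_nat_numeral)
    then have oj: "of_nat j = (- 3 - of_nat t :: 'f)"
      using eq_diff_eq[of "of_nat j" "- 1" "of_nat t + (2 :: 'f)"] by (simp add: add.assoc)
    have "(of_nat (2 * t + 2) :: 'f) \<noteq> 0" using t by (intro small_nonzero) auto
    moreover have "2 * of_nat j + 4 = - (of_nat (2 * t + 2) :: 'f)" unfolding oj by (simp add: algebra_simps)
    ultimately have "2 * of_nat j + 4 \<noteq> (0 :: 'f)" by (metis neg_equal_0_iff_equal)
    moreover have "h - j + 1 = h - (k - 2 - Suc t)" using jt kh by (simp add: j_def)
    ultimately show ?case using rec[of "h - j" j] jt kh step.IH by (simp add: j_def)
  qed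
  have ck2: "c (h - (k - 2)) = 0" using desc[of 0] by simp
  \<comment> \<open>The border case j = k - 1 of \<open>rec\<close>: now [y x^j] and [y x] no longer
    commute, and their product brings in \<open>c k\<close>. The other two terms of the Jacobi
    identity cancel because \<open>c (i + 1)\<close> is zero and j = -2 in the field.\<close>
  define i where "i = h + 1 - k"
  define j where "j = k - 1"
  have ij: "i + j = h" "j + 1 = k" "i + 1 = h - (k - 2)" "even j"
    using kh k3 odd_k by (auto simp: i_def j_def)
  have oj: "of_nat j = (- 2 :: 'f)"
  proof -
    have "of_nat j + 1 = (- 1 :: 'f)" using of_nat_k ij(2) by (metis of_nat_add of_nat_1)
    then show ?thesis using eq_diff_eq[of "of_nat j" "- 1" "1 :: 'f"] by simp
  qed
  have "(y \<lhd> i) \<cdot> (y \<lhd> j) \<cdot> (y \<lhd> 1) = scale (c i * - 3) (v1 \<cdot> x \<cdot> y)"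
    using y_pow_y_pow[of i j] f_h[of i j] Q[of "h + 1" 1] ij by (simp add: br_lin)
  moreover have "(y \<lhd> i) \<cdot> (y \<lhd> 1) \<cdot> (y \<lhd> j) = scale (c i * - 3) (v1 \<cdot> x \<cdot> y)"
    using Y[of i] Q[of "i + 2" j] ij ck2 k3 oj by (simp add: br_lin)
  moreover have "(y \<lhd> i) \<cdot> ((y \<lhd> j) \<cdot> (y \<lhd> 1)) = scale (- c k) (v1 \<cdot> x \<cdot> y)"
    using Y[of j] below[of j] Q[of i "k + 1"] ij kh odd_k of_nat_k by (simp add: br_lin)
  ultimately have "scale (- c k) (v1 \<cdot> x \<cdot> y) = 0"
    using der[of "y \<lhd> i" "y \<lhd> j" "y \<lhd> 1"] by simp
  then show False using ck v1xy_nonzero by simp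
qed

end

lemma y_pow_y: "i \<le> h \<Longrightarrow> y \<lhd> i \<cdot> y = 0"
proof -
  have "\<exists>r. y \<lhd> i \<cdot> y = scale r (y \<lhd> Suc i)" if "i \<le> h" for i
    using y_pow_span[of "Suc i" "y \<lhd> i \<cdot> y"] L_y[OF y_pow_L[of i]] that by simp
  then obtain c where c: "\<And>i. i \<le> h \<Longrightarrow> y \<lhd> i \<cdot> y = scale (c i) (y \<lhd> Suc i)"
    by metis
  assume "i \<le> h"
  then show ?thesis using y_pow_coeff_zero[OF c] c[of i] by simp
qed

text \<open>The chain relations for an element below a diamond come from evaluating both sides of
  this commutation in different ways.\<close>

lemma br_y_pow_y: "j \<le> h \<Longrightarrow> c \<cdot> (y \<lhd> j) \<cdot> y = c \<cdot> y \<cdot> (y \<lhd> j)"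
  using br_br[of c "y \<lhd> j" y] y_pow_y by simp

subsection \<open>Chains between diamonds\<close>

lemma xpow_Suc: "c \<lhd> Suc n = c \<lhd> n \<cdot> x"
  by (rule lnp_Suc)

lemma scale_two: "scale 2 u = u + u"
  using scale_left_distrib[of 1 1 u] by simp

lemma xpow_xx: "e \<cdot> x \<cdot> x = 0 \<Longrightarrow> e \<lhd> Suc (Suc n) = 0"
  by (simp add: lnp_Suc2)

lemma yyx: "c \<cdot> y = 0 \<Longrightarrow> c \<cdot> x \<cdot> y \<cdot> y = 0"
proof -
  assume "c \<cdot> y = 0"
  moreover have "c \<cdot> (y \<lhd> 1) \<cdot> y = c \<cdot> y \<cdot> (y \<lhd> 1)" using h_ge by (intro br_y_pow_y) simp
  ultimately show ?thesis by (simp add: br_br br_lin)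
qed

lemma xyy_eq: "c \<cdot> y \<cdot> y = 0 \<Longrightarrow> c \<cdot> x \<cdot> y \<cdot> y = c \<cdot> y \<cdot> x \<cdot> y + c \<cdot> y \<cdot> x \<cdot> y"
proof -
  assume "c \<cdot> y \<cdot> y = 0"
  moreover have "c \<cdot> (y \<lhd> 1) \<cdot> y = c \<cdot> y \<cdot> (y \<lhd> 1)" using h_ge by (intro br_y_pow_y) simp
  ultimately show ?thesis by (simp add: br_br br_lin algebra_simps)
qed

lemma br_y_pow_head:
  assumes "e \<cdot> x \<cdot> x = 0"
  shows "e \<cdot> (y \<lhd> Suc i) = e \<cdot> y \<lhd> Suc i - scale (of_nat (Suc i)) (e \<cdot> x \<cdot> y \<lhd> i)"
proof -
  have "e \<lhd> l \<cdot> y = 0" if "l \<notin> {0, 1}" for l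
  proof -
    have "1 < l" using that by auto
    then obtain n where "l = Suc (1 + n)" using less_imp_Suc_add by blast
    then have "l = Suc (Suc n)" by simp
    then show ?thesis using xpow_xx[OF assms] by simp
  qed
  then have "e \<cdot> (y \<lhd> Suc i) = (\<Sum>l\<in>{0, 1}. scale ((-1) ^ l * of_nat (Suc i choose l)) (e \<lhd> l \<cdot> y \<lhd> (Suc i - l)))"
    by (intro br_lnp_cut) auto
  then show ?thesis by (simp add: scale_left_diff_distrib scale_left_distrib)
qed

lemma br_y_pow_last:
  assumes "\<And>l. l < i \<Longrightarrow> c \<lhd> l \<cdot> y = 0"
  shows "c \<cdot> (y \<lhd> i) = scale ((-1) ^ i) (c \<lhd> i \<cdot> y)"
  using br_lnp_tail[of i c x y 0] assms by simp

lemma br_y_pow_last2: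
  assumes "\<And>l. l < i \<Longrightarrow> c \<lhd> l \<cdot> y = 0"
  shows "c \<cdot> (y \<lhd> Suc i) = scale ((-1) ^ i)
    (scale (of_nat (Suc i)) (c \<lhd> i \<cdot> y \<cdot> x) - c \<lhd> i \<cdot> x \<cdot> y)"
  using br_lnp_tail[of i c x y 1] assms
  by (simp add: xpow_Suc scale_right_diff_distrib)

text \<open>Starting r steps below e = [c x^r], only the summands l = r and l = r + 1 remain:
  \<open>y\<close> kills the earlier ones and [e x x] = 0 the later ones.\<close>

lemma br_y_pow_pred:
  assumes "\<And>l. l < r \<Longrightarrow> c \<lhd> l \<cdot> y = 0" "c \<lhd> r \<cdot> x \<cdot> x = 0"
  shows "c \<cdot> (y \<lhd> (i + Suc r)) = scale ((-1) ^ r)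
    (scale (of_nat ((i + Suc r) choose r)) (c \<lhd> r \<cdot> y \<lhd> Suc i)
      - scale (of_nat ((i + Suc r) choose Suc r)) (c \<lhd> r \<cdot> x \<cdot> y \<lhd> i))"
proof -
  have "c \<lhd> l \<cdot> y = 0" if "l \<notin> {r, Suc r}" for l
  proof (cases "l < r")
    case False
    then have "Suc r < l" using that by auto
    then obtain n where "l = Suc (Suc r + n)" using less_imp_Suc_add by blast
    then have "c \<lhd> l = c \<lhd> r \<lhd> Suc (Suc n)" by (simp add: lnp_lnp)
    then show ?thesis using xpow_xx[OF assms(2)] by simp
  qed (rule assms(1))
  then have "c \<cdot> (y \<lhd> (i + Suc r)) = (\<Sum>l\<in>{r, Suc r}.
      scale ((-1) ^ l * of_nat ((i + Suc r) choose l)) (c \<lhd> l \<cdot> y \<lhd> (i + Suc r - l)))"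
    by (intro br_lnp_cut) auto
  then show ?thesis by (simp add: xpow_Suc scale_right_diff_distrib)
qed

section \<open>The chain above an element lying below a diamond\<close>

context
  fixes e t :: 'v and \<alpha> \<beta> :: 'f
  assumes exx: "e \<cdot> x \<cdot> x = 0" and eyy: "e \<cdot> y \<cdot> y = 0"
    and exy: "e \<cdot> x \<cdot> y = scale \<alpha> t" and eyx: "e \<cdot> y \<cdot> x = scale \<beta> t"
begin

text \<open>The pair (\<alpha>, \<beta>) treats all diamonds alike: it is (1, -2) for the second
  diamond, (1, -1) for infinite type and (\<mu>, 1 - \<mu>) for finite type \<mu>.\<close>

lemma ex_y_pow: "e \<cdot> x \<cdot> (y \<lhd> i) = scale \<alpha> (t \<lhd> i)"
proof -
  have "e \<cdot> x \<lhd> l \<cdot> y = 0" if "l \<notin> {0}" for l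
    using that exx by (cases l) (simp_all add: lnp_Suc2)
  then have "e \<cdot> x \<cdot> (y \<lhd> i) = (\<Sum>l\<in>{0}. scale ((-1) ^ l * of_nat (i choose l)) (e \<cdot> x \<lhd> l \<cdot> y \<lhd> (i - l)))"
    by (intro br_lnp_cut) auto
  then show ?thesis by (simp add: exy lnp_scale)
qed

lemma e_y_pow: "e \<cdot> (y \<lhd> Suc i) = scale (\<beta> - of_nat (Suc i) * \<alpha>) (t \<lhd> i)"
  using br_y_pow_head[OF exx, of i]
  by (simp only: lnp_Suc2[of "e \<cdot> y"] eyx exy lnp_scale scale_scale scale_left_diff_distrib)

lemma ey_xpow: "e \<cdot> y \<lhd> Suc i = scale \<beta> (t \<lhd> i)"
  by (simp add: lnp_Suc2 eyx lnp_scale)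

lemma ey_xpow_y:
  assumes "\<And>l. l < i \<Longrightarrow> t \<lhd> l \<cdot> y = 0" "l \<le> i"
  shows "e \<cdot> y \<lhd> l \<cdot> y = 0"
  using assms by (cases l) (simp_all add: eyy ey_xpow br_lin)

text \<open>Moving \<open>y\<close> past [y x^i] in [e x [y x^i] y] reproduces the same element with
  sign (-1)^i.\<close>

lemma chain_odd:
  assumes "\<And>l. l < i \<Longrightarrow> t \<lhd> l \<cdot> y = 0" "odd i" "i \<le> h"
  shows "scale \<alpha> (t \<lhd> i \<cdot> y) = 0"
proof -
  have "e \<cdot> x \<cdot> (y \<lhd> i) \<cdot> y = e \<cdot> x \<cdot> y \<cdot> (y \<lhd> i)" by (rule br_y_pow_y) fact
  then have "scale \<alpha> (t \<lhd> i \<cdot> y) = scale \<alpha> (t \<cdot> (y \<lhd> i))"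
    by (simp only: ex_y_pow exy br_lin)
  also have "t \<cdot> (y \<lhd> i) = - (t \<lhd> i \<cdot> y)"
    using br_y_pow_last[OF assms(1)] assms(2) by simp
  also have "scale \<alpha> (- (t \<lhd> i \<cdot> y)) = - scale \<alpha> (t \<lhd> i \<cdot> y)" by simp
  finally have "scale \<alpha> (t \<lhd> i \<cdot> y) = - scale \<alpha> (t \<lhd> i \<cdot> y)" .
  then have "scale \<alpha> (t \<lhd> i \<cdot> y) + scale \<alpha> (t \<lhd> i \<cdot> y) = 0"
    by (rule eq_neg_iff_add_eq_0[THEN iffD1])
  then show ?thesis by (rule double_zero)
qed

text \<open>The comparison of \<open>chain_odd\<close>, started at \<open>e\<close> instead of
  [e x].\<close>

lemma chain_even:
  assumes "\<And>l. l < i \<Longrightarrow> t \<lhd> l \<cdot> y = 0" "even i" "Suc i \<le> h"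
  shows "scale (2 * \<beta> - of_nat (Suc i) * \<alpha>) (t \<lhd> i \<cdot> y) = 0"
proof -
  have "e \<cdot> (y \<lhd> Suc i) \<cdot> y = e \<cdot> y \<cdot> (y \<lhd> Suc i)" by (rule br_y_pow_y) fact
  moreover have "e \<cdot> y \<cdot> (y \<lhd> Suc i) = scale (- \<beta>) (t \<lhd> i \<cdot> y)"
    using br_y_pow_last[of "Suc i" "e \<cdot> y"] ey_xpow_y[OF assms(1)] assms(2) by (simp add: ey_xpow br_lin)
  ultimately have "scale (\<beta> - of_nat (Suc i) * \<alpha>) (t \<lhd> i \<cdot> y) = scale (- \<beta>) (t \<lhd> i \<cdot> y)"
    by (simp only: e_y_pow br_lin)
  then have "scale (\<beta> - of_nat (Suc i) * \<alpha> - - \<beta>) (t \<lhd> i \<cdot> y) = 0"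
    by (simp only: scale_left_diff_distrib diff_self)
  moreover have "\<beta> - of_nat (Suc i) * \<alpha> - - \<beta> = 2 * \<beta> - of_nat (Suc i) * \<alpha>" by simp
  ultimately show ?thesis by simp
qed

text \<open>The comparison one degree further on. It describes what a nonzero [t x^i y] would look
  like in the degrees where the scalar of \<open>chain_even\<close> vanishes.\<close>

lemma chain_next:
  assumes "\<And>l. l < i \<Longrightarrow> t \<lhd> l \<cdot> y = 0" "even i" "Suc i \<le> h" "\<alpha> \<noteq> 0"
  shows "scale 2 (t \<lhd> i \<cdot> x \<cdot> y) = scale (of_nat (Suc i)) (t \<lhd> i \<cdot> y \<cdot> x)"
proof -
  have "e \<cdot> x \<cdot> (y \<lhd> Suc i) \<cdot> y = e \<cdot> x \<cdot> y \<cdot> (y \<lhd> Suc i)" by (rule br_y_pow_y) fact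
  then have "scale \<alpha> (t \<lhd> Suc i \<cdot> y) = scale \<alpha> (t \<cdot> (y \<lhd> Suc i))"
    by (simp only: ex_y_pow exy br_lin)
  then have "t \<lhd> Suc i \<cdot> y = t \<cdot> (y \<lhd> Suc i)" using \<open>\<alpha> \<noteq> 0\<close> by simp
  also have "\<dots> = scale (of_nat (Suc i)) (t \<lhd> i \<cdot> y \<cdot> x) - t \<lhd> i \<cdot> x \<cdot> y"
    using br_y_pow_last2[OF assms(1)] assms(2) by simp
  finally have "t \<lhd> i \<cdot> x \<cdot> y + t \<lhd> i \<cdot> x \<cdot> y = scale (of_nat (Suc i)) (t \<lhd> i \<cdot> y \<cdot> x)"
    by (simp only: xpow_Suc eq_diff_eq)
  then show ?thesis by (simp only: scale_two)
qed

text \<open>The comparison started r steps below \<open>e\<close>, which supplies a further scalar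
  for the exceptional degrees.\<close>

lemma chain_pred:
  assumes "\<And>l. l < r \<Longrightarrow> c \<lhd> l \<cdot> y = 0" "c \<lhd> r = e" "1 \<le> r" "i + Suc r \<le> h"
  shows "scale (of_nat ((i + Suc r) choose r) * \<beta> - of_nat ((i + Suc r) choose Suc r) * \<alpha>)
    (t \<lhd> i \<cdot> y) = 0"
proof -
  have "c \<cdot> (y \<lhd> (i + Suc r)) \<cdot> y = c \<cdot> y \<cdot> (y \<lhd> (i + Suc r))" by (rule br_y_pow_y) fact
  also have "c \<cdot> y = 0" using assms(1)[of 0] assms(3) by simp
  finally have "c \<cdot> (y \<lhd> (i + Suc r)) \<cdot> y = 0" by simp
  moreover have "c \<cdot> (y \<lhd> (i + Suc r)) = scale ((-1) ^ r)
      (scale (of_nat ((i + Suc r) choose r) * \<beta> - of_nat ((i + Suc r) choose Suc r) * \<alpha>) (t \<lhd> i))"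
    using br_y_pow_pred[of r c i] assms(1,2) exx
    by (simp add: ey_xpow exy lnp_scale scale_left_diff_distrib)
  ultimately have "scale ((-1) ^ r) (scale (of_nat ((i + Suc r) choose r) * \<beta>
      - of_nat ((i + Suc r) choose Suc r) * \<alpha>) (t \<lhd> i \<cdot> y)) = 0"
    by (simp only: br_lin)
  then show ?thesis by (rule scale_cancel) simp
qed

end

text \<open>
  A vertex is an element just below a diamond. The existential clause of \<open>infinite_vertex\<close> records that
  \<open>y\<close> kills the chain leading up to \<open>e\<close>; it settles the chain above \<open>e\<close> in the degrees where the
  relations involving \<open>e\<close> itself degenerate modulo \<open>p\<close>.
\<close>

definition next_vertex :: "'v \<Rightarrow> 'v" where
  "next_vertex e = e \<cdot> x \<cdot> y \<lhd> h"

definition infinite_vertex :: "'v \<Rightarrow> bool" where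
  "infinite_vertex e \<longleftrightarrow> e \<cdot> x \<cdot> x = 0 \<and> e \<cdot> y \<cdot> y = 0 \<and> e \<cdot> y \<cdot> x = - (e \<cdot> x \<cdot> y) \<and>
     (\<exists>c. e = c \<lhd> (h - 1) \<and> (\<forall>l<h - 1. c \<lhd> l \<cdot> y = 0)) \<and> (\<exists>m\<ge>1. e \<in> L m)"

lemma xpow_q_zero: "e \<in> L m \<Longrightarrow> 1 \<le> m \<Longrightarrow> e \<lhd> Suc (Suc (Suc h)) = 0"
  using xpow_q[of m e] by (simp add: q_eq numeral_3_eq_3)

text \<open>For odd i use \<open>chain_odd\<close>. For even i the scalar of
  \<open>chain_even\<close> is -(i + 3); when it vanishes modulo p, the chain below \<open>e\<close>
  decides.\<close>

lemma infinite_vertex_chain: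
  assumes e: "infinite_vertex e" and "i < h"
  shows "e \<cdot> x \<cdot> y \<lhd> i \<cdot> y = 0"
  using \<open>i < h\<close>
proof (induction i rule: less_induct)
  case (less i)
  have exx: "e \<cdot> x \<cdot> x = 0" and eyy: "e \<cdot> y \<cdot> y = 0"
    and exy: "e \<cdot> x \<cdot> y = scale 1 (e \<cdot> x \<cdot> y)" and eyx: "e \<cdot> y \<cdot> x = scale (- 1) (e \<cdot> x \<cdot> y)"
    using e by (auto simp: infinite_vertex_def)
  have IH: "e \<cdot> x \<cdot> y \<lhd> l \<cdot> y = 0" if "l < i" for l
    using less that by simp
  show ?case
  proof (cases "odd i")
    case True
    then show ?thesis using chain_odd[OF exx eyy exy eyx IH] less.prems by simp
  next
    case False
    have *: "scale (- of_nat (i + 3)) (e \<cdot> x \<cdot> y \<lhd> i \<cdot> y) = 0"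
      using chain_even[OF exx eyy exy eyx IH] False less.prems by (simp add: algebra_simps)
    show ?thesis
    proof (cases "(of_nat (i + 3) :: 'f) = 0")
      case False
      then have "- of_nat (i + 3) \<noteq> (0 :: 'f)" by (simp only: neg_equal_0_iff_equal not_False_eq_True)
      with * show ?thesis by (rule scale_cancel)
    next
      case True
      have oi: "of_nat i = (- 3 :: 'f)"
        using True eq_diff_eq[of "of_nat i" 0 "3 :: 'f"] by simp
      have "i \<noteq> h - 1" using \<open>\<not> odd i\<close> even_h h_ge by auto
      moreover have "i \<noteq> h - 2"
      proof
        assume "i = h - 2"
        then have "h = i + 2" using h_ge by simp
        then have "(of_nat h :: 'f) = of_nat i + 2" by simp
        then have "(- 3 :: 'f) = - 3 + 2" unfolding oi of_nat_h .
        then show False by (simp only: add_cancel_right_right two_nonzero)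
      qed
      \<comment> \<open>With i + r + 1 = \<open>h\<close> the two binomial coefficients of
        \<open>chain_pred\<close> add up to an entry of row q - 2, which is r + 2 = 1 up to
        sign.\<close>
      moreover define r where "r = h - 1 - i"
      ultimately have r: "i + Suc r = h" "1 \<le> r" using less.prems by (auto simp: r_def)
      obtain c where c: "e = c \<lhd> (h - 1)" "\<And>l. l < h - 1 \<Longrightarrow> c \<lhd> l \<cdot> y = 0"
        using e by (auto simp: infinite_vertex_def)
      have "c \<lhd> (h - 1 - r) \<lhd> l \<cdot> y = 0" if "l < r" for l
        using c(2)[of "h - 1 - r + l"] that r by (simp add: lnp_lnp)
      moreover have "c \<lhd> (h - 1 - r) \<lhd> r = e" using c(1) r by (simp add: lnp_lnp)
      ultimately have s1: "scale (of_nat ((i + Suc r) choose r) * (- 1) - of_nat ((i + Suc r) choose Suc r) * 1)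
          (e \<cdot> x \<cdot> y \<lhd> i \<cdot> y) = 0"
        using r by (intro chain_pred[OF exx eyy exy eyx]) auto
      have s2: "of_nat ((i + Suc r) choose r) * (- 1) - of_nat ((i + Suc r) choose Suc r) * (1 :: 'f)
          = - of_nat ((h + 1) choose Suc r)"
        unfolding r(1) by simp
      have s3: "(of_nat ((h + 1) choose Suc r) :: 'f) = (-1) ^ Suc r * of_nat (Suc r + 1)"
        using r by (intro choose_q2) (simp add: q_eq)
      have s4: "(of_nat (Suc r + 1) :: 'f) = 1"
      proof -
        have "Suc r + 1 + i = h + 1" using r by simp
        then have "of_nat (Suc r + 1) + of_nat i = (of_nat h + 1 :: 'f)"
          by (metis of_nat_add of_nat_1)
        then show ?thesis unfolding oi of_nat_h by (simp only: diff_eq_eq[symmetric]) simp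
      qed
      have "scale (- ((-1) ^ Suc r * 1)) (e \<cdot> x \<cdot> y \<lhd> i \<cdot> y) = 0"
        using s1 unfolding s2 s3 s4 .
      then show ?thesis by (rule scale_cancel) simp
    qed
  qed
qed

section \<open>Products of a vertex of infinite type with \<open>v1\<close> and [v1 x]\<close>

context
  fixes e :: 'v
  assumes e: "infinite_vertex e"
begin

lemma iv_xx: "e \<cdot> x \<cdot> x = 0" and iv_yy: "e \<cdot> y \<cdot> y = 0" and iv_yx: "e \<cdot> y \<cdot> x = - (e \<cdot> x \<cdot> y)"
  using e by (auto simp: infinite_vertex_def)

lemma iv_homogeneous: obtains m where "1 \<le> m" "e \<in> L m"
  using e by (auto simp: infinite_vertex_def)

lemma iv_chain: "i < h \<Longrightarrow> e \<cdot> x \<cdot> y \<lhd> i \<cdot> y = 0"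
  using infinite_vertex_chain[OF e] .

lemma iv_y_xpow: "e \<cdot> y \<lhd> Suc i = - (e \<cdot> x \<cdot> y \<lhd> i)"
  by (simp add: lnp_Suc2[of "e \<cdot> y"] iv_yx lnp_minus)

text \<open>The q-th power of ad x kills [e y], and [e y x^q] is minus the left-hand side.\<close>

lemma iv_next_xx: "next_vertex e \<cdot> x \<cdot> x = 0"
proof -
  obtain m where "1 \<le> m" "e \<in> L m" by (rule iv_homogeneous)
  then have "e \<cdot> y \<lhd> Suc (Suc (Suc h)) = 0"
    using L_y[of e m] by (intro xpow_q_zero[of _ "Suc m"]) auto
  then have "e \<cdot> x \<cdot> y \<lhd> Suc (Suc h) = 0" using iv_y_xpow[of "Suc (Suc h)"] by simp
  then show ?thesis by (simp add: next_vertex_def xpow_Suc)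
qed

lemma iv_next_yy: "next_vertex e \<cdot> y \<cdot> y = 0"
proof -
  have "next_vertex e = e \<cdot> x \<cdot> y \<lhd> (h - 1) \<cdot> x"
    using h_ge xpow_Suc[of "e \<cdot> x \<cdot> y" "h - 1"] by (simp add: next_vertex_def)
  moreover have "e \<cdot> x \<cdot> y \<lhd> (h - 1) \<cdot> y = 0" using h_ge by (intro iv_chain) simp
  ultimately show ?thesis using yyx by simp
qed

lemma iv_next_pred:
  "\<exists>c. next_vertex e = c \<lhd> (h - 1) \<and> (\<forall>l<h - 1. c \<lhd> l \<cdot> y = 0)"
proof (intro exI conjI allI impI)
  show "next_vertex e = e \<cdot> x \<cdot> y \<cdot> x \<lhd> (h - 1)"
    using h_ge lnp_Suc2[of "e \<cdot> x \<cdot> y" x "h - 1"] by (simp add: next_vertex_def)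
  fix l assume "l < h - 1"
  then show "e \<cdot> x \<cdot> y \<cdot> x \<lhd> l \<cdot> y = 0"
    using iv_chain[of "Suc l"] by (simp add: lnp_Suc2)
qed

lemma iv_next_L: "\<exists>m\<ge>1. next_vertex e \<in> L m"
proof -
  obtain m where m: "1 \<le> m" "e \<in> L m" by (rule iv_homogeneous)
  then have "e \<cdot> x \<cdot> y \<in> L (Suc (Suc m))" using L_x L_y by simp
  then show ?thesis unfolding next_vertex_def by (intro exI[of _ "Suc (Suc m) + h"]) (simp add: L_xpow[of _ "Suc (Suc m)" h, simplified])
qed

lemma iv_next_infinite:
  "next_vertex e \<cdot> x \<cdot> y + next_vertex e \<cdot> y \<cdot> x = 0 \<Longrightarrow> infinite_vertex (next_vertex e)"
  unfolding infinite_vertex_def[of "next_vertex e"]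
  using iv_next_xx iv_next_yy iv_next_pred iv_next_L by (simp add: eq_neg_iff_add_eq_0 add.commute)

lemma iv_v1: "e \<cdot> v1 = next_vertex e"
proof -
  have "e \<cdot> v1 = e \<cdot> y \<lhd> Suc h - scale (of_nat (Suc h)) (e \<cdot> x \<cdot> y \<lhd> h)"
    unfolding v1_def by (rule br_y_pow_head[OF iv_xx])
  also have "\<dots> = scale (- 1 - of_nat (Suc h)) (next_vertex e)"
    by (simp only: iv_y_xpow next_vertex_def scale_left_diff_distrib scale_minus_left scale_one)
  also have "- 1 - of_nat (Suc h) = (1 :: 'f)" by simp
  finally show ?thesis by simp
qed

lemma iv_x_v1: "e \<cdot> x \<cdot> v1 = next_vertex e \<cdot> x"
proof -
  have "e \<cdot> x \<lhd> l \<cdot> y = 0" if "l \<notin> {0}" for l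
    using that iv_xx by (cases l) (simp_all add: lnp_Suc2)
  then have "e \<cdot> x \<cdot> v1 = (\<Sum>l\<in>{0}. scale (of_nat (l + 1)) (e \<cdot> x \<lhd> l \<cdot> y \<lhd> (h + 1 - l)))"
    by (intro br_v1_cut) auto
  then show ?thesis by (simp add: next_vertex_def xpow_Suc)
qed

lemma iv_y_v1: "e \<cdot> y \<cdot> v1 = next_vertex e \<cdot> y"
proof -
  have "e \<cdot> y \<lhd> l \<cdot> y = 0" if "l < Suc h" for l
    using that iv_yy iv_chain by (cases l) (simp_all add: iv_y_xpow br_lin)
  then have "e \<cdot> y \<cdot> v1 = scale ((-1) ^ Suc h) (e \<cdot> y \<lhd> Suc h \<cdot> y)"
    unfolding v1_def by (intro br_y_pow_last) auto
  then show ?thesis using even_h by (simp add: iv_y_xpow next_vertex_def br_lin)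
qed

lemma iv_xy_v1:
  "e \<cdot> x \<cdot> y \<cdot> v1 = - (scale 2 (next_vertex e \<cdot> y \<cdot> x) + next_vertex e \<cdot> x \<cdot> y)"
proof -
  have "e \<cdot> x \<cdot> y \<cdot> v1 = scale ((-1) ^ h)
    (scale (of_nat (Suc h)) (e \<cdot> x \<cdot> y \<lhd> h \<cdot> y \<cdot> x) - e \<cdot> x \<cdot> y \<lhd> h \<cdot> x \<cdot> y)"
    unfolding v1_def using iv_chain by (intro br_y_pow_last2) auto
  moreover have "of_nat (Suc h) = (- 2 :: 'f)" by simp
  ultimately show ?thesis using even_h unfolding next_vertex_def by (simp del: of_nat_Suc)
qed

lemma iv_v1x: "e \<cdot> (v1 \<cdot> x) = 0"
  by (simp add: br_br iv_v1 iv_x_v1)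

lemma iv_x_v1x: "e \<cdot> x \<cdot> (v1 \<cdot> x) = 0"
  by (simp add: br_br iv_x_v1 iv_xx iv_next_xx)

text \<open>The right-hand side is the defect of the next diamond from infinite type. Hence a
  product with [v1 x] tests the type of that diamond.\<close>

lemma iv_y_v1x: "e \<cdot> y \<cdot> (v1 \<cdot> x) = - (next_vertex e \<cdot> x \<cdot> y + next_vertex e \<cdot> y \<cdot> x)"
  by (simp add: br_br iv_y_v1 iv_yx br_lin iv_xy_v1 scale_two)

end

text \<open>Walk back down the chain: each element is killed by \<open>y\<close>, and by
  \<open>x\<close> once its successor is zero.\<close>

lemma iv_nonzero_next:
  assumes e: "infinite_vertex e" and nz: "e \<noteq> 0"
  shows "next_vertex e \<noteq> 0"
proof
  assume z: "next_vertex e = 0"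
  obtain m where m: "1 \<le> m" "e \<in> L m" by (rule iv_homogeneous[OF e])
  then have L: "e \<cdot> x \<in> L (Suc m)" "e \<cdot> y \<in> L (Suc m)" "e \<cdot> x \<cdot> y \<in> L (Suc (Suc m))"
    using L_x L_y by simp_all
  have "e \<cdot> x \<cdot> y \<lhd> i = 0" if "i \<le> h" for i
    using that
  proof (induction i rule: inc_induct)
    case base
    then show ?case using z by (simp add: next_vertex_def)
  next
    case (step i)
    show ?case
      using L_xpow[OF L(3), of i] by (rule killed_by_generators)
        (use step iv_chain[OF e, of i] in \<open>simp_all add: xpow_Suc\<close>)
  qed
  from this[of 0] have xy: "e \<cdot> x \<cdot> y = 0" by simp
  have "e \<cdot> x = 0" using L(1) by (rule killed_by_generators) (simp_all add: xy iv_xx[OF e])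
  moreover have "e \<cdot> y = 0" using L(2)
    by (rule killed_by_generators) (simp_all add: xy iv_yx[OF e] iv_yy[OF e])
  ultimately show False using killed_by_generators[OF m(2,1)] nz by simp
qed

subsection \<open>The sequence of vertices\<close>

lemma in_span_single: "d \<in> span {c} \<longleftrightarrow> (\<exists>r. d = scale r c)"
  by (auto simp: span_singleton)

lemma span_singleI:
  assumes "c \<in> L m" "1 \<le> m" "\<And>d. d \<in> L m \<Longrightarrow> \<exists>r. d = scale r c"
  shows "L m = span {c}"
proof
  show "L m \<subseteq> span {c}" using assms(3) in_span_single by blast
  show "span {c} \<subseteq> L m" using assms subspace_component by (intro span_minimal) auto
qed

lemma span_single_x:
  assumes "L m = span {c}" "1 \<le> m" "c \<cdot> y = 0" "c \<noteq> 0"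
  shows "L (Suc m) = span {c \<cdot> x}"
proof (rule span_singleI)
  have c: "c \<in> L m" using assms(1) span_base[of c "{c}"] by simp
  show "c \<cdot> x \<in> L (Suc m)" using L_x[OF c assms(2)] .
  fix d assume "d \<in> L (Suc m)"
  then obtain \<alpha> \<beta> where "d = scale \<alpha> (c \<cdot> x) + scale \<beta> (c \<cdot> y)"
    by (rule L_step[OF c assms(2,4)])
  then show "\<exists>r. d = scale r (c \<cdot> x)" using assms(3) by auto
qed simp

lemma span_xpow:
  assumes "L m = span {c}" "1 \<le> m" "\<And>l. l < n \<Longrightarrow> c \<lhd> l \<cdot> y = 0" "c \<lhd> n \<noteq> 0"
  shows "L (m + n) = span {c \<lhd> n}"
  using assms(3,4)
proof (induction n)
  case 0
  then show ?case using assms(1) by simp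
next
  case (Suc n)
  have "c \<lhd> n \<noteq> 0" using Suc.prems(2) by (auto simp: xpow_Suc)
  then have "L (m + n) = span {c \<lhd> n}" using Suc by simp
  then show ?case
    using span_single_x[of "m + n" "c \<lhd> n"] Suc.prems(1)[of n] \<open>c \<lhd> n \<noteq> 0\<close> assms(2) by (simp add: xpow_Suc)
qed

lemma not_all_zero:
  assumes "e \<in> L m" "1 \<le> m" "e \<noteq> 0" "e \<cdot> x \<cdot> x = 0" "e \<cdot> y \<cdot> y = 0"
  shows "e \<cdot> x \<cdot> y \<noteq> 0 \<or> e \<cdot> y \<cdot> x \<noteq> 0"
proof (rule ccontr)
  assume "\<not> ?thesis"
  then have z: "e \<cdot> x \<cdot> y = 0" "e \<cdot> y \<cdot> x = 0" by auto
  have "e \<cdot> x = 0" using L_x[OF assms(1,2)] by (rule killed_by_generators) (simp_all add: assms z)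
  moreover have "e \<cdot> y = 0" using L_y[OF assms(1,2)] by (rule killed_by_generators) (simp_all add: assms z)
  ultimately show False using killed_by_generators[OF assms(1,2)] assms(3) by simp
qed

lemma xpow_nonzero:
  assumes "c \<in> L m" "1 \<le> m" "c \<noteq> 0" "\<And>l. l < n \<Longrightarrow> c \<lhd> l \<cdot> y = 0"
  shows "c \<lhd> n \<noteq> 0"
  using assms(4)
proof (induction n)
  case (Suc n)
  then have "c \<lhd> n \<noteq> 0" by simp
  then show ?case
    using killed_by_generators[OF L_xpow[OF assms(1,2), of n]] Suc.prems[of n] assms(2) by (auto simp: xpow_Suc)
qed (use assms(3) in simp)

lemma vertex_step:
  assumes L: "L m = span {e}" "1 \<le> m" "e \<noteq> 0" and e: "e \<cdot> x \<cdot> x = 0" "e \<cdot> y \<cdot> y = 0"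
    "e \<cdot> y \<cdot> x = scale \<rho> (e \<cdot> x \<cdot> y)" and chain: "\<And>i. i < h \<Longrightarrow> e \<cdot> x \<cdot> y \<lhd> i \<cdot> y = 0"
  shows "L (m + h + 2) = span {next_vertex e}" and "next_vertex e \<noteq> 0"
proof -
  have eL: "e \<in> L m" using L(1) span_base[of e "{e}"] by simp
  have nz: "e \<cdot> x \<cdot> y \<noteq> 0" using not_all_zero[OF eL L(2,3) e(1,2)] e(3) by auto
  have exL: "e \<cdot> x \<in> L (Suc m)" "e \<cdot> x \<cdot> y \<in> L (Suc (Suc m))" using L_x[OF eL L(2)] L_y by auto
  have "L (Suc (Suc m)) = span {e \<cdot> x \<cdot> y}"
  proof (rule span_singleI[OF exL(2)])
    fix d assume d: "d \<in> L (Suc (Suc m))"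
    have "e \<cdot> x \<noteq> 0" using nz by auto
    obtain \<alpha> \<beta> where "d = scale \<alpha> (e \<cdot> x \<cdot> x) + scale \<beta> (e \<cdot> x \<cdot> y)"
      by (rule L_step[OF exL(1) _ \<open>e \<cdot> x \<noteq> 0\<close> d]) simp
    then show "\<exists>r. d = scale r (e \<cdot> x \<cdot> y)" using e(1) by auto
  qed simp
  moreover show "next_vertex e \<noteq> 0"
    unfolding next_vertex_def using exL(2) nz chain by (intro xpow_nonzero) auto
  ultimately have "L (Suc (Suc m) + h) = span {e \<cdot> x \<cdot> y \<lhd> h}"
    using chain by (intro span_xpow) (simp_all add: next_vertex_def)
  then show "L (m + h + 2) = span {next_vertex e}" by (simp add: next_vertex_def add.commute)
qed

text \<open>A zero product with \<open>x\<close> or \<open>y\<close> gives a fake diamond; otherwise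
  [z x] and [z y] are independent and the diamond is genuine.\<close>

lemma vertex_not_infinite:
  assumes L: "L m = span {z}" "1 \<le> m" "z \<noteq> 0" and z: "z \<cdot> x \<cdot> x = 0" "z \<cdot> y \<cdot> y = 0"
    and U: "z \<cdot> x \<cdot> y + z \<cdot> y \<cdot> x \<noteq> 0"
  shows "\<exists>\<nu>. finite_type_diamond x y (m + 1) \<nu>"
proof -
  have zL: "z \<in> L m" using L(1) span_base[of z "{z}"] by simp
  have zxL: "z \<cdot> x \<in> L (Suc m)" "z \<cdot> y \<in> L (Suc m)" using L_x[OF zL L(2)] L_y[OF zL L(2)] .
  have "independent {z}" using L(3) by simp
  then have dim1: "dim (L m) = 1"
    using dim_span_eq_card_independent[of "{z}"] L(1) by simp
  have ne: "L (m + 1 + 1) \<noteq> {0}" by (rule component_nonzero) simp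
  consider "z \<cdot> x = 0" | "z \<cdot> y = 0" | "z \<cdot> x \<noteq> 0" "z \<cdot> y \<noteq> 0" by blast
  then show ?thesis
  proof cases
    case 1
    then have "fake_diamond_0 x y (m + 1)"
      unfolding fake_diamond_0_def using L dim1 ne z(2) by (auto intro!: exI[of _ z])
    then show ?thesis unfolding finite_type_diamond_def by blast
  next
    case 2
    then have "fake_diamond_1 x y (m + 1)"
      unfolding fake_diamond_1_def using L dim1 ne z(1) by (auto intro!: exI[of _ z])
    then show ?thesis unfolding finite_type_diamond_def by blast
  next
    case 3
    have zyxL: "z \<cdot> y \<cdot> x \<in> L (Suc (Suc m))" using L_x[OF zxL(2)] by simp
    obtain \<alpha> \<rho> where "z \<cdot> y \<cdot> x = scale \<alpha> (z \<cdot> x \<cdot> x) + scale \<rho> (z \<cdot> x \<cdot> y)"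
      by (rule L_step[OF zxL(1) _ 3(1) zyxL]) simp
    then have \<rho>: "z \<cdot> y \<cdot> x = scale \<rho> (z \<cdot> x \<cdot> y)" using z(1) by simp
    then have "z \<cdot> x \<cdot> y + z \<cdot> y \<cdot> x = scale (1 + \<rho>) (z \<cdot> x \<cdot> y)" by (simp add: scale_left_distrib)
    then have \<rho>1: "1 + \<rho> \<noteq> 0" using U by auto
    have zxy: "z \<cdot> x \<cdot> y \<noteq> 0" using U \<rho> by auto
    \<comment> \<open>The solution of \<mu> \<rho> = 1 - \<mu>, which is the defining relation of
      type \<mu> after substituting [z y x] = \<rho> [z x y].\<close>
    define \<mu> where "\<mu> = 1 / (1 + \<rho>)"
    have "\<mu> * \<rho> = 1 - \<mu>" using \<rho>1 by (simp add: \<mu>_def field_simps)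
    then have rel: "scale \<mu> (z \<cdot> y \<cdot> x) = scale (1 - \<mu>) (z \<cdot> x \<cdot> y)" using \<rho> by simp
    have nspan: "z \<cdot> y \<notin> span {z \<cdot> x}"
    proof
      assume "z \<cdot> y \<in> span {z \<cdot> x}"
      then obtain r where r: "z \<cdot> y = scale r (z \<cdot> x)" using in_span_single by blast
      then have "z \<cdot> y \<cdot> y = scale r (z \<cdot> x \<cdot> y)" by (simp add: br_lin)
      then have "r = 0" using z(2) zxy by simp
      then show False using r 3(2) by simp
    qed
    have ind: "independent {z \<cdot> y, z \<cdot> x}"
      using nspan by (rule independent_insertI) (simp add: 3)
    have "L (Suc m) \<subseteq> span {z \<cdot> y, z \<cdot> x}"
    proof
      fix d assume "d \<in> L (Suc m)"
      then obtain \<alpha> \<beta> where "d = scale \<alpha> (z \<cdot> x) + scale \<beta> (z \<cdot> y)"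
        by (rule L_step[OF zL L(2,3)])
      then show "d \<in> span {z \<cdot> y, z \<cdot> x}"
        by (simp only:) (intro span_add span_scale span_base, simp_all)
    qed
    then have "card {z \<cdot> y, z \<cdot> x} = dim (L (Suc m))"
      using zxL ind by (intro basis_card_eq_dim) auto
    moreover have "z \<cdot> y \<noteq> z \<cdot> x" using nspan span_base[of "z \<cdot> x" "{z \<cdot> x}"] by auto
    ultimately have "dim (L (m + 1)) = 2" by simp
    then have "genuine_finite_type_diamond x y (m + 1) \<mu>"
      unfolding genuine_finite_type_diamond_def using L(2,3) zL ne z rel
      by (intro conjI bexI[of _ z]) auto
    then show ?thesis unfolding finite_type_diamond_def by blast
  qed
qed

lemma vertex_finite:
  assumes L: "L m = span {z}" "1 \<le> m" "z \<noteq> 0" and z: "z \<cdot> x \<cdot> x = 0" "z \<cdot> y \<cdot> y = 0"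
    and fin: "finite_type_diamond x y (m + 1) \<mu>"
  obtains t where "t \<noteq> 0" "z \<cdot> x \<cdot> y = scale \<mu> t" "z \<cdot> y \<cdot> x = scale (1 - \<mu>) t"
proof -
  have zL: "z \<in> L m" using L(1) span_base[of z "{z}"] by simp
  \<comment> \<open>The two relations to be proved have coefficients with sum 1, so this is the only
    possible choice. It serves the fake diamonds as well.\<close>
  define t where "t = z \<cdot> x \<cdot> y + z \<cdot> y \<cdot> x"
  have rel: "z \<cdot> x \<cdot> y = scale \<mu> t \<and> z \<cdot> y \<cdot> x = scale (1 - \<mu>) t"
  proof -
    consider (g) "genuine_finite_type_diamond x y (m + 1) \<mu>"
      | (f1) "\<mu> = 1" "fake_diamond_1 x y (m + 1)" | (f0) "\<mu> = 0" "fake_diamond_0 x y (m + 1)"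
      using fin unfolding finite_type_diamond_def by blast
    then show ?thesis
    proof cases
      case g
      then obtain w where w: "w \<in> L m" "w \<noteq> 0"
        "scale \<mu> (w \<cdot> y \<cdot> x) = scale (1 - \<mu>) (w \<cdot> x \<cdot> y)"
        unfolding genuine_finite_type_diamond_def by auto
      obtain r where r: "w = scale r z" using w(1) L(1) in_span_single by auto
      have "r \<noteq> 0" using r w(2) by auto
      have "scale r (scale \<mu> (z \<cdot> y \<cdot> x)) = scale r (scale (1 - \<mu>) (z \<cdot> x \<cdot> y))"
        using w(3) r by (simp add: br_lin mult.commute)
      then have *: "scale \<mu> (z \<cdot> y \<cdot> x) = scale (1 - \<mu>) (z \<cdot> x \<cdot> y)"
        using \<open>r \<noteq> 0\<close> scale_cancel_left by blast
      have "scale \<mu> t = scale \<mu> (z \<cdot> x \<cdot> y) + scale (1 - \<mu>) (z \<cdot> x \<cdot> y)"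
        by (simp only: t_def scale_right_distrib *)
      then have 1: "scale \<mu> t = z \<cdot> x \<cdot> y" by (simp add: scale_left_diff_distrib)
      have "scale (1 - \<mu>) t = t - scale \<mu> t" by (simp add: scale_left_diff_distrib)
      also have "\<dots> = z \<cdot> y \<cdot> x" unfolding 1 by (simp add: t_def)
      finally show ?thesis using 1 by simp
    next
      case f1
      then obtain w where w: "span {w} = L m" "w \<cdot> y = 0"
        unfolding fake_diamond_1_def by auto
      have "z \<in> span {w}" using zL w(1) by simp
      then obtain r where "z = scale r w" using in_span_single by blast
      then have "z \<cdot> y = 0" using w(2) by (simp add: br_lin)
      then show ?thesis using f1(1) by (simp add: t_def)
    next
      case f0
      then obtain w where w: "span {w} = L m" "w \<cdot> x = 0"
        unfolding fake_diamond_0_def by auto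
      have "z \<in> span {w}" using zL w(1) by simp
      then obtain r where "z = scale r w" using in_span_single by blast
      then have "z \<cdot> x = 0" using w(2) by (simp add: br_lin)
      then show ?thesis using f0(1) by (simp add: t_def)
    qed
  qed
  moreover have "t \<noteq> 0" using not_all_zero[OF zL L(2,3) z] rel by auto
  ultimately show ?thesis using that by blast
qed

text \<open>The numbering puts \<open>vtx k\<close> in degree k (q - 1) for k \<ge> 1;
  \<open>vtx 0\<close> coincides with \<open>vtx 1\<close> by truncated subtraction.\<close>

definition vtx :: "nat \<Rightarrow> 'v" where
  "vtx k = (next_vertex ^^ (k - 1)) v1"

lemma vtx_1 [simp]: "vtx (Suc 0) = v1"
  by (simp add: vtx_def)

lemma vtx_Suc: "1 \<le> k \<Longrightarrow> vtx (Suc k) = next_vertex (vtx k)"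
  by (cases k) (simp_all add: vtx_def)

end

section \<open>The chain between the second and the third diamond\<close>

locale nottingham_infinite_third = nottingham_generators scale br L p q x y h
  for scale :: "'f::field \<Rightarrow> 'v::ab_group_add \<Rightarrow> 'v"
    and br :: "'v \<Rightarrow> 'v \<Rightarrow> 'v" (infixl \<open>\<cdot>\<close> 70)
    and L :: "nat \<Rightarrow> 'v set"
    and p q :: nat
    and x y :: 'v
    and h :: nat +
  assumes third_diamond: "infinite_type_diamond x y (2 * q - 1)"
begin

lemma third_diamond_vertex:
  obtains w where "w \<in> L (2 * h + 4)" "w \<noteq> 0" "w \<cdot> x \<cdot> x = 0" "w \<cdot> y \<cdot> y = 0" "w \<cdot> y \<cdot> x = - (w \<cdot> x \<cdot> y)"
proof -
  have "2 * q - 1 - 1 = 2 * h + 4" by (simp add: q_eq)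
  then show ?thesis using third_diamond that unfolding infinite_type_diamond_def by auto
qed

lemma dim_third: "dim (L (2 * h + 5)) = 2"
proof -
  have "2 * q - 1 = 2 * h + 5" by (simp add: q_eq)
  then show ?thesis using third_diamond unfolding infinite_type_diamond_def by auto
qed

text \<open>Here the scalar of \<open>chain_even\<close> is -(i + 5). It always vanishes at i =
  \<open>h\<close> - 2, since \<open>h\<close> = -3 in the field, and that degree needs an argument
  of its own.\<close>

lemma v1_chain:
  assumes "i < h" shows "v1 \<cdot> x \<cdot> y \<lhd> i \<cdot> y = 0"
  using assms
proof (induction i rule: less_induct)
  case (less i)
  have exy: "v1 \<cdot> x \<cdot> y = scale 1 (v1 \<cdot> x \<cdot> y)" by simp
  note E = v1xx v1yy exy v1yx
  let ?b = "v1 \<cdot> x \<cdot> y \<lhd> i"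
  have IH: "v1 \<cdot> x \<cdot> y \<lhd> l \<cdot> y = 0" if "l < i" for l
    using less that by simp
  show ?case
  proof (cases "odd i")
    case True
    then show ?thesis using chain_odd[OF E IH] less.prems by simp
  next
    case False
    have "scale (2 * (- 2) - of_nat (Suc i) * 1) (?b \<cdot> y) = 0"
      using chain_even[OF E IH] False less.prems by simp
    moreover have "2 * (- 2) - of_nat (Suc i) * 1 = (- of_nat (i + 5) :: 'f)" by simp
    ultimately have *: "scale (- of_nat (i + 5)) (?b \<cdot> y) = 0" by (simp only:)
    have "i \<noteq> h - 1" using False even_h h_ge by auto
    show ?thesis
    proof (cases "(of_nat (i + 5) :: 'f) = 0")
      case False
      then have "- of_nat (i + 5) \<noteq> (0 :: 'f)" by (simp only: neg_equal_0_iff_equal not_False_eq_True)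
      with * show ?thesis by (rule scale_cancel)
    next
      case True
      show ?thesis
      proof (cases "i = h - 2")
        case False
        then have ih: "i + Suc 2 \<le> h" using \<open>i \<noteq> h - 1\<close> less.prems by simp
        \<comment> \<open>This uses \<open>chain_pred\<close> with r = 2; for r = 1 and i = -5 in
          the field its scalar would be 6 - 6 = 0.\<close>
        have "y \<lhd> (h - 1) \<lhd> l \<cdot> y = 0" if "l < 2" for l
          unfolding lnp_lnp using h_ge that by (intro y_pow_y) simp
        moreover have "y \<lhd> (h - 1) \<lhd> 2 = v1" using h_ge by (simp add: lnp_lnp v1_def[symmetric])
        ultimately have "scale (of_nat ((i + Suc 2) choose 2) * (- 2) - of_nat ((i + Suc 2) choose Suc 2) * 1)
            (?b \<cdot> y) = 0"
          using ih by (intro chain_pred[OF E]) auto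
        \<comment> \<open>The factor 6 clears the denominators of the binomial coefficients C(i + 3,
          2) and C(i + 3, 3).\<close>
        then have "scale 6 (scale (of_nat ((i + Suc 2) choose 2) * (- 2) - of_nat ((i + Suc 2) choose Suc 2) * 1)
            (?b \<cdot> y)) = 0" by (simp only: scale_zero_right)
        moreover have "6 * (of_nat ((i + Suc 2) choose 2) * (- 2) - of_nat ((i + Suc 2) choose Suc 2) * 1) = (- 12 :: 'f)"
        proof -
          let ?n = "i + 3"
          have n: "of_nat ?n = (- 2 :: 'f)" and n1: "of_nat (i + 2) = (- 3 :: 'f)" and n2: "of_nat (i + 1) = (- 4 :: 'f)"
            using True eq_diff_eq[of "of_nat i" 0 "5 :: 'f"] by simp_all
          have "2 * (?n choose 2) = ?n * (i + 2)"
            using times_binomial_minus1_eq[of 2 ?n] by simp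
          then have "(of_nat (2 * (?n choose 2)) :: 'f) = of_nat ?n * of_nat (i + 2)"
            by (simp only: of_nat_mult)
          then have c2: "2 * of_nat (?n choose 2) = (6 :: 'f)" unfolding n n1 of_nat_mult by simp
          have "3 * (?n choose 3) = ?n * ((i + 2) choose 2)"
            using times_binomial_minus1_eq[of 3 ?n] by simp
          moreover have "2 * ((i + 2) choose 2) = (i + 2) * (i + 1)"
            using times_binomial_minus1_eq[of 2 "i + 2"] by simp
          ultimately have "2 * (3 * (?n choose 3)) = ?n * ((i + 2) * (i + 1))" by (metis mult.left_commute)
          then have "(of_nat (2 * (3 * (?n choose 3))) :: 'f) = of_nat ?n * (of_nat (i + 2) * of_nat (i + 1))"
            by (simp only: of_nat_mult)
          then have c3: "6 * of_nat (?n choose 3) = (- 24 :: 'f)" unfolding n n1 n2 of_nat_mult by simp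
          have e: "i + Suc 2 = ?n" "Suc 2 = 3" by simp_all
          have "6 * (of_nat ((i + Suc 2) choose 2) * (- 2) - of_nat ((i + Suc 2) choose Suc 2) * 1) =
              - 6 * (2 * of_nat (?n choose 2)) - (6 * of_nat (?n choose 3) :: 'f)"
            unfolding e by (simp add: algebra_simps)
          also have "\<dots> = - 12" unfolding c2 c3 by simp
          finally show ?thesis .
        qed
        ultimately have "scale (- 12) (?b \<cdot> y) = 0" by (simp only: scale_scale)
        moreover have "(- 12 :: 'f) \<noteq> 0"
        proof -
          have "(3 :: 'f) * 4 \<noteq> 0" by (simp only: mult_eq_0_iff) simp
          then show ?thesis by simp
        qed
        ultimately show ?thesis by (rule scale_cancel)
      next
        case True
        then have i: "h = Suc (Suc i)" using h_ge by simp
        have oi: "of_nat (Suc i) = (- 4 :: 'f)"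
        proof -
          have "(of_nat h :: 'f) = of_nat (Suc i) + 1" using i by simp
          then show ?thesis using eq_diff_eq[of "of_nat (Suc i)" "- 3" "1 :: 'f"] by simp
        qed
        have "scale 2 (?b \<cdot> x \<cdot> y) = scale (of_nat (Suc i)) (?b \<cdot> y \<cdot> x)"
          using chain_next[OF E IH] \<open>\<not> odd i\<close> i by simp
        then have "scale 2 (?b \<cdot> x \<cdot> y) = scale 2 (scale (- 2) (?b \<cdot> y \<cdot> x))" unfolding oi by simp
        then have bxy: "?b \<cdot> x \<cdot> y = scale (- 2) (?b \<cdot> y \<cdot> x)"
          using scale_cancel_left two_nonzero by blast
        have "i \<ge> 1" using i h_ge by simp
        then have "?b = v1 \<cdot> x \<cdot> y \<lhd> (i - 1) \<cdot> x" by (cases i) (simp_all add: xpow_Suc)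
        then have byy: "?b \<cdot> y \<cdot> y = 0" using IH[of "i - 1"] \<open>i \<ge> 1\<close> yyx by simp
        \<comment> \<open>\<open>xyy_eq\<close> gives [b x y y] = 2 [b y x y], while [b x y] = -2
          [b y x] gives the opposite value.\<close>
        have byxy: "?b \<cdot> y \<cdot> x \<cdot> y = 0"
        proof -
          have "scale (- 2) (?b \<cdot> y \<cdot> x \<cdot> y) = scale 2 (?b \<cdot> y \<cdot> x \<cdot> y)"
            using xyy_eq[OF byy] unfolding bxy by (simp only: br_lin scale_two)
          then have "scale (- 2 - 2) (?b \<cdot> y \<cdot> x \<cdot> y) = 0" by (simp only: scale_left_diff_distrib diff_self)
          then show ?thesis by (rule scale_cancel) simp
        qed
        text \<open>The only use of the dimension of \<open>L (2 * q - 1)\<close>: the relations alone would allow a diamond here.\<close>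
        show ?thesis
        proof (rule ccontr)
          assume nz: "?b \<cdot> y \<noteq> 0"
          have "v1 \<cdot> x \<cdot> y \<in> L (h + 4)" using L_y[OF L_x[OF v1_L]] by (simp add: numeral_eq_Suc)
          then have "?b \<in> L (h + 4 + i)" by (rule L_xpow) simp
          then have byL: "?b \<cdot> y \<in> L (Suc (h + 4 + i))" by (rule L_y) simp
          obtain w where w: "w \<in> L (2 * h + 4)" "w \<noteq> 0" by (rule third_diamond_vertex)
          have deg: "2 * h + 4 = Suc (Suc (h + 4 + i))" using i by simp
          obtain \<alpha> \<beta> where "w = scale \<alpha> (?b \<cdot> y \<cdot> x) + scale \<beta> (?b \<cdot> y \<cdot> y)"
            by (rule L_step[OF byL _ nz]) (use w(1) deg in auto)
          then have wy: "w \<cdot> y = 0" by (simp add: byy byxy br_lin)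
          have "L (2 * h + 5) \<subseteq> span {w \<cdot> x}"
          proof
            fix d assume "d \<in> L (2 * h + 5)"
            then have d: "d \<in> L (Suc (2 * h + 4))" by (simp add: numeral_eq_Suc)
            obtain \<alpha> \<beta> where "d = scale \<alpha> (w \<cdot> x) + scale \<beta> (w \<cdot> y)"
              by (rule L_step[OF w(1) _ w(2) d]) simp
            then show "d \<in> span {w \<cdot> x}" using wy in_span_single by auto
          qed
          then have "dim (L (2 * h + 5)) \<le> card {w \<cdot> x}" by (intro dim_le_card) auto
          then show False using dim_third by simp
        qed
      qed
    qed
  qed
qed

end

section \<open>The run of diamonds of infinite type\<close>

locale nottingham_earliest_finite = nottingham_infinite_third scale br L p q x y h
  for scale :: "'f::field \<Rightarrow> 'v::ab_group_add \<Rightarrow> 'v"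
    and br :: "'v \<Rightarrow> 'v \<Rightarrow> 'v" (infixl \<open>\<cdot>\<close> 70)
    and L :: "nat \<Rightarrow> 'v set"
    and p q :: nat
    and x y :: 'v
    and h :: nat +
  fixes a :: nat and \<mu> :: 'f
  assumes a_ge: "3 \<le> a"
    and earliest: "earliest_finite_type_diamond x y (a * (h + 2) + 1) \<mu>"
begin

lemma vtx_2: "vtx 2 = next_vertex v1"
  using vtx_Suc[of 1] by (simp add: numeral_2_eq_2)

lemma span_vtx_2: "L (2 * h + 4) = span {vtx 2}" and vtx_2_nonzero: "vtx 2 \<noteq> 0"
proof -
  have *: "L (h + 2 + h + 2) = span {next_vertex v1}" "next_vertex v1 \<noteq> 0"
    by (rule vertex_step[OF span_v1[symmetric] _ v1_nonzero v1xx v1yy v1yx v1_chain]; simp)+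
  have deg: "h + 2 + h + 2 = 2 * h + 4" by simp
  show "L (2 * h + 4) = span {vtx 2}" "vtx 2 \<noteq> 0" using * unfolding vtx_2 deg .
qed

lemma vtx_2_infinite: "infinite_vertex (vtx 2)"
proof -
  obtain w where w: "w \<in> L (2 * h + 4)" "w \<noteq> 0" "w \<cdot> x \<cdot> x = 0" "w \<cdot> y \<cdot> y = 0"
    "w \<cdot> y \<cdot> x = - (w \<cdot> x \<cdot> y)" by (rule third_diamond_vertex)
  then obtain r where r: "w = scale r (vtx 2)" using span_vtx_2 in_span_single by auto
  then have "r \<noteq> 0" using w(2) by auto
  have "scale r (vtx 2 \<cdot> x \<cdot> x) = 0" "scale r (vtx 2 \<cdot> y \<cdot> y) = 0"
    "scale r (vtx 2 \<cdot> y \<cdot> x) = scale r (- (vtx 2 \<cdot> x \<cdot> y))"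
    using w(3-5) by (simp_all add: r br_lin)
  then have rel: "vtx 2 \<cdot> x \<cdot> x = 0" "vtx 2 \<cdot> y \<cdot> y = 0" "vtx 2 \<cdot> y \<cdot> x = - (vtx 2 \<cdot> x \<cdot> y)"
    using \<open>r \<noteq> 0\<close> scale_cancel_left[of r] by (simp, simp, blast)
  have "vtx 2 = v1 \<cdot> x \<cdot> y \<cdot> x \<lhd> (h - 1)"
    using h_ge lnp_Suc2[of "v1 \<cdot> x \<cdot> y" x "h - 1"] by (simp add: vtx_2 next_vertex_def)
  moreover have "v1 \<cdot> x \<cdot> y \<cdot> x \<lhd> l \<cdot> y = 0" if "l < h - 1" for l
    using v1_chain[of "Suc l"] that by (simp add: lnp_Suc2)
  ultimately have "\<exists>c. vtx 2 = c \<lhd> (h - 1) \<and> (\<forall>l<h - 1. c \<lhd> l \<cdot> y = 0)" by blast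
  moreover have "vtx 2 \<in> L (2 * h + 4)" using span_vtx_2 span_base by auto
  then have "\<exists>m\<ge>1. vtx 2 \<in> L m" by (intro exI[of _ "2 * h + 4"]) simp
  ultimately show ?thesis using rel by (simp add: infinite_vertex_def)
qed

text \<open>A vertex before \<open>vtx a\<close> that is not of infinite type would produce a
  diamond of finite type in too small a degree.\<close>

lemma vtx_induct:
  assumes "2 \<le> k" "k \<le> a"
  shows "L (k * (h + 2)) = span {vtx k} \<and> vtx k \<noteq> 0 \<and> (k < a \<longrightarrow> infinite_vertex (vtx k))"
  using assms
proof (induction k rule: nat_induct_at_least)
  case base
  have deg: "2 * (h + 2) = 2 * h + 4" by simp
  show ?case unfolding deg using span_vtx_2 vtx_2_nonzero vtx_2_infinite by blast
next
  case (Suc k)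
  then have k: "L (k * (h + 2)) = span {vtx k}" "vtx k \<noteq> 0" "infinite_vertex (vtx k)" by simp_all
  have next_k: "vtx (Suc k) = next_vertex (vtx k)" using Suc.hyps by (simp add: vtx_Suc)
  have yx: "vtx k \<cdot> y \<cdot> x = scale (- 1) (vtx k \<cdot> x \<cdot> y)" by (simp add: iv_yx[OF k(3)])
  have "1 \<le> k * (h + 2)" using Suc.hyps by simp
  note step = vertex_step[OF k(1) this k(2) iv_xx[OF k(3)] iv_yy[OF k(3)] yx iv_chain[OF k(3)]]
  have deg: "k * (h + 2) + h + 2 = Suc k * (h + 2)" by simp
  have sp: "L (Suc k * (h + 2)) = span {vtx (Suc k)}" "vtx (Suc k) \<noteq> 0"
    using step unfolding deg next_k by simp_all
  have "infinite_vertex (vtx (Suc k))" if "Suc k < a"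
    unfolding next_k
  proof (rule iv_next_infinite[OF k(3)], rule ccontr)
    assume U: "next_vertex (vtx k) \<cdot> x \<cdot> y + next_vertex (vtx k) \<cdot> y \<cdot> x \<noteq> 0"
    have "\<exists>\<nu>. finite_type_diamond x y (Suc k * (h + 2) + 1) \<nu>"
      by (rule vertex_not_infinite[OF sp(1)[unfolded next_k] _ sp(2)[unfolded next_k]
            iv_next_xx[OF k(3)] iv_next_yy[OF k(3)] U]) simp
    moreover have "Suc k * (h + 2) + 1 < a * (h + 2) + 1"
      using that by (simp only: add_less_cancel_right mult_less_cancel2) simp
    moreover have "q < Suc k * (h + 2) + 1"
    proof -
      have "q < 2 * (h + 2) + 1" by (simp add: q_eq)
      also have "2 * (h + 2) + 1 \<le> Suc k * (h + 2) + 1"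
        using Suc.hyps by (intro add_le_mono1 mult_le_mono1) simp
      finally show ?thesis .
    qed
    \<comment> \<open>The exception made for fake diamonds concerns adjacent degrees only, whereas
      the two degrees here differ by at least q - 1.\<close>
    ultimately have "Suc k * (h + 2) + 1 + 1 = a * (h + 2) + 1"
      using earliest unfolding earliest_finite_type_diamond_def by blast
    moreover have "Suc (Suc k) * (h + 2) \<le> a * (h + 2)" using that by (intro mult_le_mono1) simp
    ultimately show False by simp
  qed
  then show ?case using sp by blast
qed

lemma vtx_span: "2 \<le> k \<Longrightarrow> k \<le> a \<Longrightarrow> L (k * (h + 2)) = span {vtx k}"
  and vtx_nonzero: "2 \<le> k \<Longrightarrow> k \<le> a \<Longrightarrow> vtx k \<noteq> 0"
  and vtx_infinite: "2 \<le> k \<Longrightarrow> k < a \<Longrightarrow> infinite_vertex (vtx k)"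
  using vtx_induct[of k] by auto

lemma vtx_L: "2 \<le> k \<Longrightarrow> k \<le> a \<Longrightarrow> vtx k \<in> L (k * (h + 2))"
  using vtx_span[of k] span_base[of "vtx k"] by simp

lemma vtx_next: "1 \<le> k \<Longrightarrow> next_vertex (vtx k) = vtx (Suc k)"
  by (simp add: vtx_Suc)

lemma vtx_xx: "1 \<le> k \<Longrightarrow> k \<le> a \<Longrightarrow> vtx k \<cdot> x \<cdot> x = 0"
  and vtx_yy: "1 \<le> k \<Longrightarrow> k \<le> a \<Longrightarrow> vtx k \<cdot> y \<cdot> y = 0"
proof -
  assume k: "1 \<le> k" "k \<le> a"
  consider "k = 1" | "k = 2" | "3 \<le> k" using k by linarith
  then have "vtx k \<cdot> x \<cdot> x = 0 \<and> vtx k \<cdot> y \<cdot> y = 0"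
  proof cases
    case 1
    then show ?thesis by (simp add: v1xx v1yy)
  next
    case 2
    then show ?thesis using iv_xx iv_yy vtx_2_infinite by simp
  next
    case 3
    then have k: "vtx k = next_vertex (vtx (k - 1))" "infinite_vertex (vtx (k - 1))"
      using k vtx_Suc[of "k - 1"] by (auto intro: vtx_infinite)
    then show ?thesis using iv_next_xx iv_next_yy by metis
  qed
  then show "vtx k \<cdot> x \<cdot> x = 0" "vtx k \<cdot> y \<cdot> y = 0" by auto
qed

lemma vtx_yx: "2 \<le> k \<Longrightarrow> k < a \<Longrightarrow> vtx k \<cdot> y \<cdot> x = - (vtx k \<cdot> x \<cdot> y)"
  using iv_yx[OF vtx_infinite] .

lemma vtx_v1: "2 \<le> k \<Longrightarrow> k < a \<Longrightarrow> vtx k \<cdot> v1 = vtx (Suc k)"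
  using iv_v1[OF vtx_infinite, of k] vtx_next by simp

lemma vtx_x_v1: "1 \<le> k \<Longrightarrow> k < a \<Longrightarrow> vtx k \<cdot> x \<cdot> v1 = vtx (Suc k) \<cdot> x"
proof (cases "k = 1")
  case True
  have "v1 \<cdot> x \<lhd> l \<cdot> y = 0" if "l \<notin> {0}" for l
    using that v1xx by (cases l) (simp_all add: lnp_Suc2)
  then have "v1 \<cdot> x \<cdot> v1 = (\<Sum>l\<in>{0}. scale (of_nat (l + 1)) (v1 \<cdot> x \<lhd> l \<cdot> y \<lhd> (h + 1 - l)))"
    by (intro br_v1_cut) auto
  then show ?thesis using True vtx_next[of 1] by (simp add: next_vertex_def xpow_Suc)
next
  case False
  assume "1 \<le> k" "k < a"
  then show ?thesis using False iv_x_v1[OF vtx_infinite, of k] vtx_next by simp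
qed

text \<open>The product is -2 [v y x] - [v x y] with v = \<open>vtx (Suc k)\<close>, and infinite
  type at v turns this into [v x y]. Only the chain above \<open>vtx k\<close> is needed below v, so
  k = 1 is covered.\<close>

lemma vtx_xy_v1:
  assumes "1 \<le> k" "Suc k < a" shows "vtx k \<cdot> x \<cdot> y \<cdot> v1 = vtx (Suc k) \<cdot> x \<cdot> y"
proof -
  have chain: "vtx k \<cdot> x \<cdot> y \<lhd> i \<cdot> y = 0" if "i < h" for i
  proof (cases "k = 1")
    case True
    then show ?thesis using v1_chain that by simp
  next
    case False
    then show ?thesis using iv_chain[OF vtx_infinite] assms that by simp
  qed
  have "vtx k \<cdot> x \<cdot> y \<cdot> v1 = scale ((-1) ^ h)
    (scale (of_nat (Suc h)) (vtx k \<cdot> x \<cdot> y \<lhd> h \<cdot> y \<cdot> x) - vtx k \<cdot> x \<cdot> y \<lhd> h \<cdot> x \<cdot> y)"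
    unfolding v1_def using chain by (intro br_y_pow_last2) auto
  moreover have "of_nat (Suc h) = (- 2 :: 'f)" by simp
  moreover have "vtx k \<cdot> x \<cdot> y \<lhd> h = vtx (Suc k)" using vtx_next assms by (simp add: next_vertex_def)
  ultimately show ?thesis using even_h vtx_yx[of "Suc k"] assms by (simp add: scale_two del: of_nat_Suc)
qed

lemma br_derivation: "u \<cdot> w \<cdot> t = u \<cdot> t \<cdot> w + u \<cdot> (w \<cdot> t)"
  by (simp add: br_br)

section \<open>Vanishing of products of total level at most a\<close>

text \<open>Since [v_{l+1} x] = [v_l x v_1], the Jacobi identity reduces the pair (i, l + 1) to (i,
  l) and (i + 1, l), both within the bound.\<close>

lemma vtx_X: "1 \<le> l \<Longrightarrow> 2 \<le> i \<Longrightarrow> i + l \<le> a \<Longrightarrow> vtx i \<cdot> (vtx l \<cdot> x) = 0"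
proof (induction l arbitrary: i rule: nat_induct_at_least)
  case base
  then show ?case using iv_v1x[OF vtx_infinite, of i] by simp
next
  case (Suc l)
  have "vtx (Suc l) \<cdot> x = vtx l \<cdot> x \<cdot> v1" using Suc vtx_x_v1[of l] by simp
  then show ?case using Suc.IH[of i] Suc.IH[of "Suc i"] Suc vtx_v1[of i] by (simp add: br_br[of "vtx i"])
qed

text \<open>The same reduction; the bound is strict because the base case needs infinite type at
  v_{i+1}.\<close>

lemma vtx_W: "1 \<le> l \<Longrightarrow> 2 \<le> i \<Longrightarrow> i + l < a \<Longrightarrow> vtx i \<cdot> (vtx l \<cdot> x \<cdot> y) = 0"
proof (induction l arbitrary: i rule: nat_induct_at_least)
  case base
  have "vtx i \<cdot> y \<cdot> (v1 \<cdot> x) = - (vtx (Suc i) \<cdot> x \<cdot> y + vtx (Suc i) \<cdot> y \<cdot> x)"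
    using iv_y_v1x[OF vtx_infinite, of i] base vtx_next by simp
  then have "vtx i \<cdot> y \<cdot> (v1 \<cdot> x) = 0" using vtx_yx[of "Suc i"] base by simp
  moreover have "vtx i \<cdot> (v1 \<cdot> x) = 0" using vtx_X[of 1 i] base by simp
  ultimately show ?case by (simp add: br_br[of "vtx i" "v1 \<cdot> x"])
next
  case (Suc l)
  have "vtx (Suc l) \<cdot> x \<cdot> y = vtx l \<cdot> x \<cdot> y \<cdot> v1" using Suc vtx_xy_v1[of l] by simp
  then show ?case using Suc.IH[of i] Suc.IH[of "Suc i"] Suc vtx_v1[of i] by (simp add: br_br[of "vtx i"])
qed

lemma vtx_Y_X:
  assumes "1 \<le> l" "2 \<le> i" "i + l < a" shows "vtx i \<cdot> y \<cdot> (vtx l \<cdot> x) = 0"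
  using vtx_W[OF assms] vtx_X[of l i] assms by (simp add: br_br[of "vtx i" "vtx l \<cdot> x"])

lemma vtx_W_X:
  assumes "1 \<le> l" "2 \<le> i" "i + l < a" shows "vtx i \<cdot> x \<cdot> y \<cdot> (vtx l \<cdot> x) = 0"
  using br_derivation[of "vtx i \<cdot> y" "vtx l \<cdot> x" x] vtx_Y_X[OF assms] vtx_xx[of l] vtx_yx[of i] assms
  by (simp add: br_lin)

lemma vtx_X_X:
  assumes "1 \<le> l" "2 \<le> i" "i + l \<le> a" shows "vtx i \<cdot> x \<cdot> (vtx l \<cdot> x) = 0"
  using br_derivation[of "vtx i" "vtx l \<cdot> x" x] vtx_X[OF assms] vtx_xx[of l] assms by simp

lemma vtx_X_W:
  assumes "1 \<le> l" "2 \<le> i" "i + l < a" shows "vtx i \<cdot> x \<cdot> (vtx l \<cdot> x \<cdot> y) = 0"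
  using br_br[of "vtx i \<cdot> x" "vtx l \<cdot> x" y] vtx_X_X[of l i] vtx_W_X[OF assms] assms by simp

lemma vtx_Wx:
  assumes "1 \<le> l" "2 \<le> i" "i + l < a" shows "vtx i \<cdot> (vtx l \<cdot> x \<cdot> y \<cdot> x) = 0"
  using br_br[of "vtx i" "vtx l \<cdot> x \<cdot> y" x] vtx_W[OF assms] vtx_X_W[OF assms] by simp

lemma vtx_vtx: "2 \<le> l \<Longrightarrow> 2 \<le> i \<Longrightarrow> i + l \<le> a \<Longrightarrow> vtx i \<cdot> vtx l = 0"
proof (induction l arbitrary: i rule: nat_induct_at_least)
  case base
  have "vtx i \<lhd> l \<cdot> (v1 \<cdot> x \<cdot> y) = 0" for l
  proof -
    consider "l = 0" | "l = 1" | n where "l = Suc (Suc n)" by (metis One_nat_def not0_implies_Suc)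
    then show ?thesis
    proof cases
      case 1
      then show ?thesis using vtx_W[of 1 i] base by simp
    next
      case 2
      then show ?thesis using vtx_X_W[of 1 i] base by simp
    next
      case 3
      then show ?thesis using xpow_xx[of "vtx i"] vtx_xx[of i] base by simp
    qed
  qed
  then have "vtx i \<cdot> (v1 \<cdot> x \<cdot> y \<lhd> h) = 0"
    using br_lnp_cut[of "{}" h "vtx i" x "v1 \<cdot> x \<cdot> y"] by simp
  then show ?case by (simp add: vtx_2 next_vertex_def)
next
  case (Suc l)
  have "vtx (Suc l) = vtx l \<cdot> v1" using Suc vtx_v1[of l] by simp
  then show ?case using Suc.IH[of i] Suc.IH[of "Suc i"] Suc vtx_v1[of i] by (simp add: br_br[of "vtx i"])
qed

subsection \<open>The earliest diamond of finite type\<close>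

text \<open>
  Uniformly for genuine and fake diamonds, \<open>z \<cdot> x \<cdot> y = \<mu> t\<close> and \<open>z \<cdot> y \<cdot> x = (1 - \<mu>) t\<close> with \<open>t \<noteq> 0\<close>.
\<close>

definition z :: 'v where "z = vtx a"
definition u :: 'v where "u = vtx (a - 1)"
definition t :: 'v where "t = z \<cdot> x \<cdot> y + z \<cdot> y \<cdot> x"

lemma u_infinite: "infinite_vertex u"
  using a_ge unfolding u_def by (intro vtx_infinite) auto

lemma next_u: "next_vertex u = z"
  using a_ge vtx_next[of "a - 1"] unfolding u_def z_def by simp

lemma z_xx: "z \<cdot> x \<cdot> x = 0" and z_yy: "z \<cdot> y \<cdot> y = 0"
  using vtx_xx[of a] vtx_yy[of a] a_ge unfolding z_def by auto

lemma z_L: "z \<in> L (a * (h + 2))"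
  using vtx_L[of a] a_ge by (simp add: z_def)

lemma z_relations: "t \<noteq> 0 \<and> z \<cdot> x \<cdot> y = scale \<mu> t \<and> z \<cdot> y \<cdot> x = scale (1 - \<mu>) t"
proof -
  have a2: "2 \<le> a" "a \<le> a" using a_ge by auto
  have "finite_type_diamond x y (a * (h + 2) + 1) \<mu>"
    using earliest unfolding earliest_finite_type_diamond_def by blast
  then obtain t' where t': "t' \<noteq> 0" "z \<cdot> x \<cdot> y = scale \<mu> t'" "z \<cdot> y \<cdot> x = scale (1 - \<mu>) t'"
    using vertex_finite[OF vtx_span[OF a2] _ vtx_nonzero[OF a2], folded z_def, OF _ z_xx z_yy, of \<mu>]
      a_ge by auto
  then have "t = t'" by (simp add: t_def scale_left_diff_distrib)
  then show ?thesis using t' by simp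
qed

lemma t_nonzero: "t \<noteq> 0" and z_xy: "z \<cdot> x \<cdot> y = scale \<mu> t" and z_yx: "z \<cdot> y \<cdot> x = scale (1 - \<mu>) t"
  using z_relations by auto

lemma t_L: "t \<in> L (a * (h + 2) + 2)"
proof -
  have a1: "1 \<le> a * (h + 2)" using a_ge by simp
  have "z \<cdot> x \<cdot> y \<in> L (Suc (Suc (a * (h + 2))))" "z \<cdot> y \<cdot> x \<in> L (Suc (Suc (a * (h + 2))))"
    using L_x[OF z_L a1] L_y[OF z_L a1] L_y[of "z \<cdot> x"] L_x[of "z \<cdot> y"] by auto
  then have "t \<in> L (Suc (Suc (a * (h + 2))))"
    unfolding t_def by (intro subspace_add subspace_component) auto
  then show ?thesis by (simp only: add_2_eq_Suc')
qed

lemma u_X1: "u \<cdot> (v1 \<cdot> x) = 0"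
  by (rule iv_v1x[OF u_infinite])

lemma ux_X1: "u \<cdot> x \<cdot> (v1 \<cdot> x) = 0"
  by (rule iv_x_v1x[OF u_infinite])

lemma br_X1_x: "c \<cdot> (v1 \<cdot> x) \<cdot> x = c \<cdot> x \<cdot> (v1 \<cdot> x)"
  using br_derivation[of c "v1 \<cdot> x" x] v1xx by simp

lemma br_X1_xpow: "(c \<lhd> l) \<cdot> (v1 \<cdot> x) = c \<cdot> (v1 \<cdot> x) \<lhd> l"
  by (induction l) (simp_all add: xpow_Suc br_X1_x[symmetric])

lemma uy_X1: "u \<cdot> y \<cdot> (v1 \<cdot> x) = - t"
  using iv_y_v1x[OF u_infinite] by (simp add: next_u t_def)

lemma uxy_X1: "u \<cdot> x \<cdot> y \<cdot> (v1 \<cdot> x) = t \<cdot> x"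
  using br_X1_x[of "u \<cdot> y"] by (simp add: uy_X1 iv_yx[OF u_infinite] br_lin)

text \<open>If \<open>z\<close> lay below a diamond of infinite type, \<open>t\<close> would be
  zero. Here it is a product of elements below that diamond, which makes it accessible from
  \<open>u\<close>.\<close>

lemma u_W1: "u \<cdot> (v1 \<cdot> x \<cdot> y) = t"
  by (simp add: br_br[of u "v1 \<cdot> x" y] u_X1 uy_X1)

lemma ux_W1: "u \<cdot> x \<cdot> (v1 \<cdot> x \<cdot> y) = - (t \<cdot> x)"
  by (simp add: br_br[of "u \<cdot> x" "v1 \<cdot> x" y] ux_X1 uxy_X1)

lemma uy_xpow_y: "l \<le> h \<Longrightarrow> u \<cdot> y \<lhd> l \<cdot> y = 0"
  using iv_yy[OF u_infinite] iv_chain[OF u_infinite]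
  by (cases l) (simp_all add: iv_y_xpow[OF u_infinite] br_lin)

lemma uy_xpow_W1: "l \<le> h \<Longrightarrow> (u \<cdot> y \<lhd> l) \<cdot> (v1 \<cdot> x \<cdot> y) = - (t \<lhd> l \<cdot> y)"
  by (simp add: br_br[of "u \<cdot> y \<lhd> l" "v1 \<cdot> x" y] br_X1_xpow uy_X1 lnp_minus br_lin uy_xpow_y)

lemma u_W1_xpow: "u \<cdot> (v1 \<cdot> x \<cdot> y \<lhd> i) = scale (1 + of_nat i) (t \<lhd> i)"
proof -
  have "u \<cdot> (v1 \<cdot> x \<cdot> y \<lhd> i) = t \<lhd> i + scale (of_nat i) (t \<cdot> x \<lhd> (i - 1))"
    using br_lnp_head[OF iv_xx[OF u_infinite], of "v1 \<cdot> x \<cdot> y" i]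
    by (simp add: u_W1 ux_W1 lnp_minus)
  then show ?thesis by (cases i) (simp_all add: scale_left_distrib lnp_Suc2 scale_two)
qed

text \<open>\<open>y\<close> kills [v1 x y x^i], so it may be moved past it in a product with
  \<open>u\<close>. The resulting scalar does not involve \<mu>.\<close>

lemma t_chain_parity:
  assumes "\<And>l. l < i \<Longrightarrow> t \<lhd> l \<cdot> y = 0" "i < h"
  shows "scale (1 + of_nat i + (-1) ^ i) (t \<lhd> i \<cdot> y) = 0"
proof -
  have "u \<cdot> (v1 \<cdot> x \<cdot> y \<lhd> i) \<cdot> y = u \<cdot> y \<cdot> (v1 \<cdot> x \<cdot> y \<lhd> i)"
    using br_derivation[of u "v1 \<cdot> x \<cdot> y \<lhd> i" y] v1_chain[OF assms(2)] by simp
  moreover have "u \<cdot> y \<cdot> (v1 \<cdot> x \<cdot> y \<lhd> i) = scale ((-1) ^ i) (- (t \<lhd> i \<cdot> y))"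
    using br_lnp_last[of i "u \<cdot> y" x "v1 \<cdot> x \<cdot> y"] assms by (simp add: uy_xpow_W1)
  ultimately have "scale (1 + of_nat i) (t \<lhd> i \<cdot> y) = - scale ((-1) ^ i) (t \<lhd> i \<cdot> y)"
    by (simp add: u_W1_xpow br_lin)
  then show ?thesis by (simp add: scale_left_distrib)
qed

lemma sum_atMost_two: "(\<Sum>l\<le>2. g l) = g 0 + g 1 + g 2" for g :: "nat \<Rightarrow> 'v"
  by (simp add: numeral_2_eq_2)

text \<open>\<open>t_chain_parity\<close> gives the scalar i for odd i and i + 2 for even i. Where
  it vanishes modulo p, the relations at \<open>z\<close> decide: \<open>chain_odd\<close> unless
  \<mu> = 0, and \<open>chain_even\<close> unless \<mu> = 2.\<close>

lemma t_chain: "i < h \<Longrightarrow> t \<lhd> i \<cdot> y = 0"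
proof (induction i rule: less_induct)
  case (less i)
  let ?b = "t \<lhd> i"
  note E = z_xx z_yy z_xy z_yx
  have IH: "t \<lhd> l \<cdot> y = 0" if "l < i" for l
    using less that by simp
  note par = t_chain_parity[OF IH less.prems]
  show ?case
  proof (cases "odd i")
    case odd: True
    show ?thesis
    proof (cases "(of_nat i :: 'f) = 0")
      case False
      have "(1 + of_nat i + (-1) ^ i :: 'f) = of_nat i" using odd by simp
      then have "scale (of_nat i) (?b \<cdot> y) = 0" using par by (simp only:)
      then show ?thesis using False by (rule scale_cancel)
    next
      case oi: True
      show ?thesis
      proof (cases "\<mu> = 0")
        case False
        then show ?thesis using chain_odd[OF E IH odd] less.prems by simp
      next
        case True
        have "i \<noteq> h - 1"
        proof
          assume "i = h - 1"
          then have "h = i + 1" using h_ge by simp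
          then have "(of_nat h :: 'f) = of_nat i + 1" by simp
          then have "(- 3 :: 'f) = 1" unfolding oi of_nat_h by (simp only: add_0)
          then have "(1 :: 'f) + 3 = 0" by (metis add.left_inverse)
          then show False by simp
        qed
        moreover have "i \<noteq> h - 2" using odd even_h h_ge by auto
        ultimately have ih: "i + Suc 1 \<le> h" using less.prems by simp
        obtain c where c: "z = c \<lhd> (h - 1)" "\<And>l. l < h - 1 \<Longrightarrow> c \<lhd> l \<cdot> y = 0"
          using iv_next_pred[OF u_infinite] unfolding next_u by auto
        \<comment> \<open>The immediate predecessor of \<open>z\<close>, so r = 1 in
          \<open>chain_pred\<close>; with \<mu> = 0 and i = 0 in the field the scalar is i + 2 =
          2.\<close>
        have "c \<lhd> (h - 2) \<lhd> l \<cdot> y = 0" if "l < 1" for l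
          using c(2)[of "h - 2"] h_ge that by simp
        moreover have "c \<lhd> (h - 2) \<lhd> 1 = z"
          unfolding c(1) lnp_lnp using h_ge by (simp add: Suc_diff_Suc numeral_2_eq_2)
        ultimately have "scale (of_nat ((i + Suc 1) choose 1) * (1 - \<mu>) - of_nat ((i + Suc 1) choose Suc 1) * \<mu>)
            (?b \<cdot> y) = 0"
          using ih by (intro chain_pred[OF E]) auto
        then have "scale 2 (?b \<cdot> y) = 0" using True oi by simp
        then show ?thesis by (rule scale_cancel) simp
      qed
    qed
  next
    case False
    then have even: "even i" by simp
    show ?thesis
    proof (cases "(of_nat (i + 2) :: 'f) = 0")
      case False
      have "(1 + of_nat i + (-1) ^ i :: 'f) = of_nat (i + 2)" using even by simp
      then have "scale (of_nat (i + 2)) (?b \<cdot> y) = 0" using par by (simp only:)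
      then show ?thesis using False by (rule scale_cancel)
    next
      case True
      have o3: "of_nat (i + 3) = (1 :: 'f)" and o1: "of_nat (Suc i) = (- 1 :: 'f)"
      proof -
        have "(of_nat (i + 3) :: 'f) = of_nat (i + 2) + 1" by simp
        then show "of_nat (i + 3) = (1 :: 'f)" using True by simp
        have "(of_nat (i + 2) :: 'f) = of_nat (Suc i) + 1" by simp
        then show "of_nat (Suc i) = (- 1 :: 'f)"
          using True eq_diff_eq[of "of_nat (Suc i)" 0 "1 :: 'f"] by simp
      qed
      have "i \<noteq> h - 1" using even even_h h_ge by auto
      have "i \<noteq> h - 2"
      proof
        assume "i = h - 2"
        then have "h + 1 = i + 3" using h_ge by simp
        then have "(of_nat h + 1 :: 'f) = of_nat (i + 3)" by (metis of_nat_add of_nat_1)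
        then have "(- 3 + 1 :: 'f) = 1" unfolding o3 of_nat_h .
        then show False by (simp only: add_cancel_left_left neg_equal_0_iff_equal three_nonzero)
      qed
      have ih: "i + 3 \<le> h" using \<open>i \<noteq> h - 1\<close> \<open>i \<noteq> h - 2\<close> less.prems by simp
      show ?thesis
      proof (cases "\<mu> = 2")
        case False
        have "scale (2 * (1 - \<mu>) - of_nat (Suc i) * \<mu>) (?b \<cdot> y) = 0"
          using chain_even[OF E IH even] ih by simp
        moreover have "2 * (1 - \<mu>) - of_nat (Suc i) * \<mu> = 2 - \<mu>"
          unfolding o1 by (simp add: algebra_simps)
        ultimately have "scale (2 - \<mu>) (?b \<cdot> y) = 0" by (simp only:)
        then show ?thesis by (rule scale_cancel) (use False in simp)
      next
        case mu: True
        text \<open>The relations in this degree are consistent with \<open>?b \<cdot> y \<noteq> 0\<close>, which would make \<open>?b\<close> look like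
          \<open>v1\<close>; the contradiction comes from comparing \<open>?b \<cdot> x \<cdot> x\<close> with \<open>?b \<cdot> y \<cdot> x\<close> one degree further on.\<close>
        have "i \<ge> 2"
        proof (rule ccontr)
          assume "\<not> 2 \<le> i"
          then have "i = 0" using even by presburger
          then show False using True by simp
        qed
        have "scale 2 (?b \<cdot> x \<cdot> y) = scale (- 1) (?b \<cdot> y \<cdot> x)"
          using chain_next[OF E IH even] ih mu unfolding o1 by simp
        then have byx: "?b \<cdot> y \<cdot> x = scale (- 2) (?b \<cdot> x \<cdot> y)" by simp
        have "?b = t \<lhd> (i - 1) \<cdot> x" using \<open>i \<ge> 2\<close> by (cases i) (simp_all add: xpow_Suc)
        then have byy: "?b \<cdot> y \<cdot> y = 0" using IH[of "i - 1"] \<open>i \<ge> 2\<close> yyx by simp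
        have five: "scale 5 (?b \<cdot> x \<cdot> y \<cdot> y) = 0"
        proof -
          have "?b \<cdot> x \<cdot> y \<cdot> y = scale (- 2) (?b \<cdot> x \<cdot> y \<cdot> y) + scale (- 2) (?b \<cdot> x \<cdot> y \<cdot> y)"
            using xyy_eq[OF byy] unfolding byx by (simp only: br_lin)
          then have "scale 1 (?b \<cdot> x \<cdot> y \<cdot> y) = scale (- 2 + - 2) (?b \<cdot> x \<cdot> y \<cdot> y)"
            by (simp only: scale_left_distrib scale_one)
          then have "scale (1 - (- 2 + - 2)) (?b \<cdot> x \<cdot> y \<cdot> y) = 0"
            by (simp only: scale_left_diff_distrib[of 1] diff_self)
          then show ?thesis by simp
        qed
        have seven: "scale 7 (?b \<cdot> x \<cdot> y \<cdot> y) = 0"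
        proof -
          let ?c = "t \<lhd> (i - 2)"
          have "i - 2 + 2 = i" using \<open>i \<ge> 2\<close> by simp
          then have c2: "?c \<lhd> 2 = ?b" unfolding lnp_lnp by simp
          have "?c \<lhd> l \<cdot> y = 0" if "l < 2" for l
            using IH[of "i - 2 + l"] that \<open>i \<ge> 2\<close> by (simp add: lnp_lnp)
          then have "?c \<cdot> (y \<lhd> Suc 2) = scale 3 (?b \<cdot> y \<cdot> x) - ?b \<cdot> x \<cdot> y"
            using br_y_pow_last2[of 2 ?c] unfolding c2 by simp
          moreover have "?c \<cdot> (y \<lhd> Suc 2) \<cdot> y = ?c \<cdot> y \<cdot> (y \<lhd> Suc 2)"
            using h_ge by (intro br_y_pow_y) simp
          moreover have "?c \<cdot> y = 0" using IH[of "i - 2"] \<open>i \<ge> 2\<close> by simp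
          ultimately have "(scale 3 (scale (- 2) (?b \<cdot> x \<cdot> y)) - ?b \<cdot> x \<cdot> y) \<cdot> y = 0"
            unfolding byx by simp
          then have "scale (3 * - 2 - 1) (?b \<cdot> x \<cdot> y \<cdot> y) = 0"
            by (simp only: br_lin scale_scale scale_left_diff_distrib scale_one)
          then show ?thesis by simp
        qed
        \<comment> \<open>Either relation alone may be void, for p = 5 or p = 7; the combination has
          coefficient 1.\<close>
        have "scale (3 * 5 - 2 * 7) (?b \<cdot> x \<cdot> y \<cdot> y) = 0"
          using five seven by (simp only: scale_left_diff_distrib scale_scale[symmetric] scale_zero_right diff_self)
        then have bxyy: "?b \<cdot> x \<cdot> y \<cdot> y = 0" by simp
        \<comment> \<open>From [z d y] = [z y d] with d = [y x^(i+3)]. In the field i + 3 = 1 and i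
          + 2 = 0, so C(i + 3, 2) vanishes and the term with [b y x x] drops out.\<close>
        have main: "?b \<cdot> x \<cdot> y \<cdot> x = scale 4 (?b \<cdot> x \<cdot> x \<cdot> y)"
        proof -
          let ?c = "z \<cdot> y"
          have "- 1 = 1 - \<mu>" unfolding mu by simp
          then have cx: "?c \<lhd> Suc l = - (t \<lhd> l)" for l
            using ey_xpow[OF E, of l] by (metis scale_minus_left scale_one)
          have lhs: "z \<cdot> (y \<lhd> Suc (i + 2)) = scale (- 3) (t \<lhd> (i + 2))"
          proof -
            have "Suc (i + 2) = i + 3" by simp
            then have o: "of_nat (Suc (i + 2)) = (1 :: 'f)" using o3 by metis
            show ?thesis using e_y_pow[OF E, of "i + 2"] unfolding o mu by simp
          qed
          have "?c \<lhd> l \<cdot> y = 0" if "l < Suc i" for l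
            using that IH z_yy by (cases l) (simp_all add: cx br_lin)
          then have "?c \<cdot> (y \<lhd> (Suc i + 2)) = (\<Sum>l\<le>2. scale ((-1) ^ (Suc i + l) * of_nat ((Suc i + 2) choose (Suc i + l)))
              ((?c \<lhd> (Suc i + l)) \<cdot> y \<lhd> (2 - l)))" (is "_ = (\<Sum>l\<le>2. ?g l)")
            by (rule br_lnp_tail)
          also have "\<dots> = ?g 0 + ?g 1 + ?g 2" by (rule sum_atMost_two)
          also have "?g 0 = scale (of_nat ((i + 3) choose Suc i)) (?b \<cdot> y \<cdot> x \<cdot> x)"
          proof -
            have 1: "(- (?b \<cdot> y)) \<lhd> 2 = - (?b \<cdot> y \<cdot> x \<cdot> x)"
              by (simp add: numeral_2_eq_2 xpow_Suc br_lin)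
            have e: "Suc i + 2 = i + 3" "Suc i + 0 = Suc i" "2 - 0 = (2 :: nat)" by simp_all
            show ?thesis unfolding e cx br_minus_left 1 using even by (simp del: binomial_Suc_Suc)
          qed
          also have "?g 1 = - scale (of_nat ((i + 3) choose (i + 2))) (?b \<cdot> x \<cdot> y \<cdot> x)"
          proof -
            have e: "Suc i + 2 = i + 3" "Suc i + 1 = i + 2" "2 - 1 = Suc 0" by simp_all
            have "?c \<lhd> (i + 2) = - (?b \<cdot> x)" using cx[of "Suc i"] by (simp add: xpow_Suc)
            then show ?thesis unfolding e using even by (simp add: br_lin del: binomial_Suc_Suc)
          qed
          also have "?g 2 = ?b \<cdot> x \<cdot> x \<cdot> y"
          proof -
            have "?c \<lhd> (Suc i + 2) = - (?b \<cdot> x \<cdot> x)" using cx[of "Suc (Suc i)"] by (simp add: xpow_Suc)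
            then show ?thesis using even by (simp only: binomial_n_n) (simp add: br_lin)
          qed
          also have "((i + 3) choose (i + 2)) = i + 3"
            using binomial_symmetric[of "i + 2" "i + 3"] by simp
          also note o3
          also have "(of_nat ((i + 3) choose Suc i) :: 'f) = 0"
          proof -
            have "(i + 3) choose Suc i = (i + 3) choose 2"
              using binomial_symmetric[of "Suc i" "i + 3"] by simp
            moreover have "2 * ((i + 3) choose 2) = (i + 3) * (i + 2)"
              using times_binomial_minus1_eq[of 2 "i + 3"] by simp
            ultimately have "(of_nat (2 * ((i + 3) choose Suc i)) :: 'f) = of_nat (i + 3) * of_nat (i + 2)"
              by (metis of_nat_mult)
            then have "2 * (of_nat ((i + 3) choose Suc i) :: 'f) = 0" unfolding True of_nat_mult by simp
            then show ?thesis using two_nonzero by (simp only: mult_eq_0_iff) simp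
          qed
          finally have rhs: "?c \<cdot> (y \<lhd> Suc (i + 2)) = - (?b \<cdot> x \<cdot> y \<cdot> x) + ?b \<cdot> x \<cdot> x \<cdot> y"
            by simp
          have "z \<cdot> (y \<lhd> Suc (i + 2)) \<cdot> y = ?c \<cdot> (y \<lhd> Suc (i + 2))"
            using ih by (intro br_y_pow_y) simp
          then have eq: "scale (- 3) (?b \<cdot> x \<cdot> x \<cdot> y) = - (?b \<cdot> x \<cdot> y \<cdot> x) + ?b \<cdot> x \<cdot> x \<cdot> y"
            unfolding lhs rhs by (simp add: br_lin xpow_Suc)
          have "?b \<cdot> x \<cdot> y \<cdot> x = ?b \<cdot> x \<cdot> x \<cdot> y - scale (- 3) (?b \<cdot> x \<cdot> x \<cdot> y)"
            unfolding eq by simp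
          also have "\<dots> = scale (1 - - 3) (?b \<cdot> x \<cdot> x \<cdot> y)"
            by (simp only: scale_left_diff_distrib[of 1] scale_one)
          finally show ?thesis by simp
        qed
        show ?thesis
        proof (rule ccontr)
          assume nz: "?b \<cdot> y \<noteq> 0"
          have bL: "?b \<in> L (a * (h + 2) + 2 + i)" by (rule L_xpow[OF t_L]) simp
          have byL: "?b \<cdot> y \<in> L (Suc (a * (h + 2) + 2 + i))" by (rule L_y[OF bL]) simp
          have bxL: "?b \<cdot> x \<in> L (Suc (a * (h + 2) + 2 + i))" by (rule L_x[OF bL]) simp
          have bxxL: "?b \<cdot> x \<cdot> x \<in> L (Suc (Suc (a * (h + 2) + 2 + i)))" by (rule L_x[OF bxL]) simp
          have bxyL: "?b \<cdot> x \<cdot> y \<in> L (Suc (Suc (a * (h + 2) + 2 + i)))" by (rule L_y[OF bxL]) simp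
          obtain \<alpha> \<beta> where "?b \<cdot> x \<cdot> x = scale \<alpha> (?b \<cdot> y \<cdot> x) + scale \<beta> (?b \<cdot> y \<cdot> y)"
            by (rule L_step[OF byL _ nz bxxL]) simp
          then have "?b \<cdot> x \<cdot> x \<cdot> y = 0" by (simp add: byy byx br_lin bxyy)
          then have "?b \<cdot> x \<cdot> y \<cdot> x = 0" using main by simp
          then have "?b \<cdot> x \<cdot> y = 0" using bxyL bxyy by (intro killed_by_generators[OF bxyL]) auto
          then have "?b \<cdot> y = 0" by (intro killed_by_generators[OF byL]) (auto simp: byy byx)
          then show False using nz by simp
        qed
      qed
    qed
  qed
qed

section \<open>The first vertex after the diamond of finite type\<close>

definition w :: 'v where "w = t \<lhd> h"

lemma t_hL: "1 \<le> a * (h + 2) + 2" by simp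

lemma w_L: "w \<in> L (a * (h + 2) + 2 + h)"
  unfolding w_def by (rule L_xpow[OF t_L t_hL])

lemma w_nonzero: "w \<noteq> 0"
  unfolding w_def by (rule xpow_nonzero[OF t_L t_hL t_nonzero t_chain])

lemma w_yy: "w \<cdot> y \<cdot> y = 0"
proof -
  have "w = t \<lhd> (h - 1) \<cdot> x" using h_ge xpow_Suc[of t "h - 1"] by (simp add: w_def)
  moreover have "t \<lhd> (h - 1) \<cdot> y = 0" using h_ge by (intro t_chain) simp
  ultimately show ?thesis using yyx by simp
qed

lemma z_v1: "z \<cdot> v1 = scale (1 + \<mu>) w"
proof -
  have "z \<cdot> v1 = scale (1 - \<mu> - of_nat (Suc h) * \<mu>) w"
    unfolding v1_def w_def by (rule e_y_pow[OF z_xx z_yy z_xy z_yx])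
  also have "1 - \<mu> - of_nat (Suc h) * \<mu> = 1 + \<mu>" by (simp add: algebra_simps)
  finally show ?thesis .
qed

lemma zx_v1: "z \<cdot> x \<cdot> v1 = scale \<mu> (w \<cdot> x)"
  using ex_y_pow[OF z_xx z_yy z_xy z_yx, of "Suc h"] by (simp add: v1_def w_def xpow_Suc)

lemma zy_v1: "z \<cdot> y \<cdot> v1 = - scale (1 - \<mu>) (w \<cdot> y)"
proof -
  have "z \<cdot> y \<lhd> l \<cdot> y = 0" if "l < Suc h" for l
    by (rule ey_xpow_y[OF z_xx z_yy z_xy z_yx t_chain]) (use that in auto)
  then have "z \<cdot> y \<cdot> v1 = scale ((-1) ^ Suc h) (z \<cdot> y \<lhd> Suc h \<cdot> y)"
    unfolding v1_def by (rule br_y_pow_last)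
  also have "z \<cdot> y \<lhd> Suc h = scale (1 - \<mu>) w"
    unfolding w_def by (rule ey_xpow[OF z_xx z_yy z_xy z_yx])
  finally show ?thesis using even_h by (simp add: br_lin scale_left_diff_distrib)
qed

lemma t_v1: "t \<cdot> v1 = - scale 2 (w \<cdot> y \<cdot> x) - w \<cdot> x \<cdot> y"
proof -
  have "t \<cdot> v1 = scale ((-1) ^ h) (scale (of_nat (Suc h)) (t \<lhd> h \<cdot> y \<cdot> x) - t \<lhd> h \<cdot> x \<cdot> y)"
    unfolding v1_def by (rule br_y_pow_last2[OF t_chain])
  moreover have "of_nat (Suc h) = (- 2 :: 'f)" by simp
  ultimately show ?thesis using even_h by (simp add: w_def del: of_nat_Suc)
qed

lemma tx_xpow: "t \<cdot> x \<lhd> (h - 1) = w" "t \<cdot> x \<lhd> h = w \<cdot> x" "t \<cdot> x \<lhd> (h + 1) = w \<cdot> x \<cdot> x"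
proof -
  have "Suc (h - 1) = h" using h_ge by simp
  then show "t \<cdot> x \<lhd> (h - 1) = w" by (metis lnp_Suc2 w_def)
  show "t \<cdot> x \<lhd> h = w \<cdot> x" by (simp add: lnp_Suc2[symmetric] w_def xpow_Suc)
  show "t \<cdot> x \<lhd> (h + 1) = w \<cdot> x \<cdot> x" by (simp add: lnp_Suc2[symmetric] w_def xpow_Suc)
qed

text \<open>The chain above \<open>t\<close> is killed up to \<open>w\<close>, so three summands of
  \<open>br_v1\<close> remain, with coefficients \<open>h\<close>, \<open>h\<close> + 1 and
  \<open>h\<close> + 2, that is -3, -2 and -1.\<close>

lemma tx_v1: "t \<cdot> x \<cdot> v1 = - scale 3 (w \<cdot> y \<cdot> x \<cdot> x) - scale 2 (w \<cdot> x \<cdot> y \<cdot> x) - w \<cdot> x \<cdot> x \<cdot> y"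
proof -
  have "t \<cdot> x \<lhd> l \<cdot> y = 0" if "l \<notin> {h - 1, h, h + 1}" "l \<le> h + 1" for l
  proof -
    have "Suc l < h" using that h_ge by auto
    then show ?thesis using t_chain[of "Suc l"] by (simp add: lnp_Suc2)
  qed
  then have "t \<cdot> x \<cdot> v1 = (\<Sum>l\<in>{h - 1, h, h + 1}. scale (of_nat (l + 1)) (t \<cdot> x \<lhd> l \<cdot> y \<lhd> (h + 1 - l)))"
    by (intro br_v1_cut) auto
  also have "\<dots> = scale (of_nat (h - 1 + 1)) (t \<cdot> x \<lhd> (h - 1) \<cdot> y \<lhd> (h + 1 - (h - 1)))
      + (scale (of_nat (h + 1)) (t \<cdot> x \<lhd> h \<cdot> y \<lhd> (h + 1 - h))
      + scale (of_nat (h + 1 + 1)) (t \<cdot> x \<lhd> (h + 1) \<cdot> y \<lhd> (h + 1 - (h + 1))))"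
  proof -
    have "h - 1 \<notin> {h, h + 1}" using h_ge by auto
    then show ?thesis by (subst sum.insert) (simp_all del: of_nat_Suc of_nat_add)
  qed
  also have "\<dots> = scale (- 3) (w \<cdot> y \<cdot> x \<cdot> x) + (scale (- 2) (w \<cdot> x \<cdot> y \<cdot> x) + scale (- 1) (w \<cdot> x \<cdot> x \<cdot> y))"
  proof -
    have "h - 1 + 1 = h" "h + 1 - (h - 1) = Suc (Suc 0)" "h + 1 - h = Suc 0" "h + 1 - (h + 1) = 0"
      using h_ge by auto
    moreover have "of_nat h = (- 3 :: 'f)" "of_nat (h + 1) = (- 2 :: 'f)" "of_nat (h + 1 + 1) = (- 1 :: 'f)"
      by simp_all
    ultimately show ?thesis by (simp only: tx_xpow xpow_Suc lnp_0)
  qed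
  finally show ?thesis by simp
qed

lemma z_X1: "z \<cdot> (v1 \<cdot> x) = w \<cdot> x"
  by (simp add: br_br z_v1 zx_v1 br_lin scale_left_distrib)

lemma zx_X1: "z \<cdot> x \<cdot> (v1 \<cdot> x) = scale \<mu> (w \<cdot> x \<cdot> x)"
  by (simp add: br_br zx_v1 z_xx br_lin)

lemma zy_X1: "z \<cdot> y \<cdot> (v1 \<cdot> x) = scale (1 - \<mu>) (w \<cdot> x \<cdot> y + w \<cdot> y \<cdot> x)"
proof -
  have "z \<cdot> y \<cdot> (v1 \<cdot> x) = scale (1 - \<mu>) (- (w \<cdot> y \<cdot> x) - t \<cdot> v1)"
    by (simp add: br_br zy_v1 z_yx br_lin scale_right_diff_distrib)
  also have "- (w \<cdot> y \<cdot> x) - t \<cdot> v1 = w \<cdot> x \<cdot> y + w \<cdot> y \<cdot> x"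
    by (simp add: t_v1 scale_two)
  finally show ?thesis .
qed

text \<open>This is [t [v1 x]], see \<open>t_X1\<close>. If [w x x] = 0, its vanishing says that
  \<open>x\<close> kills [w x y] + [w y x]; if [w y] = 0, it is the relation of infinite type at
  [w x].\<close>

definition \<theta> :: 'v where "\<theta> = w \<cdot> y \<cdot> x \<cdot> x + w \<cdot> x \<cdot> y \<cdot> x + w \<cdot> x \<cdot> x \<cdot> y"

lemma t_X1: "t \<cdot> (v1 \<cdot> x) = \<theta>"
  by (simp add: br_br t_v1 tx_v1 \<theta>_def br_lin scale_simps)

lemma z_W1: "z \<cdot> (v1 \<cdot> x \<cdot> y) = w \<cdot> x \<cdot> y - scale (1 - \<mu>) (w \<cdot> x \<cdot> y + w \<cdot> y \<cdot> x)"
  by (simp add: br_br[of z "v1 \<cdot> x" y] z_X1 zy_X1)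

lemma zx_W1: "z \<cdot> x \<cdot> (v1 \<cdot> x \<cdot> y) = scale \<mu> (w \<cdot> x \<cdot> x \<cdot> y) - scale \<mu> \<theta>"
  by (simp add: br_br[of "z \<cdot> x" "v1 \<cdot> x" y] zx_X1 z_xy t_X1 br_lin)

lemma vtx_2_eq: "vtx 2 = v1 \<cdot> x \<cdot> y \<lhd> h"
  by (simp add: vtx_2 next_vertex_def)

lemma u_v2: "u \<cdot> vtx 2 = scale (- 2) w"
  unfolding vtx_2_eq u_W1_xpow w_def by simp

lemma ux_v2: "u \<cdot> x \<cdot> vtx 2 = - (w \<cdot> x)"
proof -
  have "u \<cdot> x \<lhd> l \<cdot> (v1 \<cdot> x \<cdot> y) = 0" if "l \<notin> {0}" for l
    using that iv_xx[OF u_infinite] by (cases l) (simp_all add: lnp_Suc2)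
  then have "u \<cdot> x \<cdot> vtx 2 = (\<Sum>l\<in>{0}. scale ((-1) ^ l * of_nat (h choose l)) (u \<cdot> x \<lhd> l \<cdot> (v1 \<cdot> x \<cdot> y) \<lhd> (h - l)))"
    unfolding vtx_2_eq by (intro br_lnp_cut) auto
  then show ?thesis by (simp add: ux_W1 lnp_minus tx_xpow)
qed

lemma uy_v2: "u \<cdot> y \<cdot> vtx 2 = - (w \<cdot> y)"
proof -
  have "u \<cdot> y \<lhd> l \<cdot> (v1 \<cdot> x \<cdot> y) = 0" if "l < h" for l
    using uy_xpow_W1[of l] t_chain[of l] that by simp
  then have "u \<cdot> y \<cdot> vtx 2 = scale ((-1) ^ h) (u \<cdot> y \<lhd> h \<cdot> (v1 \<cdot> x \<cdot> y))"
    unfolding vtx_2_eq by (rule br_lnp_last)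
  then show ?thesis using even_h uy_xpow_W1[of h] by (simp add: w_def)
qed

lemma uxy_v2: "u \<cdot> x \<cdot> y \<cdot> vtx 2 = scale 3 (w \<cdot> y \<cdot> x) + z \<cdot> (v1 \<cdot> x \<cdot> y)"
proof -
  have W: "u \<cdot> x \<cdot> y \<lhd> l \<cdot> (v1 \<cdot> x \<cdot> y) = t \<lhd> Suc l \<cdot> y" if "l < h" for l
    using that iv_chain[OF u_infinite, of l]
    by (simp add: br_br[of "u \<cdot> x \<cdot> y \<lhd> l" "v1 \<cdot> x" y] br_X1_xpow uxy_X1 lnp_Suc2)
  have h1: "Suc (h - 1) = h" "h - 1 + 1 = h" using h_ge by simp_all
  have "u \<cdot> x \<cdot> y \<lhd> l \<cdot> (v1 \<cdot> x \<cdot> y) = 0" if "l < h - 1" for l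
    using W[of l] t_chain[of "Suc l"] that by simp
  then have "u \<cdot> x \<cdot> y \<cdot> (v1 \<cdot> x \<cdot> y \<lhd> (h - 1 + 1)) =
    (\<Sum>l\<le>1. scale ((-1) ^ (h - 1 + l) * of_nat ((h - 1 + 1) choose (h - 1 + l)))
      (u \<cdot> x \<cdot> y \<lhd> (h - 1 + l) \<cdot> (v1 \<cdot> x \<cdot> y) \<lhd> (1 - l)))"
    by (rule br_lnp_tail)
  also have "\<dots> = scale ((-1) ^ (h - 1) * of_nat (h choose (h - 1))) (u \<cdot> x \<cdot> y \<lhd> (h - 1) \<cdot> (v1 \<cdot> x \<cdot> y) \<cdot> x)
      + scale ((-1) ^ h) (u \<cdot> x \<cdot> y \<lhd> h \<cdot> (v1 \<cdot> x \<cdot> y))"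
    using h1 by simp
  also have "u \<cdot> x \<cdot> y \<lhd> (h - 1) \<cdot> (v1 \<cdot> x \<cdot> y) = w \<cdot> y"
    using W[of "h - 1"] h1 h_ge by (simp add: w_def)
  also have "u \<cdot> x \<cdot> y \<lhd> h = z" using next_u by (simp add: next_vertex_def)
  also have "(-1) ^ (h - 1) * of_nat (h choose (h - 1)) = (3 :: 'f)"
  proof -
    have "h choose (h - 1) = h" using h_ge binomial_symmetric[of 1 h] by simp
    moreover have "odd (h - 1)" using even_h h_ge by simp
    ultimately show ?thesis by simp
  qed
  finally show ?thesis using even_h h1 by (simp add: vtx_2_eq)
qed

lemma two_less_a: "2 < a" using a_ge by simp

lemma v2_yx: "vtx 2 \<cdot> y \<cdot> x = - (vtx 2 \<cdot> x \<cdot> y)"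
  using two_less_a by (intro vtx_yx) auto

lemma W1_v1: "vtx 2 \<cdot> x \<cdot> y = v1 \<cdot> x \<cdot> y \<cdot> v1"
  using vtx_xy_v1[of 1] two_less_a by (simp add: numeral_2_eq_2)

text \<open>Both this lemma and the next one evaluate a product with \<open>[v\<^sub>2xy] = [v\<^sub>1xyv\<^sub>1]\<close> in two ways.\<close>

lemma theta_zero: "\<theta> = 0"
proof -
  let ?U = "w \<cdot> x \<cdot> y + w \<cdot> y \<cdot> x"
  have "u \<cdot> x \<cdot> (vtx 2 \<cdot> x \<cdot> y) = u \<cdot> x \<cdot> (v1 \<cdot> x \<cdot> y) \<cdot> v1 - u \<cdot> x \<cdot> v1 \<cdot> (v1 \<cdot> x \<cdot> y)"
    unfolding W1_v1 by (rule br_br)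
  also have "\<dots> = - (t \<cdot> x \<cdot> v1) - z \<cdot> x \<cdot> (v1 \<cdot> x \<cdot> y)"
    using iv_x_v1[OF u_infinite] by (simp add: ux_W1 br_lin next_u)
  finally have 1: "u \<cdot> x \<cdot> (vtx 2 \<cdot> x \<cdot> y) = - (t \<cdot> x \<cdot> v1) - z \<cdot> x \<cdot> (v1 \<cdot> x \<cdot> y)" .
  have "u \<cdot> x \<cdot> (vtx 2 \<cdot> x \<cdot> y) = - (u \<cdot> x \<cdot> (vtx 2 \<cdot> y) \<cdot> x)"
    using br_derivation[of "u \<cdot> x" "vtx 2 \<cdot> y" x] iv_xx[OF u_infinite] v2_yx by (simp add: br_lin)
  moreover have "u \<cdot> x \<cdot> (vtx 2 \<cdot> y) = - (w \<cdot> x \<cdot> y) - u \<cdot> x \<cdot> y \<cdot> vtx 2"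
    by (simp add: br_br[of "u \<cdot> x" "vtx 2" y] ux_v2 br_lin)
  ultimately have "u \<cdot> x \<cdot> (vtx 2 \<cdot> x \<cdot> y) = (w \<cdot> x \<cdot> y + u \<cdot> x \<cdot> y \<cdot> vtx 2) \<cdot> x"
    by (simp add: br_minus_left br_diff_left br_add_left)
  then have "(w \<cdot> x \<cdot> y + u \<cdot> x \<cdot> y \<cdot> vtx 2) \<cdot> x = - (t \<cdot> x \<cdot> v1) - z \<cdot> x \<cdot> (v1 \<cdot> x \<cdot> y)"
    using 1 by simp
  then have "w \<cdot> x \<cdot> y \<cdot> x + (scale 3 (w \<cdot> y \<cdot> x \<cdot> x) + (w \<cdot> x \<cdot> y \<cdot> x - scale (1 - \<mu>) (?U \<cdot> x)))
      - (scale 3 (w \<cdot> y \<cdot> x \<cdot> x) + scale 2 (w \<cdot> x \<cdot> y \<cdot> x) + w \<cdot> x \<cdot> x \<cdot> y)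
      + (scale \<mu> (w \<cdot> x \<cdot> x \<cdot> y) - scale \<mu> \<theta>) = 0"
    unfolding uxy_v2 z_W1 tx_v1 zx_W1 by (simp add: br_lin algebra_simps)
  moreover have "w \<cdot> x \<cdot> y \<cdot> x + (scale 3 (w \<cdot> y \<cdot> x \<cdot> x) + (w \<cdot> x \<cdot> y \<cdot> x - scale (1 - \<mu>) (?U \<cdot> x)))
      - (scale 3 (w \<cdot> y \<cdot> x \<cdot> x) + scale 2 (w \<cdot> x \<cdot> y \<cdot> x) + w \<cdot> x \<cdot> x \<cdot> y)
      + (scale \<mu> (w \<cdot> x \<cdot> x \<cdot> y) - scale \<mu> \<theta>) = - \<theta>"
    by (simp add: \<theta>_def br_lin scale_simps algebra_simps)
  ultimately show ?thesis by simp
qed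

lemma w_yxy: "w \<cdot> y \<cdot> x \<cdot> y = 0" and w_xyy: "w \<cdot> x \<cdot> y \<cdot> y = 0"
proof -
  let ?U = "w \<cdot> x \<cdot> y + w \<cdot> y \<cdot> x"
  have ty: "t \<cdot> y = 0" using t_chain[of 0] h_ge by simp
  have zyX1y: "z \<cdot> y \<cdot> (v1 \<cdot> x \<cdot> y) = scale (1 - \<mu>) (?U \<cdot> y)"
    by (simp add: br_br[of "z \<cdot> y" "v1 \<cdot> x" y] zy_X1 z_yy br_lin)
  have "u \<cdot> y \<cdot> (vtx 2 \<cdot> x \<cdot> y) = u \<cdot> y \<cdot> (v1 \<cdot> x \<cdot> y) \<cdot> v1 - u \<cdot> y \<cdot> v1 \<cdot> (v1 \<cdot> x \<cdot> y)"
    unfolding W1_v1 by (rule br_br)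
  also have "\<dots> = - scale (1 - \<mu>) (?U \<cdot> y)"
    using iv_y_v1[OF u_infinite] uy_xpow_W1[of 0] ty by (simp add: next_u zyX1y)
  finally have 1: "u \<cdot> y \<cdot> (vtx 2 \<cdot> x \<cdot> y) = - scale (1 - \<mu>) (?U \<cdot> y)" .
  have "u \<cdot> y \<cdot> (vtx 2 \<cdot> x \<cdot> y) = u \<cdot> y \<cdot> (vtx 2 \<cdot> x) \<cdot> y"
    by (simp add: br_br[of "u \<cdot> y" "vtx 2 \<cdot> x" y] iv_yy[OF u_infinite])
  also have "u \<cdot> y \<cdot> (vtx 2 \<cdot> x) = - (w \<cdot> y \<cdot> x) + u \<cdot> x \<cdot> y \<cdot> vtx 2"
    by (simp add: br_br[of "u \<cdot> y" "vtx 2" x] uy_v2 iv_yx[OF u_infinite] br_lin)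
  also have "\<dots> = w \<cdot> y \<cdot> x + scale \<mu> ?U"
    unfolding uxy_v2 z_W1 by (simp add: scale_simps algebra_simps)
  finally have "w \<cdot> y \<cdot> x \<cdot> y + scale \<mu> (?U \<cdot> y) = - scale (1 - \<mu>) (?U \<cdot> y)"
    using 1 by (simp only: br_add_left br_scale_left)
  then have "w \<cdot> y \<cdot> x \<cdot> y + scale \<mu> (?U \<cdot> y) + scale (1 - \<mu>) (?U \<cdot> y) = 0"
    by (rule eq_neg_iff_add_eq_0[THEN iffD1])
  then have "w \<cdot> y \<cdot> x \<cdot> y + ?U \<cdot> y = 0" by (simp add: scale_left_diff_distrib)
  moreover have xyy: "w \<cdot> x \<cdot> y \<cdot> y = w \<cdot> y \<cdot> x \<cdot> y + w \<cdot> y \<cdot> x \<cdot> y" by (rule xyy_eq[OF w_yy])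
  \<comment> \<open>The sum of the two vanishing terms is [w x y y] + 2 [w y x y], and
    \<open>xyy\<close> doubles the coefficient.\<close>
  ultimately have "scale 4 (w \<cdot> y \<cdot> x \<cdot> y) = 0" by (simp add: br_lin scale_simps add.assoc)
  then show yxy: "w \<cdot> y \<cdot> x \<cdot> y = 0" by (rule scale_cancel) simp
  show "w \<cdot> x \<cdot> y \<cdot> y = 0" using xyy yxy by simp
qed

lemma w_xxx: "w \<cdot> x \<cdot> x \<cdot> x = 0"
  using xpow_q_zero[OF t_L t_hL] by (simp add: w_def xpow_Suc)

text \<open>The q-th power of ad x kills [z y], and [z y x^q] = (1 - \<mu>) [w x x].\<close>

lemma mu_one: "w \<cdot> x \<cdot> x \<noteq> 0 \<Longrightarrow> \<mu> = 1"
proof -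
  assume nz: "w \<cdot> x \<cdot> x \<noteq> 0"
  have "1 \<le> a * (h + 2)" using a_ge by simp
  from L_y[OF z_L this] have "z \<cdot> y \<lhd> Suc (Suc (Suc h)) = 0" by (rule xpow_q_zero) simp
  then have "scale (1 - \<mu>) (w \<cdot> x \<cdot> x) = 0"
    using ey_xpow[OF z_xx z_yy z_xy z_yx, of "Suc (Suc h)"] by (simp add: w_def xpow_Suc)
  then show "\<mu> = 1" using nz by simp
qed

text \<open>The defect [w x y] + [w y x] is killed by \<open>x\<close> because \<theta> = 0, and by
  \<open>y\<close> because of \<open>w_yxy\<close> and \<open>w_xyy\<close>.\<close>

lemma w_infinite:
  assumes xx: "w \<cdot> x \<cdot> x = 0" shows "infinite_vertex w"
proof -
  let ?U = "w \<cdot> x \<cdot> y + w \<cdot> y \<cdot> x"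
  have L1: "1 \<le> a * (h + 2) + 2 + h" by simp
  have L2: "w \<cdot> x \<in> L (Suc (a * (h + 2) + 2 + h))" "w \<cdot> y \<in> L (Suc (a * (h + 2) + 2 + h))"
    using L_x[OF w_L L1] L_y[OF w_L L1] .
  have UL: "?U \<in> L (Suc (Suc (a * (h + 2) + 2 + h)))"
    using L_y[OF L2(1)] L_x[OF L2(2)] by (intro subspace_add subspace_component) auto
  have "?U \<cdot> x = 0" using theta_zero xx by (simp add: \<theta>_def br_lin add.commute)
  moreover have "?U \<cdot> y = 0" by (simp add: br_lin w_yxy w_xyy)
  ultimately have "?U = 0" by (intro killed_by_generators[OF UL]) simp_all
  then have "w \<cdot> y \<cdot> x = - (w \<cdot> x \<cdot> y)" by (simp add: eq_neg_iff_add_eq_0 add.commute)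
  moreover have "t \<cdot> x \<lhd> l \<cdot> y = 0" if "l < h - 1" for l
    using t_chain[of "Suc l"] that by (simp add: lnp_Suc2)
  then have "\<exists>c. w = c \<lhd> (h - 1) \<and> (\<forall>l<h - 1. c \<lhd> l \<cdot> y = 0)"
    using tx_xpow(1) by (intro exI[of _ "t \<cdot> x"]) simp
  moreover have "\<exists>m\<ge>1. w \<in> L m" using w_L L1 by blast
  ultimately show ?thesis using xx w_yy by (simp add: infinite_vertex_def)
qed

text \<open>If [w y] were nonzero, covering would make [w x x] a nonzero multiple of [w y x]. Then
  [w x x x] = 0 shows that both generators kill [w y x], which must vanish, and so must
  [w y].\<close>

lemma w_y_zero:
  assumes nz: "w \<cdot> x \<cdot> x \<noteq> 0" shows "w \<cdot> y = 0"
proof (rule ccontr)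
  assume wy: "w \<cdot> y \<noteq> 0"
  have L1: "1 \<le> a * (h + 2) + 2 + h" by simp
  have L2: "w \<cdot> x \<in> L (Suc (a * (h + 2) + 2 + h))" "w \<cdot> y \<in> L (Suc (a * (h + 2) + 2 + h))"
    using L_x[OF w_L L1] L_y[OF w_L L1] .
  have L3: "w \<cdot> x \<cdot> x \<in> L (Suc (Suc (a * (h + 2) + 2 + h)))" "w \<cdot> y \<cdot> x \<in> L (Suc (Suc (a * (h + 2) + 2 + h)))"
    using L_x[OF L2(1)] L_x[OF L2(2)] by auto
  obtain \<kappa> \<nu> where "w \<cdot> x \<cdot> x = scale \<kappa> (w \<cdot> y \<cdot> x) + scale \<nu> (w \<cdot> y \<cdot> y)"
    by (rule L_step[OF L2(2) _ wy L3(1)]) simp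
  then have k: "w \<cdot> x \<cdot> x = scale \<kappa> (w \<cdot> y \<cdot> x)" by (simp add: w_yy)
  then have "scale \<kappa> (w \<cdot> y \<cdot> x \<cdot> x) = 0" using w_xxx by (simp add: br_lin)
  moreover have "\<kappa> \<noteq> 0" using nz k by auto
  ultimately have "w \<cdot> y \<cdot> x \<cdot> x = 0" by simp
  then have "w \<cdot> y \<cdot> x = 0" using w_yxy by (intro killed_by_generators[OF L3(2)]) simp_all
  then have "w \<cdot> y = 0" using w_yy by (intro killed_by_generators[OF L2(2)]) simp_all
  then show False using wy by simp
qed

text \<open>In this case the next vertex sits one degree higher, at [w x] instead of
  \<open>w\<close>.\<close>

lemma wx_infinite:
  assumes nz: "w \<cdot> x \<cdot> x \<noteq> 0" shows "infinite_vertex (w \<cdot> x)"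
proof -
  have "w \<cdot> x \<cdot> y \<cdot> x + w \<cdot> x \<cdot> x \<cdot> y = 0" using theta_zero by (simp add: \<theta>_def w_y_zero[OF nz])
  then have "w \<cdot> x \<cdot> y \<cdot> x = - (w \<cdot> x \<cdot> x \<cdot> y)" by (rule eq_neg_iff_add_eq_0[THEN iffD2])
  moreover have "w \<cdot> x = t \<cdot> x \<cdot> x \<lhd> (h - 1)"
    using tx_xpow(2) lnp_Suc2[of "t \<cdot> x" x "h - 1"] h_ge by simp
  moreover have "t \<cdot> x \<cdot> x \<lhd> l \<cdot> y = 0" if l: "l < h - 1" for l
  proof -
    have "t \<cdot> x \<cdot> x \<lhd> l = t \<lhd> Suc (Suc l)" by (simp add: lnp_Suc2)
    moreover have "t \<lhd> Suc (Suc l) \<cdot> y = 0"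
    proof (cases "Suc (Suc l) = h")
      case True
      then show ?thesis using w_y_zero[OF nz] by (simp add: w_def)
    next
      case False
      then show ?thesis using l by (intro t_chain) simp
    qed
    ultimately show ?thesis by simp
  qed
  ultimately have "\<exists>c. w \<cdot> x = c \<lhd> (h - 1) \<and> (\<forall>l<h - 1. c \<lhd> l \<cdot> y = 0)" by blast
  moreover have "\<exists>m\<ge>1. w \<cdot> x \<in> L m" using L_x[OF w_L] by (intro exI[of _ "Suc (a * (h + 2) + 2 + h)"]) auto
  ultimately show ?thesis
    using w_xxx w_xyy \<open>w \<cdot> x \<cdot> y \<cdot> x = - (w \<cdot> x \<cdot> x \<cdot> y)\<close> by (simp add: infinite_vertex_def)
qed

lemma z_v2: "z \<cdot> vtx 2 = z \<cdot> (v1 \<cdot> x \<cdot> y) \<lhd> h + scale 3 (z \<cdot> x \<cdot> (v1 \<cdot> x \<cdot> y) \<lhd> (h - 1))"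
  using br_lnp_head[OF z_xx, of "v1 \<cdot> x \<cdot> y" h] by (simp add: vtx_2_eq)

lemma z_v2_single:
  assumes "w \<cdot> x \<cdot> x = 0" shows "z \<cdot> vtx 2 = w \<cdot> v1"
proof -
  have "w \<cdot> x \<cdot> y + w \<cdot> y \<cdot> x = 0" using iv_yx[OF w_infinite[OF assms]] by simp
  then have "z \<cdot> vtx 2 = w \<cdot> x \<cdot> y \<lhd> h"
    unfolding z_v2 z_W1 zx_W1 theta_zero assms by simp
  then show ?thesis using iv_v1[OF w_infinite[OF assms]] by (simp add: next_vertex_def)
qed

text \<open>Put c = [w x x y x^(h-1)]. The two summands of \<open>z_v2\<close> contribute -c and 3
  c, while [w v1] = -2 c + 3 c = c.\<close>

lemma z_v2_double:
  assumes nz: "w \<cdot> x \<cdot> x \<noteq> 0" shows "z \<cdot> vtx 2 = scale 2 (w \<cdot> v1)"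
proof -
  let ?c = "w \<cdot> x \<cdot> x \<cdot> y \<lhd> (h - 1)"
  have h1: "Suc (h - 1) = h" using h_ge by simp
  have "w \<cdot> x \<cdot> y \<lhd> Suc (h - 1) = w \<cdot> x \<cdot> y \<cdot> x \<lhd> (h - 1)" by (rule lnp_Suc2)
  then have byh: "w \<cdot> x \<cdot> y \<lhd> h = - ?c"
    unfolding h1 using iv_yx[OF wx_infinite[OF nz]] by (simp add: lnp_minus)
  have "z \<cdot> vtx 2 = scale 2 ?c"
    unfolding z_v2 z_W1 zx_W1 theta_zero mu_one[OF nz] using byh by (simp add: scale_simps)
  moreover have "w \<cdot> v1 = ?c"
  proof -
    have "w \<lhd> l \<cdot> y = 0" if l: "l \<notin> {1, 2}" for l
    proof -
      consider "l = 0" | n where "l = Suc (Suc (Suc n))"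
        using l by (metis One_nat_def insertCI not0_implies_Suc numeral_2_eq_2)
      then show ?thesis using w_y_zero[OF nz] w_xxx by cases (simp_all add: lnp_Suc2)
    qed
    then have "w \<cdot> v1 = (\<Sum>l\<in>{1, 2}. scale (of_nat (l + 1)) (w \<lhd> l \<cdot> y \<lhd> (h + 1 - l)))"
      using h_ge by (intro br_v1_cut) auto
    also have "\<dots> = scale 2 (w \<cdot> x \<cdot> y \<lhd> h) + scale 3 ?c"
      by (simp add: xpow_Suc numeral_2_eq_2)
    finally show ?thesis unfolding byh by (simp add: scale_simps)
  qed
  ultimately show ?thesis by simp
qed

section \<open>Products of vertices from level a + 1 on\<close>

text \<open>Multiplying the vanishing product [v_{a-r-1} v_{1+r}] of level a by \<open>v1\<close>
  shows that moving one unit from left to right changes the sign.\<close>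

lemma vtx_vtx_level1:
  "1 \<le> r \<Longrightarrow> r + 2 \<le> a \<Longrightarrow> vtx (a - r) \<cdot> vtx (1 + r) = scale ((-1) ^ r * 2) w"
proof (induction r rule: nat_induct_at_least)
  case base
  then show ?case using u_v2 by (simp add: u_def numeral_2_eq_2)
next
  case (Suc r)
  have IH: "vtx (a - r) \<cdot> vtx (1 + r) = scale ((-1) ^ r * 2) w" using Suc by simp
  have "vtx (a - Suc r) \<cdot> vtx (1 + r) = 0" using Suc by (intro vtx_vtx) auto
  moreover have "vtx (a - Suc r) \<cdot> v1 = vtx (a - r)"
    using vtx_v1[of "a - Suc r"] Suc by (simp add: Suc_diff_Suc)
  moreover have "vtx (1 + r) \<cdot> v1 = vtx (1 + Suc r)" using vtx_v1[of "1 + r"] Suc by simp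
  ultimately have "0 = vtx (a - r) \<cdot> vtx (1 + r) + vtx (a - Suc r) \<cdot> vtx (1 + Suc r)"
    using br_derivation[of "vtx (a - Suc r)" "vtx (1 + r)" v1] by simp
  then have "vtx (a - Suc r) \<cdot> vtx (1 + Suc r) = - scale ((-1) ^ r * 2) w"
    unfolding IH by (metis add.commute eq_neg_iff_add_eq_0)
  then show ?case by simp
qed

lemma even_a: "even a"
proof (rule ccontr)
  assume "odd a"
  then obtain r where r: "a = 2 * r + 1" by (rule oddE)
  then have "1 \<le> r" "r + 2 \<le> a" using a_ge by auto
  then have "vtx (a - r) \<cdot> vtx (1 + r) = scale ((-1) ^ r * 2) w" by (rule vtx_vtx_level1)
  moreover have "a - r = 1 + r" using r by simp
  ultimately have "scale ((-1) ^ r * 2) w = 0" by (simp only: alternating)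
  then have "w = 0" by (rule scale_cancel) simp
  then show False using w_nonzero by simp
qed

definition m :: nat where "m = a div 2"

lemma a_eq: "a = m + m"
  using even_a by (auto simp: m_def)

lemma m_ge: "2 \<le> m"
  using a_ge a_eq by simp

text \<open>\<open>w\<close> is a nonzero multiple of [v_{m+1} v_m], the most balanced product of
  level a + 1. Thus the vanishing up to level a passes to products of \<open>w\<close> with elements
  of index up to about m.\<close>

lemma w_kill:
  assumes "vtx (m + 1) \<cdot> d = 0" "vtx m \<cdot> d = 0" shows "w \<cdot> d = 0"
proof -
  have "vtx (a - (m - 1)) \<cdot> vtx (1 + (m - 1)) = scale ((-1) ^ (m - 1) * 2) w"
    using m_ge a_eq by (intro vtx_vtx_level1) auto
  moreover have "a - (m - 1) = m + 1" "1 + (m - 1) = m" using m_ge a_eq by auto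
  ultimately have "vtx (m + 1) \<cdot> vtx m = scale ((-1) ^ (m - 1) * 2) w" by simp
  then have "scale ((-1) ^ (m - 1) * 2) (w \<cdot> d) = vtx (m + 1) \<cdot> vtx m \<cdot> d" by (simp add: br_lin)
  also have "\<dots> = 0" using br_derivation[of "vtx (m + 1)" "vtx m" d] assms by simp
  finally show ?thesis by (rule scale_cancel) simp
qed

lemma w_X: "1 \<le> l \<Longrightarrow> l + 1 \<le> m \<Longrightarrow> w \<cdot> (vtx l \<cdot> x) = 0"
  using m_ge a_eq by (intro w_kill vtx_X) auto

lemma w_W: "1 \<le> l \<Longrightarrow> l + 2 \<le> m \<Longrightarrow> w \<cdot> (vtx l \<cdot> x \<cdot> y) = 0"
  using m_ge a_eq by (intro w_kill vtx_W) auto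

lemma w_Wx: "1 \<le> l \<Longrightarrow> l + 2 \<le> m \<Longrightarrow> w \<cdot> (vtx l \<cdot> x \<cdot> y \<cdot> x) = 0"
  using m_ge a_eq by (intro w_kill vtx_Wx) auto

lemma w_vtx: "2 \<le> l \<Longrightarrow> l + 1 \<le> m \<Longrightarrow> w \<cdot> vtx l = 0"
  using m_ge a_eq by (intro w_kill vtx_vtx) auto

lemma wy_X:
  assumes "1 \<le> l" "l + 2 \<le> m" shows "w \<cdot> y \<cdot> (vtx l \<cdot> x) = 0"
  using br_derivation[of w "vtx l \<cdot> x" y] w_X[of l] w_W[OF assms] assms by simp

lemma wx_X:
  assumes "1 \<le> l" "l + 1 \<le> m" shows "w \<cdot> x \<cdot> (vtx l \<cdot> x) = 0"
  using br_derivation[of w "vtx l \<cdot> x" x] w_X[OF assms] vtx_xx[of l] assms a_eq by simp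

lemma wxy_X:
  assumes "1 \<le> l" "l + 2 \<le> m" shows "w \<cdot> x \<cdot> y \<cdot> (vtx l \<cdot> x) = 0"
proof -
  have "w \<cdot> x \<cdot> (vtx l \<cdot> x \<cdot> y) = 0"
    using br_derivation[of w "vtx l \<cdot> x \<cdot> y" x] w_W[OF assms] w_Wx[OF assms] by simp
  then show ?thesis
    using br_derivation[of "w \<cdot> x" "vtx l \<cdot> x" y] wx_X[of l] assms by simp
qed

lemma br_v1_vtx_x: "1 \<le> l \<Longrightarrow> l < a \<Longrightarrow> c \<cdot> v1 \<cdot> (vtx l \<cdot> x) = c \<cdot> (vtx l \<cdot> x) \<cdot> v1 - c \<cdot> (vtx (Suc l) \<cdot> x)"
  using br_br[of c "vtx l \<cdot> x" v1] vtx_x_v1[of l] by simp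

text \<open>The condition for l = 1 says, by \<open>iv_y_v1x\<close>, that the next diamond is of
  infinite type again. Each step shortens the range of l by one, which limits the length of the
  run.\<close>

lemma infinite_run:
  assumes e: "infinite_vertex e" "e \<noteq> 0" and X: "\<And>l. 1 \<le> l \<Longrightarrow> l + 2 \<le> m \<Longrightarrow> e \<cdot> y \<cdot> (vtx l \<cdot> x) = 0"
    and "i + 2 \<le> m"
  shows "infinite_vertex (left_normed_pow e v1 i) \<and> left_normed_pow e v1 i \<noteq> 0 \<and>
    (\<forall>l. 1 \<le> l \<and> l + i + 2 \<le> m \<longrightarrow> left_normed_pow e v1 i \<cdot> y \<cdot> (vtx l \<cdot> x) = 0)"
  using \<open>i + 2 \<le> m\<close>
proof (induction i)
  case 0
  then show ?case using e X by simp
next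
  case (Suc i)
  let ?e = "left_normed_pow e v1 i"
  have IH: "infinite_vertex ?e" "?e \<noteq> 0"
    and IHX: "\<And>l. 1 \<le> l \<Longrightarrow> l + i + 2 \<le> m \<Longrightarrow> ?e \<cdot> y \<cdot> (vtx l \<cdot> x) = 0"
    using Suc by auto
  have nx: "left_normed_pow e v1 (Suc i) = next_vertex ?e"
    by (simp add: lnp_Suc iv_v1[OF IH(1)])
  have "?e \<cdot> y \<cdot> (v1 \<cdot> x) = 0" using IHX[of 1] Suc.prems by simp
  then have "- (next_vertex ?e \<cdot> x \<cdot> y + next_vertex ?e \<cdot> y \<cdot> x) = 0"
    unfolding iv_y_v1x[OF IH(1)] .
  then have "next_vertex ?e \<cdot> x \<cdot> y + next_vertex ?e \<cdot> y \<cdot> x = 0"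
    by (simp only: neg_equal_0_iff_equal)
  then have "infinite_vertex (next_vertex ?e)" by (rule iv_next_infinite[OF IH(1)])
  moreover have "next_vertex ?e \<cdot> y \<cdot> (vtx l \<cdot> x) = 0" if "1 \<le> l" "l + Suc i + 2 \<le> m" for l
    using br_v1_vtx_x[of l "?e \<cdot> y"] IHX[of l] IHX[of "Suc l"] that a_eq iv_y_v1[OF IH(1)] by simp
  ultimately show ?case unfolding nx using iv_nonzero_next[OF IH] by blast
qed

lemma infinite_run_nonzero:
  assumes e: "infinite_vertex e" "e \<noteq> 0" and X: "\<And>l. 1 \<le> l \<Longrightarrow> l + 2 \<le> m \<Longrightarrow> e \<cdot> y \<cdot> (vtx l \<cdot> x) = 0"
    and "i + 1 \<le> m"
  shows "left_normed_pow e v1 i \<noteq> 0"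
proof (cases i)
  case 0
  then show ?thesis using e by simp
next
  case (Suc j)
  then have j: "infinite_vertex (left_normed_pow e v1 j)" "left_normed_pow e v1 j \<noteq> 0"
    using infinite_run[OF e X, of j] assms(4) by auto
  then show ?thesis using iv_nonzero_next[OF j] iv_v1[OF j(1)] Suc by (simp add: lnp_Suc)
qed

text \<open>When the run of infinite type starts at [w x], this carries its nonvanishing back to
  [w v1^s].\<close>

lemma w_run_x:
  assumes "s + 1 \<le> m"
  shows "left_normed_pow w v1 s \<cdot> x = left_normed_pow (w \<cdot> x) v1 s \<and>
    (\<forall>l. 1 \<le> l \<and> l + s + 1 \<le> m \<longrightarrow> left_normed_pow w v1 s \<cdot> (vtx l \<cdot> x) = 0)"
  using assms
proof (induction s)
  case 0
  then show ?case using w_X by simp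
next
  case (Suc s)
  let ?e = "left_normed_pow w v1 s"
  have IH: "?e \<cdot> x = left_normed_pow (w \<cdot> x) v1 s"
    and IHX: "\<And>l. 1 \<le> l \<Longrightarrow> l + s + 1 \<le> m \<Longrightarrow> ?e \<cdot> (vtx l \<cdot> x) = 0"
    using Suc by auto
  have "?e \<cdot> v1 \<cdot> x = ?e \<cdot> x \<cdot> v1"
    using br_derivation[of ?e v1 x] IHX[of 1] Suc.prems by simp
  moreover have "?e \<cdot> v1 \<cdot> (vtx l \<cdot> x) = 0" if "1 \<le> l" "l + Suc s + 1 \<le> m" for l
    using br_v1_vtx_x[of l ?e] IHX[of l] IHX[of "Suc l"] that a_eq by simp
  ultimately show ?case using IH by (simp add: lnp_Suc)
qed

lemma w_run_nonzero: "s + 1 \<le> m \<Longrightarrow> left_normed_pow w v1 s \<noteq> 0"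
proof (cases "w \<cdot> x \<cdot> x = 0")
  case True
  assume "s + 1 \<le> m"
  then show ?thesis by (intro infinite_run_nonzero w_infinite[OF True] w_nonzero wy_X)
next
  case False
  assume s: "s + 1 \<le> m"
  have "w \<cdot> x \<noteq> 0" using False by auto
  then have "left_normed_pow (w \<cdot> x) v1 s \<noteq> 0"
    using s by (intro infinite_run_nonzero wx_infinite[OF False] wxy_X)
  then show ?thesis using w_run_x[OF s] by auto
qed

text \<open>The correction term is a multiple of [w v_{1+s}], which vanishes in this range, so the
  boundary value stays \<tau>.\<close>

lemma z_vtx:
  assumes tau: "z \<cdot> vtx 2 = scale \<tau> (w \<cdot> v1)"
  shows "1 \<le> s \<Longrightarrow> s + 1 \<le> m \<Longrightarrow> z \<cdot> vtx (1 + s) = scale \<tau> (left_normed_pow w v1 s)"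
proof (induction s rule: nat_induct_at_least)
  case base
  then show ?case using tau by (simp add: lnp_Suc numeral_2_eq_2)
next
  case (Suc s)
  have "vtx (1 + Suc s) = vtx (1 + s) \<cdot> v1" using vtx_v1[of "1 + s"] Suc a_eq by simp
  moreover have "w \<cdot> vtx (1 + s) = 0" using Suc by (intro w_vtx) auto
  ultimately show ?case using Suc by (simp add: br_br[of z] z_v1 br_lin lnp_Suc)
qed

text \<open>The solution of Pascal's recursion with value 2 at s = 0 and value \<tau> at r = 0, s >
  0, where C(s - 1, s) vanishes.\<close>

definition coeff :: "'f \<Rightarrow> nat \<Rightarrow> nat \<Rightarrow> 'f" where
  "coeff \<tau> r s = \<tau> * of_nat ((r + s) choose s) + (2 - \<tau>) * of_nat ((r + s - 1) choose s)"

lemma coeff_rec: "coeff \<tau> (Suc r) (Suc s) = coeff \<tau> (Suc r) s + coeff \<tau> r (Suc s)"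
proof -
  have "(Suc r + Suc s) choose Suc s = ((Suc r + s) choose s) + ((r + Suc s) choose Suc s)"
    by simp
  moreover have "(Suc r + Suc s - 1) choose Suc s = ((Suc r + s - 1) choose s) + ((r + Suc s - 1) choose Suc s)"
    by simp
  ultimately show ?thesis unfolding coeff_def by (simp only: of_nat_add) (simp add: algebra_simps)
qed

text \<open>The condition \<open>r + s \<noteq> 0\<close> excludes [z v1] = (1 + \<mu>) w, which
  need not fit the pattern.\<close>

lemma vtx_vtx_level:
  assumes tau: "z \<cdot> vtx 2 = scale \<tau> (w \<cdot> v1)"
  shows "s + 1 \<le> m \<Longrightarrow> r + s \<noteq> 0 \<Longrightarrow> r + 2 \<le> a \<Longrightarrow> 1 + s + r \<le> a \<Longrightarrow>
    vtx (a - r) \<cdot> vtx (1 + s + r) = scale ((-1) ^ r * coeff \<tau> r s) (left_normed_pow w v1 s)"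
proof (induction s arbitrary: r)
  case 0
  then obtain r' where "r = Suc r'" by (cases r) auto
  then show ?case using vtx_vtx_level1[of r] 0 by (simp add: coeff_def)
next
  case (Suc s)
  from Suc.prems show ?case
  proof (induction r)
    case 0
    then show ?case using z_vtx[OF tau, of "Suc s"] by (simp add: coeff_def z_def binomial_eq_0)
  next
    case (Suc r)
    have 1: "vtx (a - r) \<cdot> vtx (1 + Suc s + r) = scale ((-1) ^ r * coeff \<tau> r (Suc s)) (left_normed_pow w v1 (Suc s))"
      using Suc.IH Suc.prems by simp
    \<comment> \<open>This is the hypothesis of the outer induction on s, quoted by its shape
      because the inner induction on r shadows its name.\<close>
    have 2: "vtx (a - Suc r) \<cdot> vtx (1 + s + Suc r) = scale ((-1) ^ Suc r * coeff \<tau> (Suc r) s) (left_normed_pow w v1 s)"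
      using Suc.prems by (intro \<open>\<And>r. \<lbrakk>s + 1 \<le> m; _ r; _ r; _ r\<rbrakk> \<Longrightarrow> _ r\<close>) auto
    have v: "vtx (a - Suc r) \<cdot> v1 = vtx (a - r)" "vtx (1 + s + Suc r) \<cdot> v1 = vtx (1 + Suc s + Suc r)"
      using vtx_v1[of "a - Suc r"] vtx_v1[of "1 + s + Suc r"] Suc.prems by (simp_all add: Suc_diff_Suc)
    have "1 + s + Suc r = 1 + Suc s + r" by simp
    then have "vtx (a - Suc r) \<cdot> vtx (1 + Suc s + Suc r) =
        vtx (a - Suc r) \<cdot> vtx (1 + s + Suc r) \<cdot> v1 - vtx (a - r) \<cdot> vtx (1 + Suc s + r)"
      using br_br[of "vtx (a - Suc r)" "vtx (1 + s + Suc r)" v1] unfolding v by simp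
    also have "\<dots> = scale ((-1) ^ Suc r * coeff \<tau> (Suc r) s - (-1) ^ r * coeff \<tau> r (Suc s)) (left_normed_pow w v1 (Suc s))"
      unfolding 1 2 by (simp only: br_scale_left lnp_Suc scale_left_diff_distrib)
    also have "(-1) ^ Suc r * coeff \<tau> (Suc r) s - (-1) ^ r * coeff \<tau> r (Suc s) = (-1) ^ Suc r * coeff \<tau> (Suc r) (Suc s)"
      unfolding coeff_rec by (simp add: algebra_simps)
    finally show ?case .
  qed
qed

text \<open>Exchanging the two factors exchanges r and r'. As a is even and s odd, r + r' is even,
  so the signs (-1)^r and (-1)^r' agree.\<close>

lemma coeff_antisym:
  assumes tau: "z \<cdot> vtx 2 = scale \<tau> (w \<cdot> v1)"
    and s: "odd s" "s + 1 \<le> m" and rr: "r + r' + s + 1 = a"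
  shows "coeff \<tau> r' s = - coeff \<tau> r s"
proof -
  have s0: "1 \<le> s" using s(1) by (cases s) auto
  have 1: "vtx (a - r) \<cdot> vtx (1 + s + r) = scale ((-1) ^ r * coeff \<tau> r s) (left_normed_pow w v1 s)"
    using s s0 rr by (intro vtx_vtx_level[OF tau]) auto
  have 2: "vtx (a - r') \<cdot> vtx (1 + s + r') = scale ((-1) ^ r' * coeff \<tau> r' s) (left_normed_pow w v1 s)"
    using s s0 rr by (intro vtx_vtx_level[OF tau]) auto
  have e: "a - r = 1 + s + r'" "a - r' = 1 + s + r" using rr by auto
  have "vtx (1 + s + r) \<cdot> vtx (1 + s + r') = - (vtx (1 + s + r') \<cdot> vtx (1 + s + r))"
    by (rule br_swap)
  then have "scale ((-1) ^ r' * coeff \<tau> r' s) (left_normed_pow w v1 s) =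
      - scale ((-1) ^ r * coeff \<tau> r s) (left_normed_pow w v1 s)"
    unfolding 1[unfolded e] 2[unfolded e] .
  then have "scale ((-1) ^ r' * coeff \<tau> r' s) (left_normed_pow w v1 s) =
      scale (- ((-1) ^ r * coeff \<tau> r s)) (left_normed_pow w v1 s)" by simp
  then have eq: "(-1) ^ r' * coeff \<tau> r' s = - ((-1) ^ r * coeff \<tau> r s)"
    using w_run_nonzero[OF s(2)] scale_cancel_right by blast
  have "even (r + r')" using rr s(1) even_a by presburger
  then have "(-1) ^ r' = ((-1) ^ r :: 'f)" by (cases "even r") auto
  then have "(-1) ^ r * coeff \<tau> r' s = (-1) ^ r * (- coeff \<tau> r s)" using eq by simp
  then show ?thesis by (simp only: mult_cancel_left) simp
qed

section \<open>Binomial coefficients with lower index a power of p\<close>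

text \<open>In Vandermonde's convolution for (b + 1) p^e = p^e + b p^e only the two extreme terms
  survive modulo p, so each step adds 1.\<close>

lemma choose_prime_power_mult: "(of_nat ((b * p ^ e) choose (p ^ e)) :: 'f) = of_nat b"
proof (induction b)
  case 0
  have "0 < p ^ e" using p_gt_3 by simp
  then show ?case by (simp add: binomial_eq_0)
next
  case (Suc b)
  let ?E = "p ^ e"
  have E: "0 < ?E" using p_gt_3 by simp
  have "(Suc b * ?E) choose ?E = (\<Sum>k\<le>?E. (?E choose k) * ((b * ?E) choose (?E - k)))"
    using vandermonde[of ?E "b * ?E" ?E] by simp
  then have "(of_nat ((Suc b * ?E) choose ?E) :: 'f) =
      (\<Sum>k\<le>?E. of_nat (?E choose k) * of_nat ((b * ?E) choose (?E - k)))"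
    by simp
  also have "\<dots> = (\<Sum>k\<in>{0, ?E}. of_nat (?E choose k) * of_nat ((b * ?E) choose (?E - k)))"
  proof (rule sum.mono_neutral_right)
    show "\<forall>k\<in>{..?E} - {0, ?E}. of_nat (?E choose k) * of_nat ((b * ?E) choose (?E - k)) = (0 :: 'f)"
    proof
      fix k assume "k \<in> {..?E} - {0, ?E}"
      then have "(of_nat (?E choose k) :: 'f) = 0"
        using prime_power_dvd_choose[OF prime_p, of k e] by (auto simp: of_nat_0_iff)
      then show "of_nat (?E choose k) * of_nat ((b * ?E) choose (?E - k)) = (0 :: 'f)"
        by (simp only: mult_zero_left)
    qed
  qed auto
  also have "\<dots> = of_nat ((b * ?E) choose ?E) + 1" using E by simp
  also have "\<dots> = of_nat (Suc b)" unfolding Suc.IH by simp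
  finally show ?case .
qed

text \<open>Absorption and cancellation of b give C(b p^e - 1, p^e - 1) = 1 modulo p; Pascal's rule
  does the rest.\<close>

lemma choose_prime_power_mult_minus1:
  assumes "\<not> p dvd b"
  shows "(of_nat ((b * p ^ e - 1) choose (p ^ e)) :: 'f) = of_nat b - 1"
proof -
  let ?E = "p ^ e"
  have E: "0 < ?E" using p_gt_3 by simp
  have b: "0 < b" using assms by (cases b) auto
  have "?E * ((b * ?E) choose ?E) = b * ?E * ((b * ?E - 1) choose (?E - 1))"
    using E by (rule times_binomial_minus1_eq)
  then have "?E * ((b * ?E) choose ?E) = ?E * (b * ((b * ?E - 1) choose (?E - 1)))"
    by (simp only: ac_simps)
  then have "(b * ?E) choose ?E = b * ((b * ?E - 1) choose (?E - 1))"
    using E by (metis mult_cancel1 less_irrefl)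
  then have "(of_nat b :: 'f) = of_nat b * of_nat ((b * ?E - 1) choose (?E - 1))"
    by (metis choose_prime_power_mult of_nat_mult)
  moreover have "(of_nat b :: 'f) \<noteq> 0" using assms by (simp add: of_nat_0_iff)
  ultimately have 1: "(of_nat ((b * ?E - 1) choose (?E - 1)) :: 'f) = 1" by simp
  have "(b * ?E) choose ?E = ((b * ?E - 1) choose (?E - 1)) + ((b * ?E - 1) choose ?E)"
    using E b by (intro choose_reduce_nat) auto
  then have "(of_nat b :: 'f) = 1 + of_nat ((b * ?E - 1) choose ?E)"
    by (metis 1 choose_prime_power_mult of_nat_add)
  then show ?thesis by simp
qed

lemma p_part:
  assumes "0 < n" obtains b e where "n = b * p ^ e" "\<not> p dvd b"
proof -
  have "\<not> is_unit p" using p_gt_3 by simp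
  then obtain b where "n = p ^ multiplicity p n * b" "\<not> p dvd b"
    using multiplicity_decompose'[of n p] assms by auto
  then show ?thesis using that[of b "multiplicity p n"] by (simp add: mult.commute)
qed

lemma double_of_nat: "of_nat b + of_nat b = (0 :: 'f) \<Longrightarrow> p dvd b"
proof -
  assume "of_nat b + of_nat b = (0 :: 'f)"
  then have "2 * of_nat b = (0 :: 'f)" by (simp only: mult_2)
  then show ?thesis by (simp add: of_nat_0_iff)
qed

lemma odd_prime_power: "odd (p ^ e)"
  using p_odd by simp

section \<open>The form of a\<close>

text \<open>Let a - 1 = b p^e with b prime to p. For s = p^e the positions r = 0 and r' = a - 1 -
  p^e have coefficients 1 and 2 b - 1, so antisymmetry gives 2 b = 0. As b is odd, b \<noteq> 1
  means b \<ge> 3, which puts s within range.\<close>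

lemma earliest_single:
  assumes xx: "w \<cdot> x \<cdot> x = 0" shows "\<exists>s. a - 1 = p ^ s"
proof -
  obtain b e where be: "a - 1 = b * p ^ e" "\<not> p dvd b"
    by (rule p_part[of "a - 1"]) (use a_ge in auto)
  let ?E = "p ^ e"
  have E: "1 \<le> ?E" using p_gt_3 by (simp add: Suc_leI)
  have "b = 1"
  proof (rule ccontr)
    assume "b \<noteq> 1"
    have "odd (a - 1)" using even_a a_ge by simp
    then have "odd b" by (metis be(1) even_mult_iff)
    with \<open>b \<noteq> 1\<close> have "3 \<le> b" by presburger
    then have "3 * ?E \<le> a - 1" unfolding be(1) by (rule mult_le_mono1)
    then have s: "?E + 1 \<le> m" using E a_eq by linarith
    have tau: "z \<cdot> vtx 2 = scale 1 (w \<cdot> v1)" using z_v2_single[OF xx] by simp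
    have r: "0 + (a - 1 - ?E) + ?E + 1 = a" using \<open>3 * ?E \<le> a - 1\<close> a_ge by linarith
    have "coeff 1 (a - 1 - ?E) ?E = - coeff 1 0 ?E"
      by (rule coeff_antisym[OF tau odd_prime_power s r])
    moreover have "coeff 1 0 ?E = 1" using E by (simp add: coeff_def binomial_eq_0)
    moreover have "coeff 1 (a - 1 - ?E) ?E = of_nat b + (of_nat b - 1)"
    proof -
      have "a - 1 - ?E + ?E = b * ?E" using r be(1) by linarith
      then show ?thesis unfolding coeff_def
        using choose_prime_power_mult[of b e] choose_prime_power_mult_minus1[OF be(2), of e] by simp
    qed
    ultimately have "of_nat b + of_nat b = (0 :: 'f)" by simp
    then show False using double_of_nat be(2) by blast
  qed
  then show ?thesis using be(1) by auto
qed

text \<open>Let a = b p^e with b prime to p, so b is even. For s = p^e the positions p^e - 1 and a -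
  2 p^e have coefficients 2 and 2 (b - 1), and again 2 b = 0. The range of s requires b \<ge>
  4.\<close>

lemma earliest_double:
  assumes xx: "w \<cdot> x \<cdot> x \<noteq> 0" shows "\<exists>s. a = 2 * p ^ s"
proof -
  obtain b e where be: "a = b * p ^ e" "\<not> p dvd b"
    by (rule p_part[of a]) (use a_ge in auto)
  let ?E = "p ^ e"
  have E: "1 \<le> ?E" using p_gt_3 by (simp add: Suc_leI)
  have "b = 2"
  proof (rule ccontr)
    assume "b \<noteq> 2"
    have "even b" by (metis be(1) even_a even_mult_iff odd_prime_power)
    moreover have "b \<noteq> 0" using be(2) by (cases b) auto
    ultimately have "4 \<le> b" using \<open>b \<noteq> 2\<close> by presburger
    then have le: "4 * ?E \<le> a" unfolding be(1) by (rule mult_le_mono1)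
    then have s: "?E + 1 \<le> m" using E a_eq by linarith
    have r: "(?E - 1) + (a - 2 * ?E) + ?E + 1 = a" using le E by linarith
    have "coeff 2 (a - 2 * ?E) ?E = - coeff 2 (?E - 1) ?E"
      by (rule coeff_antisym[OF z_v2_double[OF xx] odd_prime_power s r])
    moreover have "coeff 2 (?E - 1) ?E = 2 * (2 - 1)"
    proof -
      have "\<not> p dvd 2" using p_gt_3 by (auto dest: dvd_imp_le)
      from choose_prime_power_mult_minus1[OF this, of e]
      have "(of_nat ((2 * ?E - 1) choose ?E) :: 'f) = 2 - 1" by simp
      moreover have "?E - 1 + ?E = 2 * ?E - 1" using E by linarith
      ultimately show ?thesis unfolding coeff_def by simp
    qed
    moreover have "coeff 2 (a - 2 * ?E) ?E = 2 * (of_nat b - 1)"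
    proof -
      have "a - 2 * ?E + ?E = a - ?E" using le E by linarith
      also have "\<dots> = (b - 1) * ?E" unfolding be(1) by (simp add: diff_mult_distrib)
      finally have "a - 2 * ?E + ?E = (b - 1) * ?E" .
      moreover have "(of_nat (b - 1) :: 'f) = of_nat b - 1" using \<open>4 \<le> b\<close> by (simp add: of_nat_diff)
      ultimately show ?thesis unfolding coeff_def using choose_prime_power_mult[of "b - 1" e] by simp
    qed
    ultimately have "2 * (of_nat b - 1) + 2 = (0 :: 'f)" by simp
    then have "of_nat b + of_nat b = (0 :: 'f)" by (simp add: algebra_simps)
    then show False using double_of_nat be(2) by blast
  qed
  then show ?thesis using be(1) by auto
qed

lemma earliest_degree: "(\<exists>s. a - 1 = p ^ s) \<or> ((\<exists>s. a = 2 * p ^ s) \<and> \<mu> = 1)"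
  using earliest_single earliest_double mu_one by blast

end

theorem theorem2:
  fixes scale :: "'f::field \<Rightarrow> 'v::ab_group_add \<Rightarrow> 'v"
    and br :: "'v \<Rightarrow> 'v \<Rightarrow> 'v"
    and L :: "nat \<Rightarrow> 'v set"
    and p q a :: nat
    and x y :: 'v
    and \<mu> :: 'f
  assumes "nottingham_algebra scale br L p q"
    and "lie_algebra.infinite_dimensional scale"
    and "nottingham_algebra.standard_generators scale br L q x y"
    and "thin_lie_algebra.infinite_type_diamond scale br L x y (2 * q - 1)"
    and "nottingham_algebra.earliest_finite_type_diamond scale br L q x y (a * (q - 1) + 1) \<mu>"
  shows "(\<exists>s. a - 1 = p ^ s) \<or> ((\<exists>s. a = 2 * p ^ s) \<and> \<mu> = 1)"
proof -
  interpret nottingham_algebra scale br L p q by fact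
  have q5: "q > 5"
    using nottingham_algebra_axioms by (simp add: nottingham_algebra_def nottingham_algebra_axioms_def)
  have "q < a * (q - 1) + 1"
    using assms(5) unfolding earliest_finite_type_diamond_def by blast
  then have "2 \<le> a" using q5 by (cases a; cases "a - 1") auto
  show ?thesis
  proof (cases "a = 2")
    case True
    \<comment> \<open>For a = 2 the conclusion holds with exponent 0. The case is split off because
      the main argument needs v_{a-1} to be a vertex of infinite type.\<close>
    then show ?thesis by (intro disjI1 exI[of _ 0]) simp
  next
    case False
    have q1: "q - 3 + 2 = q - 1" using q5 by simp
    interpret nottingham_earliest_finite scale br L p q x y "q - 3" a \<mu>
    proof unfold_locales
      show "standard_generators x y" "infinite_dimensional" "infinite_type_diamond x y (2 * q - 1)"
        by fact+
      show "q = q - 3 + 3" using q5 by simp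
      show "3 \<le> a" using False \<open>2 \<le> a\<close> by simp
      show "earliest_finite_type_diamond x y (a * (q - 3 + 2) + 1) \<mu>" unfolding q1 by fact
    qed
    show ?thesis by (rule earliest_degree)
  qed
qed

end
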